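(* Let $r\in\{1,6\}$ and $s\ge1$. There exists a unique twisted isomorphism $p:B(s\Lambda_r)\to B(s\Lambda_r)$, induced by the $E_6^{(1)}$ Dynkin diagram automorphism $\dot p$ given by $0\mapsto1\mapsto6\mapsto0$, $2\mapsto3\mapsto5\mapsto2$, $4\mapsto4$, of order three such that each node $b\in B(s\Lambda_r)$ is mapped to a node $p(b)$ with affine level-$0$ weight $\dot p(\mathrm{wt}(b))$, i.e. $\mathrm{wt}_{\dot p(i)}(p(b))=\mathrm{wt}_i(b)$ for all $i\in\{0,1,\dots,6\}$.
   Context: The $E_6^{(1)}$ Dynkin diagram has nodes $0,1,\dots,6$ and edges $1-3$, $3-4$, $4-5$, $5-6$, $4-2$, $2-0$; removing node $0$ gives $E_6$ with index set $I=\{1,\dots,6\}$ and fundamental weights $\Lambda_1,\dots,\Lambda_6$. $B(\lambda)$ is the type $E_6$ crystal of the irreducible highest weight $U_q(E_6)$-module with dominant highest weight $\lambda$, with crystal operators $e_i,f_i:B(\lambda)\to B(\lambda)\cup\{\mathbf 0\}$, $i\in I$. Level-0 weights: for $b$ in a classical $E_6$ crystal and $i\in I$, $\mathrm{wt}_i(b)=\langle\alpha_i^\vee,\mathrm{wt}(b)\rangle$, and $\mathrm{wt}_0(b)$ is defined by requiring level $0$: $\mathrm{wt}_0+\mathrm{wt}_1+\mathrm{wt}_6+2(\mathrm{wt}_2+\mathrm{wt}_3+\mathrm{wt}_5)+3\,\mathrm{wt}_4=0$. The affine level-0 weight of $b$ is $\sum_{i=0}^6\mathrm{wt}_i(b)\Lambda_i$,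 and $\dot p$ acts on affine weights by $\Lambda_i\mapsto\Lambda_{\dot p(i)}$. Twisted isomorphism: a bijection $p:B\cup\{\mathbf 0\}\to B'\cup\{\mathbf 0\}$ between classical crystals is a twisted isomorphism induced by $\dot p$ if $p(b)=\mathbf 0$ iff $b=\mathbf 0$, and $p\circ f_i(b)=f_{\dot p(i)}\circ p(b)$ and $p\circ e_i(b)=e_{\dot p(i)}\circ p(b)$ for all $i\in I\setminus\{\dot p^{-1}(0)\}=\{1,\dots,5\}$ and $b\in B$. *)

theory Defs
  imports
    Complex_Main
    "HOL-Library.FuncSet"
    "HOL-Computational_Algebra.Polynomial"
    "HOL-Computational_Algebra.Fraction_Field"
begin

section \<open>The Dynkin diagrams of type $E_6^{(1)}$ and $E_6$\<close>

definition aff_index :: "nat set" where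
  "aff_index = {0..6}"

definition E6_index :: "nat set" where
  "E6_index = {1..6}"

definition aff_edges :: "nat set set" where
  "aff_edges = {{1,3}, {3,4}, {4,5}, {5,6}, {4,2}, {2,0}}"

definition cartan :: "nat \<Rightarrow> nat \<Rightarrow> int" where
  "cartan i j = (if i = j then 2 else if {i, j} \<in> aff_edges then -1 else 0)"

definition pdot :: "nat \<Rightarrow> nat" where
  "pdot = id (0 := 1, 1 := 6, 6 := 0, 2 := 3, 3 := 5, 5 := 2)"

lemma pdot_diagram_automorphism:
  "bij_betw pdot aff_index aff_index"
  "\<forall>i\<in>aff_index. \<forall>j\<in>aff_index. cartan (pdot i) (pdot j) = cartan i j"
  "\<forall>i\<in>aff_index. pdot (pdot (pdot i)) = i"
proof -
  have ai: "aff_index = {0,1,2,3,4,5,6}"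
    by (auto simp: aff_index_def)
  show "bij_betw pdot aff_index aff_index"
    unfolding ai bij_betw_def inj_on_def by (auto simp: pdot_def)
  show "\<forall>i\<in>aff_index. \<forall>j\<in>aff_index. cartan (pdot i) (pdot j) = cartan i j"
    unfolding ai by (simp add: pdot_def cartan_def aff_edges_def doubleton_eq_iff)
  show "\<forall>i\<in>aff_index. pdot (pdot (pdot i)) = i"
    unfolding ai by (simp add: pdot_def)
qed

text \<open>Only the values \<open>\<mu> i = \<langle>\<alpha>\<^sub>i\<^sup>\<or>, \<mu>\<rangle>\<close> for \<open>i\<close> in \<^const>\<open>E6_index\<close>
  are meaningful for a classical weight \<open>\<mu> :: nat \<Rightarrow> int\<close>.\<close>

definition Lambda :: "nat \<Rightarrow> nat \<Rightarrow> int" where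
  "Lambda r i = (if i = r then 1 else 0)"


section \<open>Classical crystals and twisted isomorphisms\<close>

text \<open>The value \<^const>\<open>None\<close> plays the role of the extra element $\mathbf 0$, so that
  $B \cup \{\mathbf 0\}$ is \<^term>\<open>insert None (Some ` B)\<close>.\<close>

record 'b crystal =
  nodes :: "'b set"
  e_op :: "nat \<Rightarrow> 'b \<Rightarrow> 'b option"
  f_op :: "nat \<Rightarrow> 'b \<Rightarrow> 'b option"
  wt :: "nat \<Rightarrow> 'b \<Rightarrow> int"

definition nodes0 :: "'b crystal \<Rightarrow> 'b option set" where
  "nodes0 C = insert None (Some ` nodes C)"

text \<open>The operators extended by $\mathbf 0 \mapsto \mathbf 0$.\<close>

definition e0 :: "'b crystal \<Rightarrow> nat \<Rightarrow> 'b option \<Rightarrow> 'b option" where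
  "e0 C i x = Option.bind x (e_op C i)"

definition f0 :: "'b crystal \<Rightarrow> nat \<Rightarrow> 'b option \<Rightarrow> 'b option" where
  "f0 C i x = Option.bind x (f_op C i)"

text \<open>The coefficient at index 0 is fixed by the level-0 condition.\<close>

definition aff_wt :: "'b crystal \<Rightarrow> nat \<Rightarrow> 'b \<Rightarrow> int" where
  "aff_wt C i b =
     (if i = 0
      then - (wt C 1 b + wt C 6 b + 2 * (wt C 2 b + wt C 3 b + wt C 5 b) + 3 * wt C 4 b)
      else wt C i b)"

definition twisted_isomorphism ::
  "(nat \<Rightarrow> nat) \<Rightarrow> 'b crystal \<Rightarrow> 'c crystal \<Rightarrow> ('b option \<Rightarrow> 'c option) \<Rightarrow> bool" where
  "twisted_isomorphism \<pi> C C' p \<longleftrightarrow>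
     bij_betw p (nodes0 C) (nodes0 C') \<and>
     (\<forall>x\<in>nodes0 C. p x = None \<longleftrightarrow> x = None) \<and>
     (\<forall>i\<in>E6_index. \<pi> i \<noteq> 0 \<longrightarrow>
        (\<forall>b\<in>nodes C. p (f0 C i (Some b)) = f0 C' (\<pi> i) (p (Some b)) \<and>
                      p (e0 C i (Some b)) = e0 C' (\<pi> i) (p (Some b))))"


section \<open>Crystal bases of modules over $U_q(E_6)$\<close>

type_synonym Qq = "rat poly fract"  \<comment> \<open>the field $\mathbb{Q}(q)$\<close>

definition qq :: Qq where
  "qq = Fract [:0, 1:] 1"

definition Qq_of_rat :: "rat \<Rightarrow> Qq" where
  "Qq_of_rat c = Fract [:c:] 1"

text \<open>The rational functions that are regular at $q = 0$.\<close>

definition A0 :: "Qq set" where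
  "A0 = {Fract a b | a b. poly b 0 \<noteq> 0}"

definition qint :: "nat \<Rightarrow> Qq" where
  "qint n = (qq ^ n - inverse qq ^ n) / (qq - inverse qq)"

definition qfact :: "nat \<Rightarrow> Qq" where
  "qfact n = (\<Prod>k=1..n. qint k)"

text \<open>A $U_q(E_6)$-module is a $\mathbb{Q}(q)$-vector space with operators satisfying the
  defining relations of the Chevalley generators $E_i, F_i, K_i^{\pm 1}$; the
  inverse \<^term>\<open>inv (K i)\<close> is the action of $K_i^{-1}$.\<close>

locale Uq_E6_module = vector_space scale
  for scale :: "Qq \<Rightarrow> 'v \<Rightarrow> 'v::ab_group_add" (infixr \<open>*s\<close> 75) +
  fixes E F K :: "nat \<Rightarrow> 'v \<Rightarrow> 'v"
  assumes linear_E: "i \<in> E6_index \<Longrightarrow> Vector_Spaces.linear (*s) (*s) (E i)"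
    and linear_F: "i \<in> E6_index \<Longrightarrow> Vector_Spaces.linear (*s) (*s) (F i)"
    and linear_K: "i \<in> E6_index \<Longrightarrow> Vector_Spaces.linear (*s) (*s) (K i)"
    and bij_K: "i \<in> E6_index \<Longrightarrow> bij (K i)"
    and K_K: "\<lbrakk>i \<in> E6_index; j \<in> E6_index\<rbrakk> \<Longrightarrow> K i (K j v) = K j (K i v)"
    and K_E: "\<lbrakk>i \<in> E6_index; j \<in> E6_index\<rbrakk> \<Longrightarrow> K i (E j v) = (qq powi cartan i j) *s E j (K i v)"
    and K_F: "\<lbrakk>i \<in> E6_index; j \<in> E6_index\<rbrakk> \<Longrightarrow> K i (F j v) = (qq powi (- cartan i j)) *s F j (K i v)"
    and E_F: "\<lbrakk>i \<in> E6_index; j \<in> E6_index\<rbrakk> \<Longrightarrow>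
       E i (F j v) - F j (E i v) =
         (if i = j then (1 / (qq - inverse qq)) *s (K i v - inv (K i) v) else 0)"
    and E_comm: "\<lbrakk>i \<in> E6_index; j \<in> E6_index; cartan i j = 0\<rbrakk> \<Longrightarrow> E i (E j v) = E j (E i v)"
    and F_comm: "\<lbrakk>i \<in> E6_index; j \<in> E6_index; cartan i j = 0\<rbrakk> \<Longrightarrow> F i (F j v) = F j (F i v)"
    and E_serre: "\<lbrakk>i \<in> E6_index; j \<in> E6_index; cartan i j = -1\<rbrakk> \<Longrightarrow>
       E i (E i (E j v)) - (qq + inverse qq) *s E i (E j (E i v)) + E j (E i (E i v)) = 0"
    and F_serre: "\<lbrakk>i \<in> E6_index; j \<in> E6_index; cartan i j = -1\<rbrakk> \<Longrightarrow>
       F i (F i (F j v)) - (qq + inverse qq) *s F i (F j (F i v)) + F j (F i (F i v)) = 0"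
begin

definition weight_space :: "(nat \<Rightarrow> int) \<Rightarrow> 'v set" where
  "weight_space \<mu> = {v. \<forall>i\<in>E6_index. K i v = (qq powi \<mu> i) *s v}"

definition irreducible_module :: bool where
  "irreducible_module \<longleftrightarrow> (UNIV :: 'v set) \<noteq> {0} \<and>
     (\<forall>W. subspace W \<and>
          (\<forall>i\<in>E6_index. E i ` W \<subseteq> W \<and> F i ` W \<subseteq> W \<and> K i ` W \<subseteq> W \<and> inv (K i) ` W \<subseteq> W)
        \<longrightarrow> W = {0} \<or> W = UNIV)"

definition highest_weight_vector :: "(nat \<Rightarrow> int) \<Rightarrow> 'v \<Rightarrow> bool" where
  "highest_weight_vector \<mu> u \<longleftrightarrow> u \<noteq> 0 \<and> u \<in> weight_space \<mu> \<and> (\<forall>i\<in>E6_index. E i u = 0)"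

definition integrable :: bool where
  "integrable \<longleftrightarrow> span (\<Union>\<mu>. weight_space \<mu>) = UNIV \<and>
     (\<forall>i\<in>E6_index. \<forall>v. (\<exists>n. (E i ^^ n) v = 0) \<and> (\<exists>n. (F i ^^ n) v = 0))"

definition F_div :: "nat \<Rightarrow> nat \<Rightarrow> 'v \<Rightarrow> 'v" where
  "F_div i k v = inverse (qfact k) *s (F i ^^ k) v"

text \<open>Kashiwara's operators. An integrable module is spanned by the vectors $F_i^{(k)} v$
  with $E_i v = 0$, $K_i v = q^n v$ and $0 \le k \le n$, and the operators raise and lower the
  exponent \<open>k\<close>. The bound \<open>k \<le> n\<close> makes the operators well defined, as
  $F_i^{(k)} v = 0$ for \<open>k > n\<close>.\<close>

definition e_tilde :: "nat \<Rightarrow> 'v \<Rightarrow> 'v" where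
  "e_tilde i = (THE T. Vector_Spaces.linear (*s) (*s) T \<and>
     (\<forall>n k v. E i v = 0 \<and> K i v = (qq ^ n) *s v \<and> k \<le> n \<longrightarrow>
        T (F_div i k v) = (if k = 0 then 0 else F_div i (k - 1) v)))"

definition f_tilde :: "nat \<Rightarrow> 'v \<Rightarrow> 'v" where
  "f_tilde i = (THE T. Vector_Spaces.linear (*s) (*s) T \<and>
     (\<forall>n k v. E i v = 0 \<and> K i v = (qq ^ n) *s v \<and> k \<le> n \<longrightarrow>
        T (F_div i k v) = F_div i (Suc k) v))"

definition A_span :: "'v set \<Rightarrow> 'v set" where
  "A_span X = {\<Sum>x\<in>S. c x *s x | S c. finite S \<and> S \<subseteq> X \<and> c ` S \<subseteq> A0}"

text \<open>A crystal lattice is a free \<^const>\<open>A0\<close>-submodule generating the module over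
  $\mathbb{Q}(q)$, compatible with the weight space decomposition and stable under Kashiwara's
  operators.\<close>

definition crystal_lattice :: "'v set \<Rightarrow> bool" where
  "crystal_lattice L \<longleftrightarrow>
     (\<exists>X. independent X \<and> span X = UNIV \<and> L = A_span X) \<and>
     L = A_span (\<Union>\<mu>. L \<inter> weight_space \<mu>) \<and>
     (\<forall>i\<in>E6_index. e_tilde i ` L \<subseteq> L \<and> f_tilde i ` L \<subseteq> L)"

text \<open>Elements of $L / qL$ are represented by cosets.\<close>

definition coset :: "'v set \<Rightarrow> 'v \<Rightarrow> 'v set" where
  "coset L v = {v + qq *s w | w. w \<in> L}"

definition quotient_space :: "'v set \<Rightarrow> 'v set set" where
  "quotient_space L = coset L ` L"

definition induced :: "'v set \<Rightarrow> ('v \<Rightarrow> 'v) \<Rightarrow> 'v set \<Rightarrow> 'v set" where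
  "induced L T b = (\<Union>v\<in>b. coset L (T v))"

text \<open>Every class in $L / qL$ is a unique finite $\mathbb{Q}$-linear combination of
  elements of \<open>B\<close>; the combination is computed on representatives.\<close>

definition Q_basis :: "'v set \<Rightarrow> 'v set set \<Rightarrow> bool" where
  "Q_basis L B \<longleftrightarrow> B \<subseteq> quotient_space L \<and>
     (\<forall>v\<in>L. \<exists>!c :: 'v set \<Rightarrow> rat. finite {b. c b \<noteq> 0} \<and> {b. c b \<noteq> 0} \<subseteq> B \<and>
        (\<Sum>b | c b \<noteq> 0. Qq_of_rat (c b) *s (SOME w. w \<in> b)) \<in> coset L v)"

definition crystal_base :: "'v set \<Rightarrow> 'v set set \<Rightarrow> bool" where
  "crystal_base L B \<longleftrightarrow>
     integrable \<and> crystal_lattice L \<and> Q_basis L B \<and>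
     (\<forall>b\<in>B. \<exists>\<mu>. b \<inter> weight_space \<mu> \<noteq> {}) \<and>
     (\<forall>i\<in>E6_index. \<forall>b\<in>B. induced L (e_tilde i) b \<in> insert (coset L 0) B \<and>
                        induced L (f_tilde i) b \<in> insert (coset L 0) B) \<and>
     (\<forall>i\<in>E6_index. \<forall>b\<in>B. \<forall>b'\<in>B.
        induced L (f_tilde i) b = b' \<longleftrightarrow> induced L (e_tilde i) b' = b)"

inductive_set f_strings :: "'v \<Rightarrow> 'v set" for u where
  start: "u \<in> f_strings u"
| step: "\<lbrakk>v \<in> f_strings u; i \<in> E6_index\<rbrakk> \<Longrightarrow> f_tilde i v \<in> f_strings u"

definition class_option :: "'v set \<Rightarrow> 'v set \<Rightarrow> 'v set option" where
  "class_option L b = (if b = coset L 0 then None else Some b)"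

definition class_weight :: "nat \<Rightarrow> 'v set \<Rightarrow> int" where
  "class_weight i b = (THE n. \<exists>\<mu>. \<mu> i = n \<and> b \<inter> weight_space \<mu> \<noteq> {})"

definition crystal_of :: "'v set \<Rightarrow> 'v set set \<Rightarrow> 'v set crystal" where
  "crystal_of L B =
     \<lparr>nodes = B,
      e_op = (\<lambda>i b. class_option L (induced L (e_tilde i) b)),
      f_op = (\<lambda>i b. class_option L (induced L (f_tilde i) b)),
      wt = class_weight\<rparr>"

end

text \<open>Kashiwara's crystal base $(L(\lambda), B(\lambda))$ of the irreducible module with highest
  weight $\lambda$ and highest weight vector $u$: the lattice is generated by all
  $\tilde f_{i_1} \cdots \tilde f_{i_k} u$, and the base consists of their nonzero classes
  modulo $q L(\lambda)$. Kashiwara's existence theorem says that \<open>is_crystal_base\<close> follows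
  from the other assumptions for dominant $\lambda$.\<close>

locale highest_weight_crystal_base = Uq_E6_module scale E F K
  for scale :: "Qq \<Rightarrow> 'v \<Rightarrow> 'v::ab_group_add" (infixr \<open>*s\<close> 75)
    and E F K :: "nat \<Rightarrow> 'v \<Rightarrow> 'v" +
  fixes \<mu> :: "nat \<Rightarrow> int" and u :: 'v and L :: "'v set" and B :: "'v set set"
  assumes irreducible: irreducible_module
    and highest_weight: "highest_weight_vector \<mu> u"
    and L_def: "L = A_span (f_strings u)"
    and B_def: "B = coset L ` f_strings u - {coset L 0}"
    and is_crystal_base: "crystal_base L B"

end

theory Submission
  imports Defs "HOL-Library.Function_Algebras" "HOL-Library.Product_Plus"
begin

text \<open>Deleting node 6 of the diagram \<open>E\<^sub>6\<close> leaves a diagram of type \<open>D\<^sub>5\<close> on the nodes 1 to 5, deleting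
node 1 leaves one on the nodes 2 to 6, and the diagram automorphism carries the first to the second.
A twisted isomorphism is therefore an isomorphism from \<open>B(s\<Lambda>\<^sub>r)\<close>, seen as a crystal of the left
\<open>D\<^sub>5\<close>, to \<open>B(s\<Lambda>\<^sub>r)\<close>, seen as a crystal of the right \<open>D\<^sub>5\<close>. It is determined by the images of
the highest weight elements of the components. Uniqueness holds because a highest weight element
for the right \<open>D\<^sub>5\<close> is determined by its \<open>E\<^sub>6\<close> weight (\<open>right_highest_unique\<close>), and the level-zero
condition prescribes this weight. Existence needs a weight-preserving matching of the highest
weight elements, and the fact that the component of a highest weight element depends, up to
isomorphism, only on its weight.

Both are made explicit by words. The minuscule crystal \<open>B(\<Lambda>\<^sub>r)\<close> has 27 elements, called letters here
and given by the multiplicities of the simple roots in \<open>\<Lambda>\<^sub>r\<close> minus the weight. The component of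
\<open>top ... top\<close> in the crystal of words of length \<open>s\<close> consists of the standard words, those that
decrease weakly for the componentwise order on depths (\<open>standard_component\<close>). A standard word is a
highest weight element for either \<open>D\<^sub>5\<close> iff all its letters are (\<open>standard_highest\<close>), and each
\<open>D\<^sub>5\<close> has three highest weight letters, which form a chain. The diagram automorphism acts linearly
on level-zero weights, permutes the letters, and maps the left chain to the right chain in reverse
order. Hence \<open>x \<mapsto> map p1 (rev x)\<close> matches the left highest standard words with the right ones
(\<open>reversal\<close>), and \<open>f\<^sub>l x \<mapsto> map p1 (f\<^sub>l (rev x))\<close>, for \<open>l\<close> a sequence of nodes of the left \<open>D\<^sub>5\<close>, is the
twisted isomorphism (\<open>promote\<close>).

The representation theory consists of two statements: the crystal base of the module is isomorphic
to the component of words just described (\<open>word_of_bij\<close> and its companions), and the component of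
\<open>x\<close> is isomorphic to that of \<open>rev x\<close> (\<open>word_fs_transport\<close>). Both follow from the tensor power of the
minuscule module, with its form for which the words are orthonormal. For this form \<open>F\<^sub>i\<close> is adjoint to
\<open>q\<^sup>-\<^sup>1 K\<^sub>i E\<^sub>i\<close>. Leading terms of a sum of squares over \<open>\<rat>(q)\<close> cannot cancel, so a vector \<open>x\<close> lies in the
lattice of words iff \<open>(x, x)\<close> is regular at \<open>q = 0\<close>, it lies in \<open>q\<close> times this lattice iff \<open>(x, x)\<close>
vanishes at \<open>q = 0\<close>, and \<open>(x, x) = 0\<close> forces \<open>x = 0\<close>. As \<open>sl\<^sub>2\<close>-strings are orthogonal, Kashiwara's
operators preserve the lattice, and modulo \<open>q\<close> they act on words by the signature rule
(\<open>wft_wet_basis_vec\<close>).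

Two highest weight vectors \<open>u1\<close>, \<open>u2\<close> of equal weight in two modules are compared by the submodule
\<open>D\<close> of the product generated by \<open>(u1, u2)\<close>. It is integrable, hence closed under simultaneous
application of Kashiwara's operators (\<open>D_tilde\<close>). If the first module is irreducible and the second
consists of words, definiteness of the form makes \<open>D\<close> the graph of a map that commutes with
Kashiwara's operators (\<open>D_zero\<close>, \<open>D_total\<close>). If both consist of words, the pairings of the left
components of elements of such submodules agree with those of the right components
(\<open>diagonal_isometry\<close>), and these pairings decide which words are equal modulo \<open>q\<close>.\<close>

section \<open>Quantum integers\<close>

lemma qq_nonzero [simp]: "qq \<noteq> 0"
  by (simp add: qq_def Zero_fract_def eq_fract)

lemma qq_power: "qq ^ n = Fract ([:0, 1:] ^ n) 1"
  by (induction n) (simp_all add: qq_def One_fract_def)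

lemma qq_power_eq_1_iff: "qq ^ n = 1 \<longleftrightarrow> n = 0"
proof
  assume "qq ^ n = 1"
  then have "[:0, 1::rat:] ^ n = 1"
    by (simp add: qq_power One_fract_def eq_fract)
  then have "degree ([:0, 1::rat:] ^ n) = 0" by simp
  then show "n = 0" by (simp add: degree_power_eq)
qed simp

lemma qq_powi_eq_1_iff: "qq powi a = 1 \<longleftrightarrow> a = 0"
proof -
  have "qq ^ nat a = 1 \<longleftrightarrow> a = 0" if "a \<ge> 0"
    using that by (simp add: qq_power_eq_1_iff)
  moreover have "inverse qq ^ nat (- a) = 1 \<longleftrightarrow> a = 0" if "a < 0"
    using that by (simp add: qq_power_eq_1_iff power_inverse)
  ultimately show ?thesis by (simp add: power_int_def)
qed

lemma qq_powi_nonzero [simp]: "qq powi a \<noteq> 0"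
  by (simp add: power_int_eq_0_iff)

lemma qq_powi_inject: "qq powi a = qq powi b \<longleftrightarrow> a = b"
proof -
  have "qq powi a = qq powi b \<longleftrightarrow> qq powi (a - b) = 1"
    by (auto simp: power_int_diff)
  then show ?thesis by (simp add: qq_powi_eq_1_iff)
qed

lemma qq_powi_add: "qq powi (a + b) = qq powi a * qq powi b"
  by (simp add: power_int_add)

lemma qq_diff_nonzero: "qq - inverse qq \<noteq> 0"
proof
  assume "qq - inverse qq = 0"
  then have "qq powi 1 = qq powi (-1)" by (simp add: power_int_minus)
  then show False by (simp only: qq_powi_inject)
qed

text \<open>Quantum integers with integer argument: the number \<open>[n - k]\<close> in the commutation rule along a string
becomes negative past the end of the string.\<close>

definition qi :: "int \<Rightarrow> Qq" where
  "qi n = (qq powi n - qq powi (- n)) / (qq - inverse qq)"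

lemma qint_qi: "qint n = qi (int n)"
  by (simp add: qint_def qi_def power_int_minus power_inverse)

lemma qi_0 [simp]: "qi 0 = 0" and qi_1 [simp]: "qi 1 = 1"
  using qq_diff_nonzero by (simp_all add: qi_def power_int_minus)

lemma qi_minus: "qi (- n) = - qi n"
  by (simp add: qi_def minus_divide_left)

lemma qi_eq_0_iff [simp]: "qi n = 0 \<longleftrightarrow> n = 0"
  using qq_diff_nonzero qq_powi_inject[of n "- n"] by (auto simp: qi_def)

lemma qi_add: "qi (a + b) = qq powi (- b) * qi a + qq powi a * qi b"
proof -
  have "qq powi (- (a + b)) = qq powi (- a) * qq powi (- b)" by (simp flip: qq_powi_add)
  moreover define d where "d = qq - inverse qq"
  ultimately show ?thesis
    by (simp add: qi_def qq_powi_add algebra_simps flip: add_divide_distrib diff_divide_distrib d_def)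
qed

lemma qi_product:
  "qi a * qi b = (qq powi (a + b) + qq powi (- (a + b)) - qq powi (a - b) - qq powi (b - a))
     / (qq - inverse qq)\<^sup>2"
proof -
  have "qq powi (a - b) = qq powi a * qq powi (- b)" "qq powi (b - a) = qq powi b * qq powi (- a)"
    "qq powi (- (a + b)) = qq powi (- a) * qq powi (- b)"
    by (simp_all flip: qq_powi_add)
  moreover define d where "d = qq - inverse qq"
  ultimately show ?thesis
    by (simp add: qi_def qq_powi_add power2_eq_square algebra_simps flip: d_def)
qed

lemma qi_string_step: "qi k * qi (n - k + 1) + qi (n - 2 * k) = qi (k + 1) * qi (n - k)"
proof -
  have "qi (n - 2 * k) = qi 1 * qi (n - 2 * k)" by simp
  also have "qi k * qi (n - k + 1) + \<dots> = qi (k + 1) * qi (n - k)"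
    unfolding qi_product add_divide_distrib [symmetric]
    by (simp add: algebra_simps)
  finally show ?thesis .
qed

text \<open>The two hypotheses compare the eigenvalues of \<open>K\<close> and of \<open>F E\<close> on the \<open>k\<close>-th vector of a string of
length \<open>n\<close>. Given the first, the second compares \<open>q^(n+1) + q^(-n-1)\<close>, which determines \<open>n \<ge> 0\<close>.\<close>

lemma qi_string_inj:
  assumes "n - 2 * k = n' - 2 * k'" "n \<ge> 0" "n' \<ge> 0"
    and "qi k * qi (n - k + 1) = qi k' * qi (n' - k' + 1)"
  shows "n = n'" "k = k'"
proof -
  let ?d = "(qq - inverse qq)\<^sup>2"
  have d: "?d \<noteq> 0" using qq_diff_nonzero by simp
  have *: "?d * (qi k * qi (n - k + 1)) = qq powi (n + 1) + qq powi (- (n + 1))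
     - qq powi (2 * k - n - 1) - qq powi (n - 2 * k + 1)" for n k
  proof -
    have e: "k + (n - k + 1) = n + 1" "k - (n - k + 1) = 2 * k - n - 1"
      "(n - k + 1) - k = n - 2 * k + 1" by simp_all
    show ?thesis unfolding qi_product e using d by simp
  qed
  have "qq powi (n + 1) + qq powi (- (n + 1)) = qq powi (n' + 1) + qq powi (- (n' + 1))"
  proof -
    have e: "2 * k - n - 1 = 2 * k' - n' - 1" "n - 2 * k + 1 = n' - 2 * k' + 1"
      using assms(1) by simp_all
    have "?d * (qi k * qi (n - k + 1)) = ?d * (qi k' * qi (n' - k' + 1))"
      using assms(4) by simp
    then show ?thesis unfolding * e by simp
  qed
  then have "(qq powi (n + 1) - qq powi (n' + 1)) * (1 - qq powi (- (n + 1) - (n' + 1))) = 0"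
    by (simp add: algebra_simps flip: qq_powi_add)
  then have "n + 1 = n' + 1 \<or> - (n + 1) - (n' + 1) = 0"
    by (auto simp: qq_powi_inject qq_powi_eq_1_iff[symmetric])
  then show "n = n'" using assms(2,3) by auto
  then show "k = k'" using assms(1) by simp
qed

lemma qfact_0 [simp]: "qfact 0 = 1" by (simp add: qfact_def)
lemma qfact_Suc: "qfact (Suc n) = qfact n * qint (Suc n)" by (simp add: qfact_def)
lemma qint_nonzero: "n > 0 \<Longrightarrow> qint n \<noteq> 0" by (simp add: qint_qi)
lemma qfact_nonzero [simp]: "qfact n \<noteq> 0"
  by (induction n) (simp_all add: qfact_Suc qint_nonzero)

section \<open>The local ring at zero\<close>

lemma A0_I: "poly b 0 \<noteq> 0 \<Longrightarrow> Fract a b \<in> A0" by (auto simp: A0_def)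

lemma A0_add: assumes "x \<in> A0" "y \<in> A0" shows "x + y \<in> A0"
proof -
  obtain a b where x: "x = Fract a b" "poly b 0 \<noteq> 0" using assms by (auto simp: A0_def)
  obtain c d where y: "y = Fract c d" "poly d 0 \<noteq> 0" using assms by (auto simp: A0_def)
  have "b \<noteq> 0" "d \<noteq> 0" using x y by auto
  then show ?thesis using x y by (auto intro!: A0_I)
qed

lemma A0_mult: assumes "x \<in> A0" "y \<in> A0" shows "x * y \<in> A0"
proof -
  obtain a b where x: "x = Fract a b" "poly b 0 \<noteq> 0" using assms by (auto simp: A0_def)
  obtain c d where y: "y = Fract c d" "poly d 0 \<noteq> 0" using assms by (auto simp: A0_def)
  then show ?thesis using x y by (auto intro!: A0_I)
qed

lemma A0_rat [simp]: "Qq_of_rat c \<in> A0" by (auto simp: Qq_of_rat_def intro!: A0_I)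
lemma Qq_of_rat_0 [simp]: "Qq_of_rat 0 = 0" and Qq_of_rat_1 [simp]: "Qq_of_rat 1 = 1"
  by (simp_all add: Qq_of_rat_def Zero_fract_def One_fract_def flip: one_pCons)
lemma Qq_of_rat_add: "Qq_of_rat (a + b) = Qq_of_rat a + Qq_of_rat b"
  and Qq_of_rat_mult: "Qq_of_rat (a * b) = Qq_of_rat a * Qq_of_rat b"
  by (simp_all add: Qq_of_rat_def mult.commute)
lemma A0_0 [simp]: "0 \<in> A0" and A0_1 [simp]: "1 \<in> A0"
  using A0_rat[of 0] A0_rat[of 1] by simp_all
lemma A0_qq [simp]: "qq \<in> A0" by (simp add: qq_def A0_I)
lemma A0_uminus: "x \<in> A0 \<Longrightarrow> - x \<in> A0"
  using A0_mult[OF A0_rat[of "-1"], of x] Qq_of_rat_add[of 1 "-1"]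
  by (simp add: add_eq_0_iff)
lemma A0_diff: "x \<in> A0 \<Longrightarrow> y \<in> A0 \<Longrightarrow> x - y \<in> A0"
  using A0_add[of x "- y"] A0_uminus by simp
lemma A0_sum: "(\<And>x. x \<in> S \<Longrightarrow> f x \<in> A0) \<Longrightarrow> sum f S \<in> A0"
  by (induction S rule: infinite_finite_induct) (auto intro: A0_add)
lemma A0_power: "x \<in> A0 \<Longrightarrow> x ^ n \<in> A0"
  by (induction n) (auto intro: A0_mult)

text \<open>The maximal ideal of the local ring \<^const>\<open>A0\<close>.\<close>

definition m0 :: "Qq set" where "m0 = (*) qq ` A0"

lemma m0_I: "x \<in> A0 \<Longrightarrow> qq * x \<in> m0" by (simp add: m0_def)
lemma m0_E: assumes "x \<in> m0" obtains y where "y \<in> A0" "x = qq * y"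
  using assms by (auto simp: m0_def)
lemma m0_A0: "x \<in> m0 \<Longrightarrow> x \<in> A0" by (auto simp: m0_def intro: A0_mult)
lemma m0_0 [simp]: "0 \<in> m0" using m0_I[of 0] by simp
lemma m0_add: "x \<in> m0 \<Longrightarrow> y \<in> m0 \<Longrightarrow> x + y \<in> m0"
  by (elim m0_E) (simp add: m0_I A0_add flip: distrib_left)
lemma m0_mult: "x \<in> A0 \<Longrightarrow> y \<in> m0 \<Longrightarrow> x * y \<in> m0"
  by (elim m0_E) (simp add: m0_I A0_mult mult.left_commute[of x])
lemma m0_mult': "y \<in> m0 \<Longrightarrow> x \<in> A0 \<Longrightarrow> y * x \<in> m0"
  using m0_mult[of x y] by (simp add: mult.commute)
lemma m0_uminus: "x \<in> m0 \<Longrightarrow> - x \<in> m0"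
  using m0_mult[OF A0_uminus[OF A0_1], of x] by simp
lemma m0_diff: "x \<in> m0 \<Longrightarrow> y \<in> m0 \<Longrightarrow> x - y \<in> m0"
  using m0_add[of x "- y"] m0_uminus by simp
lemma m0_sum: "(\<And>x. x \<in> S \<Longrightarrow> f x \<in> m0) \<Longrightarrow> sum f S \<in> m0"
  by (induction S rule: infinite_finite_induct) (auto intro: m0_add)
lemma m0_cancel: "qq * x \<in> m0 \<longleftrightarrow> x \<in> A0" by (auto simp: m0_def)

text \<open>The residue field of \<^const>\<open>A0\<close> is \<open>\<rat>\<close>. That it is formally real is what makes the form on words
anisotropic at \<open>q = 0\<close>.\<close>

lemma A0_residue:
  assumes "x \<in> A0" obtains c where "x - Qq_of_rat c \<in> m0"
proof -
  obtain a b where x: "x = Fract a b" "poly b 0 \<noteq> 0" using assms by (auto simp: A0_def)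
  define c where "c = poly a 0 / poly b 0"
  have b: "b \<noteq> 0" using x by auto
  have "poly (a - [:c:] * b) 0 = 0" using x by (simp add: c_def)
  then have "[:0, 1:] dvd a - [:c:] * b"
    using poly_eq_0_iff_dvd[of "a - [:c:] * b" 0] by simp
  then obtain r where r: "a - [:c:] * b = [:0, 1:] * r" by (rule dvdE)
  have "x - Qq_of_rat c = Fract (a - [:c:] * b) b"
    using b x by (simp add: Qq_of_rat_def)
  also have "\<dots> = qq * Fract r b" unfolding r qq_def by simp
  finally show ?thesis using that m0_I A0_I[OF x(2), of r] by metis
qed

lemma rat_m0: assumes "Qq_of_rat c \<in> m0" shows "c = 0"
proof -
  obtain a b where x: "Qq_of_rat c = qq * Fract a b" "poly b 0 \<noteq> 0"
    using assms by (auto simp: A0_def m0_def)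
  have "b \<noteq> 0" using x by auto
  then have "[:c:] * b = [:0, 1:] * a"
    using x by (simp add: Qq_of_rat_def qq_def eq_fract)
  then have "poly ([:c:] * b) 0 = poly ([:0, 1:] * a) 0" by simp
  then show ?thesis using x by simp
qed

lemma one_notin_m0: "1 \<notin> m0" using rat_m0[of 1] by auto

lemma A0_inverse: assumes "x - 1 \<in> m0" shows "inverse x \<in> A0"
proof -
  obtain a b where y: "x - 1 = qq * Fract a b" "poly b 0 \<noteq> 0"
    using assms by (auto simp: A0_def m0_def)
  have "b \<noteq> 0" using y by auto
  moreover have "x = 1 + qq * Fract a b" using y by (simp add: algebra_simps)
  ultimately have "x = Fract (b + [:0, 1:] * a) b"
    by (simp add: qq_def One_fract_def)
  then have "inverse x = Fract b (b + [:0, 1:] * a)" by simp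
  then show ?thesis using y by (auto intro!: A0_I)
qed

lemma eventually_A0: "\<exists>N. qq ^ N * x \<in> A0"
proof (cases x)
  case (Fract a b)
  then have b: "b \<noteq> 0" by simp
  obtain r where r: "b = [:0, 1:] ^ order 0 b * r" "\<not> [:0, 1:] dvd r"
    using order_decomp[OF b, of 0] by auto
  then have r0: "poly r 0 \<noteq> 0" using poly_eq_0_iff_dvd[of r 0] by simp
  have "qq ^ order 0 b * x = Fract ([:0, 1:] ^ order 0 b * a) b"
    using Fract by (simp add: qq_power)
  also have "\<dots> = Fract ([:0, 1:] ^ order 0 b * a) ([:0, 1:] ^ order 0 b * r)"
    using r(1) by metis
  also have "\<dots> = Fract a r" by (rule mult_fract_cancel) simp
  finally show ?thesis using A0_I[OF r0] by metis
qed

text \<open>Modulo \<open>q\<close> this is a vanishing sum of squares of rational numbers.\<close>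

lemma sum_squares_m0_aux:
  assumes "finite S" "\<And>i. i \<in> S \<Longrightarrow> x i \<in> A0" "(\<Sum>i\<in>S. x i * x i) \<in> m0" "i \<in> S"
  shows "x i \<in> m0"
proof -
  have "\<forall>i\<in>S. \<exists>c. x i - Qq_of_rat c \<in> m0" using A0_residue assms(2) by metis
  then obtain c where c: "\<And>i. i \<in> S \<Longrightarrow> x i - Qq_of_rat (c i) \<in> m0" by metis
  have "x i * x i - Qq_of_rat (c i * c i) \<in> m0" if "i \<in> S" for i
  proof -
    have "x i * x i - Qq_of_rat (c i * c i) =
      x i * (x i - Qq_of_rat (c i)) + Qq_of_rat (c i) * (x i - Qq_of_rat (c i))"
      by (simp add: Qq_of_rat_mult algebra_simps)
    then show ?thesis using m0_add m0_mult assms(2) c that by simp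
  qed
  then have "(\<Sum>i\<in>S. x i * x i - Qq_of_rat (c i * c i)) \<in> m0" by (rule m0_sum)
  then have "(\<Sum>i\<in>S. x i * x i) - (\<Sum>i\<in>S. x i * x i - Qq_of_rat (c i * c i)) \<in> m0"
    using assms(3) m0_diff by blast
  moreover have "(\<Sum>i\<in>T. Qq_of_rat (f i)) = Qq_of_rat (sum f T)" if "finite T" for T and f :: "'a \<Rightarrow> rat"
    using that by induction (simp_all add: Qq_of_rat_add)
  ultimately have "Qq_of_rat (\<Sum>i\<in>S. c i * c i) \<in> m0"
    using assms(1) by (simp add: sum_subtractf)
  then have "(\<Sum>i\<in>S. c i * c i) = 0" by (rule rat_m0)
  then have "c i = 0"
    using assms(1,4) by (simp add: sum_nonneg_eq_0_iff)
  then show ?thesis using c[OF assms(4)] by simp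
qed

text \<open>The leading terms of the squares cannot cancel: as long as some power of \<open>q\<close> is needed to make all
\<open>x i\<close> regular, the preceding lemma shows that one factor \<open>q\<close> can be saved.\<close>

lemma sum_squares_A0:
  assumes "finite S" "(\<Sum>i\<in>S. x i * x i) \<in> A0" "i \<in> S"
  shows "x i \<in> A0"
proof -
  have "\<exists>N. \<forall>i\<in>S. qq ^ N * x i \<in> A0" using assms(1)
  proof induction
    case (insert j S)
    obtain M N where M: "qq ^ M * x j \<in> A0" and N: "\<forall>i\<in>S. qq ^ N * x i \<in> A0"
      using insert eventually_A0 by blast
    have "qq ^ (M + N) * x j \<in> A0"
      using A0_mult[OF A0_power[OF A0_qq, of N] M] by (simp add: power_add mult_ac)
    moreover have "qq ^ (M + N) * x i \<in> A0" if "i \<in> S" for i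
      using A0_mult[OF A0_power[OF A0_qq, of M] N[rule_format, OF that]] by (simp add: power_add mult_ac)
    ultimately show ?case by (intro exI[of _ "M + N"]) auto
  qed simp
  then obtain N where "\<forall>i\<in>S. qq ^ N * x i \<in> A0" by blast
  then have "\<forall>i\<in>S. x i \<in> A0"
  proof (induction N)
    case (Suc N)
    have "(\<Sum>i\<in>S. (qq ^ Suc N * x i) * (qq ^ Suc N * x i)) = qq * ((qq * (qq ^ N * qq ^ N)) * (\<Sum>i\<in>S. x i * x i))"
      by (simp add: sum_distrib_left algebra_simps)
    moreover have "\<dots> \<in> m0" by (intro m0_I A0_mult A0_power A0_qq assms(2))
    ultimately have "\<forall>i\<in>S. qq ^ Suc N * x i \<in> m0"
      using sum_squares_m0_aux[OF assms(1), of "\<lambda>i. qq ^ Suc N * x i"] Suc.prems by metis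
    then show ?case using Suc.IH by (simp add: mult.assoc m0_cancel)
  qed simp
  then show ?thesis using assms(3) by simp
qed

lemma sum_squares_m0:
  assumes "finite S" "(\<Sum>i\<in>S. x i * x i) \<in> m0" "i \<in> S"
  shows "x i \<in> m0"
  using sum_squares_m0_aux[OF assms(1) _ assms(2,3)] sum_squares_A0[OF assms(1) m0_A0[OF assms(2)]]
  by blast

lemma sum_squares_eq_0:
  assumes "finite S" "(\<Sum>i\<in>S. x i * x i) = 0" "i \<in> S"
  shows "x i = (0 :: Qq)"
proof -
  \<comment> \<open>All multiples of \<open>x i\<close> vanish at \<open>q = 0\<close>.\<close>
  have inv: "c * x i \<in> m0" for c
  proof (rule sum_squares_m0[OF assms(1) _ assms(3)])
    have "(\<Sum>i\<in>S. c * x i * (c * x i)) = c * c * (\<Sum>i\<in>S. x i * x i)"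
      by (simp add: sum_distrib_left mult_ac)
    then show "(\<Sum>i\<in>S. c * x i * (c * x i)) \<in> m0" using assms(2) by simp
  qed
  show ?thesis
  proof (rule ccontr)
    assume "x i \<noteq> 0"
    then show False using inv[of "inverse (x i)"] one_notin_m0 by simp
  qed
qed

lemma qint_Suc_Suc: "qint (Suc (Suc k)) = inverse qq * qint (Suc k) + qq ^ Suc k"
proof -
  have "qi (int (Suc k) + 1) = qq powi (-1) * qi (int (Suc k)) + qq powi int (Suc k) * qi 1"
    by (rule qi_add)
  then show ?thesis
    by (simp add: qint_qi power_int_minus add.commute del: power_Suc flip: power_int_of_nat)
qed

text \<open>The quantum integer \<open>[k + 1]\<close> has leading term \<open>q^(-k)\<close>; this controls all coefficients met below.\<close>

lemma qint_leading: "qq ^ k * qint (Suc k) - 1 \<in> m0"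
proof (induction k)
  case 0 then show ?case by (simp add: qint_qi)
next
  case (Suc k)
  have "qq ^ Suc k * qint (Suc (Suc k)) - 1 = qq ^ Suc k * (inverse qq * qint (Suc k) + qq ^ Suc k) - 1"
    by (simp add: qint_Suc_Suc)
  also have "\<dots> = (qq ^ k * qint (Suc k) - 1) + qq * (qq ^ k * qq ^ Suc k)"
    by (simp add: algebra_simps)
  finally have "qq ^ Suc k * qint (Suc (Suc k)) - 1 = (qq ^ k * qint (Suc k) - 1) + qq * (qq ^ k * qq ^ Suc k)" .
  then show ?case using Suc.IH m0_add m0_I[OF A0_mult[OF A0_power A0_power]] A0_qq by metis
qed

lemma qint_leading_A0: "qq ^ k * qint (Suc k) \<in> A0"
  using A0_add[OF m0_A0[OF qint_leading] A0_1] by simp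

lemma qint_leading_inverse: "inverse (qq ^ k * qint (Suc k)) \<in> A0"
  using A0_inverse[OF qint_leading] .

section \<open>Integrable modules over one copy of quantum sl2\<close>

lemma linear_map_simps:
  assumes "Vector_Spaces.linear s t f"
  shows "f (x + y) = f x + f y" "f (s c x) = t c (f x)" "f 0 = 0" "f (x - y) = f x - f y"
    "f (sum g A) = (\<Sum>a\<in>A. f (g a))"
proof -
  interpret Vector_Spaces.linear s t f by fact
  show "f (x + y) = f x + f y" "f (s c x) = t c (f x)" "f 0 = 0" "f (x - y) = f x - f y"
    "f (sum g A) = (\<Sum>a\<in>A. f (g a))"
    by (simp_all add: add scale zero diff sum)
qed

lemma sum_extend_by_zero:
  assumes "finite B" "A \<subseteq> B" "\<And>a. h a 0 = 0"
  shows "(\<Sum>a\<in>B. h a (if a \<in> A then z a else 0)) = (\<Sum>a\<in>A. h a (z a))"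
  using assms by (intro sum.mono_neutral_cong_right) auto

context vector_space
begin

lemma span_Union_subspaces:
  assumes "\<And>i. i \<in> I \<Longrightarrow> subspace (P i)" and "x \<in> span (\<Union>i\<in>I. P i)"
  shows "\<exists>A z. finite A \<and> A \<subseteq> I \<and> (\<forall>i\<in>A. z i \<in> P i) \<and> x = sum z A"
proof -
  have "\<exists>A z. finite A \<and> A \<subseteq> I \<and> (\<forall>i\<in>A. z i \<in> P i) \<and> (\<forall>i. i \<notin> A \<longrightarrow> z i = 0) \<and> x = sum z A"
    using assms(2)
  proof (induction rule: span_induct_alt)
    case base
    then show ?case by (intro exI[of _ "{}"] exI[of _ "\<lambda>_. 0"]) simp
  next
    case (step c a y)
    then obtain A z where A: "finite A" "A \<subseteq> I" "\<forall>i\<in>A. z i \<in> P i" "\<forall>i. i \<notin> A \<longrightarrow> z i = 0"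
      "y = sum z A" by auto
    from step obtain j where j: "j \<in> I" "a \<in> P j" by auto
    define z' where "z' = z(j := z j + scale c a)"
    have zj: "z j \<in> P j" using A(3,4) assms(1)[OF j(1)] subspace_0 by (cases "j \<in> A") auto
    have "sum z' (insert j A) = scale c a + sum z A"
    proof (cases "j \<in> A")
      case True
      then show ?thesis using A(1)
        by (simp add: z'_def insert_absorb sum.remove[of A j] add_ac)
    next
      case False
      have "sum z' A = sum z A" using False by (intro sum.cong) (auto simp: z'_def)
      then show ?thesis using False A by (simp add: z'_def)
    qed
    moreover have "\<forall>i\<in>insert j A. z' i \<in> P i"
      using A(3) zj j assms(1)[OF j(1)] by (auto simp: z'_def intro: subspace_add subspace_scale)
    moreover have "\<forall>i. i \<notin> insert j A \<longrightarrow> z' i = 0" using A(4) by (auto simp: z'_def)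
    ultimately show ?case using A(1,2,5) j(1)
      by (intro exI[of _ "insert j A"] exI[of _ z']) auto
  qed
  then show ?thesis by blast
qed

text \<open>Simultaneous eigenvectors add up to zero, and \<open>a\<close> is told apart from each other index by some
operator. For \<open>b \<in> B\<close>, an operator that tells \<open>a\<close> from \<open>b\<close>, minus its eigenvalue at \<open>b\<close>, removes the
summand at \<open>b\<close> and multiplies the one at \<open>a\<close> by a nonzero scalar.\<close>

lemma separated_eigenvector_zero:
  assumes "finite B" "a \<notin> B"
    and "\<And>i. i \<in> I \<Longrightarrow> Vector_Spaces.linear scale scale (H i)"
    and "\<And>i b. i \<in> I \<Longrightarrow> b \<in> insert a B \<Longrightarrow> H i (z b) = scale (c i b) (z b)"
    and "\<And>b. b \<in> B \<Longrightarrow> \<exists>i\<in>I. c i a \<noteq> c i b"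
    and "sum z (insert a B) = 0"
  shows "z a = 0"
  using assms(1,2,4-6)
proof (induction B arbitrary: z)
  case empty
  then show ?case by simp
next
  case (insert b B)
  obtain i where i: "i \<in> I" "c i a \<noteq> c i b" using insert.prems(3)[of b] by auto
  note lin = linear_map_simps[OF assms(3)[OF i(1)]]
  define z' where "z' x = scale (c i x - c i b) (z x)" for x
  have "sum z' (insert b (insert a B)) = H i (sum z (insert b (insert a B)))
      - scale (c i b) (sum z (insert b (insert a B)))"
    unfolding lin(5) scale_sum_right sum_subtractf [symmetric]
    using insert.prems(2)[OF i(1)] by (intro sum.cong) (auto simp: z'_def scale_left_diff_distrib)
  also have "\<dots> = 0" using insert.prems(4) by (simp add: insert_commute lin(3))
  finally have "sum z' (insert b (insert a B)) = 0" .
  moreover have "b \<notin> insert a B" "z' b = 0"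
    using insert.hyps insert.prems(1) by (auto simp: z'_def)
  ultimately have "sum z' (insert a B) = 0"
    using insert.hyps(1) by simp
  moreover have "H j (z' d) = scale (c j d) (z' d)" if "j \<in> I" "d \<in> insert a B" for j d
    using insert.prems(2)[of j d] that linear_map_simps(2)[OF assms(3)[OF that(1)]]
    by (auto simp: z'_def mult.commute)
  ultimately have "z' a = 0"
    using insert.prems(1,3) by (intro insert.IH[of z']) auto
  then show ?case using i(2) by (simp add: z'_def)
qed

end

text \<open>An integrable module over one copy of quantum \<open>sl\<^sub>2\<close>, carried by a subspace, so that the same operators
can be restricted to words of a given length or to a submodule of a product. The relations are
stated on weight vectors only; this expresses the commutator of \<open>E\<close> and \<open>F\<close> by a quantum integer
in place of the inverse of \<open>K\<close>.\<close>

locale sl2_module = vector_space scale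
  for scale :: "Qq \<Rightarrow> 'v \<Rightarrow> 'v::ab_group_add" (infixr \<open>*s\<close> 75) +
  fixes S :: "'v set" and E F K :: "'v \<Rightarrow> 'v"
  assumes subspace_S: "subspace S"
    and linear_E: "Vector_Spaces.linear (*s) (*s) E"
    and linear_F: "Vector_Spaces.linear (*s) (*s) F"
    and linear_K: "Vector_Spaces.linear (*s) (*s) K"
    and E_closed: "v \<in> S \<Longrightarrow> E v \<in> S"
    and F_closed: "v \<in> S \<Longrightarrow> F v \<in> S"
    and K_E: "\<lbrakk>v \<in> S; K v = (qq powi n) *s v\<rbrakk> \<Longrightarrow> K (E v) = (qq powi (n + 2)) *s E v"
    and K_F: "\<lbrakk>v \<in> S; K v = (qq powi n) *s v\<rbrakk> \<Longrightarrow> K (F v) = (qq powi (n - 2)) *s F v"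
    and E_F: "\<lbrakk>v \<in> S; K v = (qq powi n) *s v\<rbrakk> \<Longrightarrow> E (F v) = F (E v) + qi n *s v"
    and weight_span: "S \<subseteq> span {v \<in> S. \<exists>n. K v = (qq powi n) *s v}"
    and E_nilpotent: "v \<in> S \<Longrightarrow> \<exists>n. (E ^^ n) v = 0"
    and F_nilpotent: "v \<in> S \<Longrightarrow> \<exists>n. (F ^^ n) v = 0"
begin

lemmas E_lin = linear_map_simps[OF linear_E]
lemmas F_lin = linear_map_simps[OF linear_F]
lemmas K_lin = linear_map_simps[OF linear_K]

text \<open>The space \<open>strings (n, k)\<close> consists of the \<open>k\<close>-th vectors \<open>F^(k) v\<close> of the strings of length \<open>n\<close>.
The module is the direct sum of these spaces for \<open>k \<le> n\<close>.\<close>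

definition hw :: "nat \<Rightarrow> 'v \<Rightarrow> bool" where
  "hw n v \<longleftrightarrow> v \<in> S \<and> E v = 0 \<and> K v = (qq ^ n) *s v"

definition Fdiv :: "nat \<Rightarrow> 'v \<Rightarrow> 'v" where
  "Fdiv k v = inverse (qfact k) *s (F ^^ k) v"

definition strings :: "nat \<times> nat \<Rightarrow> 'v set" where
  "strings a = {Fdiv (snd a) v | v. hw (fst a) v}"

definition string_index :: "(nat \<times> nat) set" where
  "string_index = {(n, k). k \<le> n}"

lemma F_pow_closed: "v \<in> S \<Longrightarrow> (F ^^ k) v \<in> S"
  by (induction k) (auto intro: F_closed)

lemma F_pow_weight:
  assumes "v \<in> S" "K v = (qq powi n) *s v"
  shows "K ((F ^^ k) v) = (qq powi (n - 2 * int k)) *s (F ^^ k) v"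
proof (induction k)
  case (Suc k)
  then show ?case using K_F[OF F_pow_closed[OF assms(1)] Suc.IH] by (simp add: algebra_simps)
qed (use assms in simp)

lemma F_pow_lin: "(F ^^ k) (x + y) = (F ^^ k) x + (F ^^ k) y" "(F ^^ k) (c *s x) = c *s (F ^^ k) x"
  "(F ^^ k) 0 = 0"
  by (induction k) (simp_all add: F_lin)

lemma E_F_pow:
  assumes "v \<in> S" "K v = (qq powi n) *s v"
  shows "E ((F ^^ k) v) = (F ^^ k) (E v) + (qi (int k) * qi (n - int k + 1)) *s (F ^^ (k - 1)) v"
proof (induction k)
  case (Suc k)
  let ?y = "(F ^^ k) v"
  have FF: "(qi (int k) * qi (n - int k + 1)) *s F ((F ^^ (k - 1)) v) = (qi (int k) * qi (n - int k + 1)) *s ?y"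
    by (cases k) simp_all
  have "E (F ?y) = F (E ?y) + qi (n - 2 * int k) *s ?y"
    by (rule E_F[OF F_pow_closed F_pow_weight]) fact+
  also have "F (E ?y) = (F ^^ Suc k) (E v) + (qi (int k) * qi (n - int k + 1)) *s ?y"
    by (simp only: Suc.IH F_lin FF funpow.simps o_apply)
  finally have "E (F ?y) = (F ^^ Suc k) (E v) + (qi (int k) * qi (n - int k + 1) + qi (n - 2 * int k)) *s ?y"
    by (simp add: scale_left_distrib add.assoc)
  then show ?case unfolding qi_string_step by (simp add: algebra_simps)
qed simp

text \<open>Let \<open>F^b v\<close> be the last nonzero vector in the sequence. Then \<open>E F^(b+1) v = 0\<close> equals
\<open>[b+1] [n-b] F^b v\<close>, so \<open>n = b\<close>.\<close>

lemma singular_vector_weight: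
  assumes "v \<in> S" "K v = (qq powi n) *s v" "F (E v) = 0" "v \<noteq> 0"
  obtains m where "n = int m" "(F ^^ Suc m) v = 0"
proof -
  define a where "a = (LEAST a. (F ^^ a) v = 0)"
  have a: "(F ^^ a) v = 0" unfolding a_def using F_nilpotent[OF assms(1)] by (rule LeastI_ex)
  have "a \<noteq> 0" using a assms(4) by (cases "a = 0") auto
  then obtain b where b: "a = Suc b" by (cases a) auto
  have nz: "(F ^^ b) v \<noteq> 0" using not_less_Least[of b "\<lambda>a. (F ^^ a) v = 0"] b unfolding a_def by simp
  have "(F ^^ Suc b) (E v) = 0"
    by (simp only: funpow_Suc_right o_apply assms(3) F_pow_lin)
  then have "(qi (int (Suc b)) * qi (n - int (Suc b) + 1)) *s (F ^^ b) v = 0"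
    using E_F_pow[OF assms(1,2), of "Suc b"] a b by (simp add: E_lin)
  then have "n = int b" using nz by simp
  then show ?thesis using that a b by blast
qed

lemma Fdiv_lin: "Fdiv k (x + y) = Fdiv k x + Fdiv k y" "Fdiv k (c *s x) = c *s Fdiv k x" "Fdiv k 0 = 0"
  by (simp_all add: Fdiv_def F_pow_lin scale_right_distrib mult.commute)

lemma Fdiv_0 [simp]: "Fdiv 0 v = v" by (simp add: Fdiv_def)

lemma F_Fdiv: "F (Fdiv k v) = qint (Suc k) *s Fdiv (Suc k) v"
  by (simp add: Fdiv_def F_lin qfact_Suc qint_nonzero)

lemma Fdiv_eqI:
  assumes "z 0 = v" and "\<And>k. F (z k) = qint (Suc k) *s z (Suc k)"
  shows "Fdiv k v = z k"
proof (induction k)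
  case (Suc k)
  have "qint (Suc k) *s Fdiv (Suc k) v = qint (Suc k) *s z (Suc k)"
    using Suc F_Fdiv[of k v] assms(2)[of k] by metis
  then show ?case using qint_nonzero[of "Suc k"] by simp
qed (simp add: assms)

lemma Fdiv_closed: "v \<in> S \<Longrightarrow> Fdiv k v \<in> S"
  by (simp add: Fdiv_def subspace_scale subspace_S F_pow_closed)

lemma hw_D: "hw n v \<Longrightarrow> v \<in> S" "hw n v \<Longrightarrow> E v = 0" "hw n v \<Longrightarrow> K v = (qq powi int n) *s v"
  by (simp_all add: hw_def)

lemma Fdiv_weight: "hw n v \<Longrightarrow> K (Fdiv k v) = (qq powi (int n - 2 * int k)) *s Fdiv k v"
  using F_pow_weight[OF hw_D(1,3), of n v n k] by (simp add: Fdiv_def K_lin mult.commute)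

lemma E_Fdiv:
  assumes "hw n v" shows "E (Fdiv (Suc k) v) = qi (int n - int k) *s Fdiv k v"
proof -
  have "E ((F ^^ Suc k) v) = (qint (Suc k) * qi (int n - int k)) *s (F ^^ k) v"
    using E_F_pow[OF hw_D(1,3)[OF assms], of "Suc k"] hw_D(2)[OF assms]
    by (simp add: F_pow_lin F_lin qint_qi)
  then show ?thesis
    by (simp add: Fdiv_def E_lin qfact_Suc qint_nonzero del: funpow.simps)
qed

lemma Fdiv_end: assumes "hw n v" shows "Fdiv (Suc n) v = 0"
proof (cases "v = 0")
  case False
  obtain m where "int n = int m" "(F ^^ Suc m) v = 0"
    using singular_vector_weight[OF hw_D(1,3)[OF assms]] hw_D(2)[OF assms] False F_lin(3) by metis
  then show ?thesis by (simp add: Fdiv_def)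
qed (simp add: Fdiv_lin)

lemma hw_subspace: "subspace {v. hw n v}"
  using subspace_S unfolding hw_def subspace_def
  by (auto simp: E_lin K_lin scale_right_distrib mult.commute)

lemma strings_subspace: "subspace (strings a)"
proof -
  have s: "subspace {v. hw (fst a) v}" by (rule hw_subspace)
  have "subspace (Fdiv (snd a) ` {v. hw (fst a) v})"
    unfolding subspace_def
  proof safe
    show "0 \<in> Fdiv (snd a) ` {v. hw (fst a) v}"
      using subspace_0[OF s] by (intro image_eqI[of _ _ 0]) (simp_all add: Fdiv_lin)
    show "Fdiv (snd a) v + Fdiv (snd a) w \<in> Fdiv (snd a) ` {v. hw (fst a) v}"
      if "hw (fst a) v" "hw (fst a) w" for v w
      using subspace_add[OF s, of v w] that by (intro image_eqI[of _ _ "v + w"]) (simp_all add: Fdiv_lin)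
    show "c *s Fdiv (snd a) v \<in> Fdiv (snd a) ` {v. hw (fst a) v}"
      if "hw (fst a) v" for v c
      using subspace_scale[OF s, of v c] that by (intro image_eqI[of _ _ "c *s v"]) (simp_all add: Fdiv_lin)
  qed
  moreover have "strings a = Fdiv (snd a) ` {v. hw (fst a) v}" by (auto simp: strings_def)
  ultimately show ?thesis by simp
qed

lemma strings_closed: "x \<in> strings a \<Longrightarrow> x \<in> S"
  by (auto simp: strings_def hw_D Fdiv_closed)

lemma strings_weight: "x \<in> strings (n, k) \<Longrightarrow> K x = (qq powi (int n - 2 * int k)) *s x"
  by (auto simp: strings_def Fdiv_weight)

lemma strings_F_E: "x \<in> strings (n, k) \<Longrightarrow> F (E x) = (qi (int k) * qi (int n - int k + 1)) *s x"
  by (cases k) (auto simp: strings_def E_Fdiv F_Fdiv F_lin hw_D(2) qint_qi algebra_simps)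

text \<open>Induction on the nilpotency order of \<open>E\<close>: a preimage of \<open>E x\<close> along strings is subtracted from \<open>x\<close>.
What remains is killed by \<open>E\<close>, or it has negative weight and vanishes because \<open>F\<close> is locally
nilpotent.\<close>

lemma weight_vector_in_strings:
  assumes "x \<in> S" "K x = (qq powi p) *s x" "(E ^^ m) x = 0"
  shows "x \<in> span (\<Union>a\<in>{(n, k). k \<le> n \<and> int n - 2 * int k = p}. strings a)"
  using assms
proof (induction m arbitrary: x p)
  case 0
  then show ?case by (simp add: span_zero)
next
  case (Suc m)
  define I where "I p = {(n, k). k \<le> n \<and> int n - 2 * int k = p}" for p
  have Ex: "E x \<in> span (\<Union>a\<in>I (p + 2). strings a)"
    unfolding I_def using Suc.prems
    by (intro Suc.IH E_closed K_E) (simp_all add: funpow_swap1)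
  obtain A z where A: "finite A" "A \<subseteq> I (p + 2)" "\<And>a. a \<in> A \<Longrightarrow> z a \<in> strings a" "E x = sum z A"
    using span_Union_subspaces[OF strings_subspace Ex] by blast
  have "\<forall>a\<in>A. \<exists>v. hw (fst a) v \<and> z a = Fdiv (snd a) v" using A(3) by (auto simp: strings_def)
  then obtain v where v: "\<And>a. a \<in> A \<Longrightarrow> hw (fst a) (v a)" "\<And>a. a \<in> A \<Longrightarrow> z a = Fdiv (snd a) (v a)"
    by metis
  \<comment> \<open>Summands before the end of their strings lie in the image of \<open>E\<close>; those in \<open>A2\<close> are at
  the end of their strings and are killed by \<open>F\<close>.\<close>
  define A1 where "A1 = {a \<in> A. snd a < fst a}"
  define A2 where "A2 = {a \<in> A. snd a = fst a}"
  define y where "y = (\<Sum>a\<in>A1. inverse (qi (int (fst a) - int (snd a))) *s Fdiv (Suc (snd a)) (v a))"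
  have A12: "A = A1 \<union> A2" "A1 \<inter> A2 = {}" using A(2) by (auto simp: A1_def A2_def I_def)
  have Ey: "E y = sum z A1"
    unfolding y_def E_lin by (intro sum.cong refl) (auto simp: A1_def E_Fdiv[OF v(1)] v(2) E_lin)
  have term_in: "inverse (qi (int (fst a) - int (snd a))) *s Fdiv (Suc (snd a)) (v a) \<in> strings (fst a, Suc (snd a))
      \<and> (fst a, Suc (snd a)) \<in> I p" if "a \<in> A1" for a
  proof
    have "Fdiv (Suc (snd a)) (v a) \<in> strings (fst a, Suc (snd a))"
      using v(1)[of a] that by (auto simp: strings_def A1_def)
    then show "inverse (qi (int (fst a) - int (snd a))) *s Fdiv (Suc (snd a)) (v a) \<in> strings (fst a, Suc (snd a))"
      by (rule subspace_scale[OF strings_subspace])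
    show "(fst a, Suc (snd a)) \<in> I p" using that A(2) by (auto simp: A1_def I_def)
  qed
  have yspan: "y \<in> span (\<Union>a\<in>I p. strings a)" unfolding y_def
    using term_in by (intro span_sum span_base) blast
  have yS: "y \<in> S" unfolding y_def
    using term_in strings_closed by (intro subspace_sum[OF subspace_S]) blast
  have yK: "K y = (qq powi p) *s y" unfolding y_def K_lin(5) scale_sum_right
  proof (intro sum.cong refl)
    fix a assume "a \<in> A1"
    from term_in[OF this] show "K (inverse (qi (int (fst a) - int (snd a))) *s Fdiv (Suc (snd a)) (v a)) =
      (qq powi p) *s inverse (qi (int (fst a) - int (snd a))) *s Fdiv (Suc (snd a)) (v a)"
      using strings_weight by (auto simp: I_def)
  qed
  define x' where "x' = x - y"
  have x': "x' \<in> S" "K x' = (qq powi p) *s x'"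
    using Suc.prems yS yK subspace_S by (simp_all add: x'_def subspace_diff K_lin scale_right_diff_distrib)
  have Ex': "E x' = sum z A2"
    using A(1,4) A12 by (simp add: x'_def E_lin Ey sum.union_disjoint)
  have FEx': "F (E x') = 0"
    unfolding Ex' F_lin by (intro sum.neutral) (auto simp: A2_def v(2) F_Fdiv Fdiv_end[OF v(1)])
  have "x' \<in> span (\<Union>a\<in>I p. strings a)"
  proof (cases "x' = 0")
    case False
    then obtain m where m: "p = int m" using singular_vector_weight[OF x' FEx'] by metis
    \<comment> \<open>The end of a string has weight \<open>-n\<close>, which would have to be \<open>m + 2\<close>.\<close>
    then have "A2 = {}" using A(2) by (auto simp: A2_def I_def)
    then have "hw m x'" using x' Ex' m by (simp add: hw_def)
    then have "x' \<in> strings (m, 0)" by (force simp: strings_def)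
    moreover have "(m, 0) \<in> I p" using m by (simp add: I_def)
    ultimately show ?thesis by (intro span_base) blast
  qed (simp add: span_zero)
  then have "x' + y \<in> span (\<Union>a\<in>I p. strings a)" using yspan by (rule span_add)
  then show ?case by (simp add: x'_def I_def)
qed

lemma string_decomposition:
  assumes "x \<in> S"
  shows "\<exists>A z. finite A \<and> A \<subseteq> string_index \<and> (\<forall>a\<in>A. z a \<in> strings a) \<and> x = sum z A"
proof -
  have "{v \<in> S. \<exists>n. K v = (qq powi n) *s v} \<subseteq> span (\<Union>a\<in>string_index. strings a)"
  proof clarify
    fix v n assume v: "v \<in> S" "K v = (qq powi n) *s v"
    obtain m where "(E ^^ m) v = 0" using E_nilpotent v by blast
    with v have "v \<in> span (\<Union>a\<in>{(n', k). k \<le> n' \<and> int n' - 2 * int k = n}. strings a)"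
      by (rule weight_vector_in_strings)
    moreover have "(\<Union>a\<in>{(n', k). k \<le> n' \<and> int n' - 2 * int k = n}. strings a) \<subseteq> (\<Union>a\<in>string_index. strings a)"
      by (auto simp: string_index_def)
    ultimately show "v \<in> span (\<Union>a\<in>string_index. strings a)" using span_mono by blast
  qed
  then have "span {v \<in> S. \<exists>n. K v = (qq powi n) *s v} \<subseteq> span (\<Union>a\<in>string_index. strings a)"
    by (rule span_minimal) (rule subspace_span)
  then have "x \<in> span (\<Union>a\<in>string_index. strings a)"
    using weight_span assms by blast
  then show ?thesis by (rule span_Union_subspaces[OF strings_subspace])
qed

text \<open>The operators \<open>K\<close> and \<open>F E\<close> act by scalars on each space of strings, and the pair of scalars
determines the space.\<close>

lemma strings_independent:
  assumes "finite A" "A \<subseteq> string_index" "\<And>a. a \<in> A \<Longrightarrow> z a \<in> strings a" "sum z A = 0" "a \<in> A"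
  shows "z a = 0"
proof (rule separated_eigenvector_zero[where B = "A - {a}" and I = UNIV
      and H = "\<lambda>i. if i then K else F \<circ> E"
      and c = "\<lambda>i (n, k). if i then qq powi (int n - 2 * int k) else qi (int k) * qi (int n - int k + 1)"])
  show "Vector_Spaces.linear (*s) (*s) (if i then K else F \<circ> E)" for i
    using linear_K Vector_Spaces.linear_compose[OF linear_E linear_F] by simp
  show "(if i then K else F \<circ> E) (z b) =
      (case b of (n, k) \<Rightarrow> if i then qq powi (int n - 2 * int k) else qi (int k) * qi (int n - int k + 1)) *s z b"
    if "b \<in> insert a (A - {a})" for i b
    using assms(3)[of b] that assms(5) strings_weight strings_F_E by (auto split: prod.splits)
  show "\<exists>i\<in>UNIV. (case a of (n, k) \<Rightarrow> if i then qq powi (int n - 2 * int k) else qi (int k) * qi (int n - int k + 1)) \<noteq>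
      (case b of (n, k) \<Rightarrow> if i then qq powi (int n - 2 * int k) else qi (int k) * qi (int n - int k + 1))"
    if "b \<in> A - {a}" for b
  proof (rule ccontr)
    assume *: "\<not> ?thesis"
    obtain n k where a: "a = (n, k)" by (cases a)
    obtain n' k' where b: "b = (n', k')" by (cases b)
    note ab = a b
    from * have "qq powi (int n - 2 * int k) = qq powi (int n' - 2 * int k')"
      "qi (int k) * qi (int n - int k + 1) = qi (int k') * qi (int n' - int k' + 1)"
      unfolding ab by (auto split: if_splits)
    then have "int n = int n'" "int k = int k'"
      using qi_string_inj[of "int n" "int k" "int n'" "int k'"] by (simp_all add: qq_powi_inject)
    then show False using that ab by simp
  qed
  show "sum z (insert a (A - {a})) = 0" using assms by (simp add: insert_absorb)
qed (use assms in auto)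

text \<open>The operator that acts by \<open>G a\<close> on the summand \<open>strings a\<close>. A decomposition into strings is unique up
to zero summands, so the description determines one value for linear \<open>G a\<close>.\<close>

definition string_map :: "(nat \<times> nat \<Rightarrow> 'v \<Rightarrow> 'v) \<Rightarrow> 'v \<Rightarrow> 'v" where
  "string_map G x = (THE y. \<exists>A z. finite A \<and> A \<subseteq> string_index \<and> (\<forall>a\<in>A. z a \<in> strings a) \<and>
     x = sum z A \<and> y = (\<Sum>a\<in>A. G a (z a)))"

context
  fixes G :: "nat \<times> nat \<Rightarrow> 'v \<Rightarrow> 'v"
  assumes G: "\<And>a. Vector_Spaces.linear (*s) (*s) (G a)"
begin

lemma string_map_wd:
  assumes A: "finite A" "A \<subseteq> string_index" "\<And>a. a \<in> A \<Longrightarrow> z a \<in> strings a"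
    and B: "finite B" "B \<subseteq> string_index" "\<And>a. a \<in> B \<Longrightarrow> w a \<in> strings a"
    and eq: "sum z A = sum w B"
  shows "(\<Sum>a\<in>A. G a (z a)) = (\<Sum>a\<in>B. G a (w a))"
proof -
  define z' where "z' a = (if a \<in> A then z a else 0)" for a
  define w' where "w' a = (if a \<in> B then w a else 0)" for a
  have z': "sum z' (A \<union> B) = sum z A" "(\<Sum>a\<in>A \<union> B. G a (z' a)) = (\<Sum>a\<in>A. G a (z a))"
    unfolding z'_def using sum_extend_by_zero[of "A \<union> B" A "\<lambda>_ x. x" z]
      sum_extend_by_zero[of "A \<union> B" A G z] A(1) B(1) linear_map_simps(3)[OF G] by simp_all
  have w': "sum w' (A \<union> B) = sum w B" "(\<Sum>a\<in>A \<union> B. G a (w' a)) = (\<Sum>a\<in>B. G a (w a))"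
    unfolding w'_def using sum_extend_by_zero[of "A \<union> B" B "\<lambda>_ x. x" w]
      sum_extend_by_zero[of "A \<union> B" B G w] A(1) B(1) linear_map_simps(3)[OF G] by simp_all
  have "z' a - w' a = 0" if "a \<in> A \<union> B" for a
  proof (rule strings_independent[of "A \<union> B" "\<lambda>a. z' a - w' a"])
    show "z' a - w' a \<in> strings a" if "a \<in> A \<union> B" for a
      using A(3)[of a] B(3)[of a] subspace_0[OF strings_subspace, of a]
      by (intro subspace_diff[OF strings_subspace]) (simp_all add: z'_def w'_def)
    show "(\<Sum>a\<in>A \<union> B. z' a - w' a) = 0" using z'(1) w'(1) eq by (simp add: sum_subtractf)
  qed (use A(1,2) B(1,2) that in auto)
  then have "(\<Sum>a\<in>A \<union> B. G a (z' a)) = (\<Sum>a\<in>A \<union> B. G a (w' a))"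
    by (intro sum.cong) auto
  then show ?thesis using z'(2) w'(2) by simp
qed

lemma string_map_sum:
  assumes A: "finite A" "A \<subseteq> string_index" "\<And>a. a \<in> A \<Longrightarrow> z a \<in> strings a"
  shows "string_map G (sum z A) = (\<Sum>a\<in>A. G a (z a))"
  unfolding string_map_def
proof (rule the_equality)
  show "\<exists>A' z'. finite A' \<and> A' \<subseteq> string_index \<and> (\<forall>a\<in>A'. z' a \<in> strings a) \<and>
     sum z A = sum z' A' \<and> (\<Sum>a\<in>A. G a (z a)) = (\<Sum>a\<in>A'. G a (z' a))"
    by (intro exI[of _ A] exI[of _ z] conjI ballI refl) (use A in simp_all)
  show "y = (\<Sum>a\<in>A. G a (z a))"
    if "\<exists>A' z'. finite A' \<and> A' \<subseteq> string_index \<and> (\<forall>a\<in>A'. z' a \<in> strings a) \<and>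
     sum z A = sum z' A' \<and> y = (\<Sum>a\<in>A'. G a (z' a))" for y
  proof -
    from that obtain B w where B: "finite B \<and> B \<subseteq> string_index \<and> (\<forall>a\<in>B. w a \<in> strings a) \<and>
      sum z A = sum w B \<and> y = (\<Sum>a\<in>B. G a (w a))" by (elim exE)
    then have "(\<Sum>a\<in>A. G a (z a)) = (\<Sum>a\<in>B. G a (w a))"
      by (intro string_map_wd A) auto
    then show ?thesis using B by simp
  qed
qed

lemma string_map_string:
  assumes "a \<in> string_index" "x \<in> strings a" shows "string_map G x = G a x"
  using string_map_sum[of "{a}" "\<lambda>_. x"] assms by simp

lemma string_map_add:
  assumes "x \<in> S" "y \<in> S" shows "string_map G (x + y) = string_map G x + string_map G y"
proof -
  obtain A z where A: "finite A" "A \<subseteq> string_index" "\<And>a. a \<in> A \<Longrightarrow> z a \<in> strings a" "x = sum z A"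
    using string_decomposition[OF assms(1)] by blast
  obtain B w where B: "finite B" "B \<subseteq> string_index" "\<And>a. a \<in> B \<Longrightarrow> w a \<in> strings a" "y = sum w B"
    using string_decomposition[OF assms(2)] by blast
  define z' where "z' a = (if a \<in> A then z a else 0)" for a
  define w' where "w' a = (if a \<in> B then w a else 0)" for a
  have z': "sum z' (A \<union> B) = sum z A" "(\<Sum>a\<in>A \<union> B. G a (z' a)) = (\<Sum>a\<in>A. G a (z a))"
    unfolding z'_def using sum_extend_by_zero[of "A \<union> B" A "\<lambda>_ x. x" z]
      sum_extend_by_zero[of "A \<union> B" A G z] A(1) B(1) linear_map_simps(3)[OF G] by simp_all
  have w': "sum w' (A \<union> B) = sum w B" "(\<Sum>a\<in>A \<union> B. G a (w' a)) = (\<Sum>a\<in>B. G a (w a))"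
    unfolding w'_def using sum_extend_by_zero[of "A \<union> B" B "\<lambda>_ x. x" w]
      sum_extend_by_zero[of "A \<union> B" B G w] A(1) B(1) linear_map_simps(3)[OF G] by simp_all
  have "x + y = (\<Sum>a\<in>A \<union> B. z' a + w' a)" using z'(1) w'(1) A(4) B(4) by (simp add: sum.distrib)
  moreover have "string_map G (\<Sum>a\<in>A \<union> B. z' a + w' a) = (\<Sum>a\<in>A \<union> B. G a (z' a + w' a))"
  proof (intro string_map_sum)
    show "z' a + w' a \<in> strings a" for a
      using A(3)[of a] B(3)[of a] subspace_0[OF strings_subspace, of a]
      by (intro subspace_add[OF strings_subspace]) (simp_all add: z'_def w'_def)
  qed (use A(1,2) B(1,2) in auto)
  ultimately show ?thesis
    using z'(2) w'(2) string_map_sum[OF A(1-3)] string_map_sum[OF B(1-3)] A(4) B(4)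
    by (simp add: linear_map_simps(1)[OF G] sum.distrib)
qed

lemma string_map_scale:
  assumes "x \<in> S" shows "string_map G (c *s x) = c *s string_map G x"
proof -
  obtain A z where A: "finite A" "A \<subseteq> string_index" "\<And>a. a \<in> A \<Longrightarrow> z a \<in> strings a" "x = sum z A"
    using string_decomposition[OF assms(1)] by blast
  have "string_map G (\<Sum>a\<in>A. c *s z a) = (\<Sum>a\<in>A. G a (c *s z a))"
    using A by (intro string_map_sum subspace_scale[OF strings_subspace]) simp_all
  then show ?thesis using string_map_sum[OF A(1-3)] A(4)
    by (simp add: linear_map_simps(2)[OF G] scale_sum_right)
qed

lemma string_map_closed:
  assumes "\<And>a v. v \<in> S \<Longrightarrow> G a v \<in> S" "x \<in> S" shows "string_map G x \<in> S"
proof -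
  obtain A z where A: "finite A" "A \<subseteq> string_index" "\<And>a. a \<in> A \<Longrightarrow> z a \<in> strings a" "x = sum z A"
    using string_decomposition[OF assms(2)] by blast
  have "string_map G x = (\<Sum>a\<in>A. G a (z a))" unfolding A(4) by (rule string_map_sum[OF A(1-3)])
  also have "\<dots> \<in> S"
    using A(3) strings_closed assms(1) by (intro subspace_sum[OF subspace_S]) blast
  finally show ?thesis .
qed

end

text \<open>On the \<open>k\<close>-th vector of a string of length \<open>n\<close>, Kashiwara's operators are \<open>F / [k + 1]\<close> and
\<open>E / [n - k + 1]\<close>.\<close>

definition f_map :: "nat \<times> nat \<Rightarrow> 'v \<Rightarrow> 'v" where
  "f_map a v = inverse (qint (Suc (snd a))) *s F v"

definition e_map :: "nat \<times> nat \<Rightarrow> 'v \<Rightarrow> 'v" where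
  "e_map a v = inverse (qi (int (fst a) - int (snd a) + 1)) *s E v"

lemma linear_f_map: "Vector_Spaces.linear (*s) (*s) (f_map a)"
  by (simp add: Vector_Spaces.linear_iff vector_space_axioms f_map_def F_lin scale_right_distrib mult.commute)

lemma linear_e_map: "Vector_Spaces.linear (*s) (*s) (e_map a)"
  by (simp add: Vector_Spaces.linear_iff vector_space_axioms e_map_def E_lin scale_right_distrib mult.commute)

definition ft :: "'v \<Rightarrow> 'v" where "ft = string_map f_map"
definition et :: "'v \<Rightarrow> 'v" where "et = string_map e_map"

lemma ft_add: "x \<in> S \<Longrightarrow> y \<in> S \<Longrightarrow> ft (x + y) = ft x + ft y"
  and ft_scale: "x \<in> S \<Longrightarrow> ft (c *s x) = c *s ft x"
  and et_add: "x \<in> S \<Longrightarrow> y \<in> S \<Longrightarrow> et (x + y) = et x + et y"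
  and et_scale: "x \<in> S \<Longrightarrow> et (c *s x) = c *s et x"
  unfolding ft_def et_def
  by (simp_all add: string_map_add string_map_scale linear_f_map linear_e_map)

lemma ft_closed: "x \<in> S \<Longrightarrow> ft x \<in> S"
  unfolding ft_def by (rule string_map_closed[OF linear_f_map])
    (simp add: f_map_def F_closed subspace_S subspace_scale)

lemma ft_Fdiv: assumes "hw n v" "k \<le> n" shows "ft (Fdiv k v) = Fdiv (Suc k) v"
proof -
  have "ft (Fdiv k v) = f_map (n, k) (Fdiv k v)" unfolding ft_def
    using assms by (intro string_map_string linear_f_map) (auto simp: string_index_def strings_def)
  then show ?thesis by (simp add: f_map_def F_Fdiv qint_nonzero)
qed

lemma et_Fdiv: assumes "hw n v" "k \<le> n" shows "et (Fdiv k v) = (if k = 0 then 0 else Fdiv (k - 1) v)"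
proof -
  have "et (Fdiv k v) = e_map (n, k) (Fdiv k v)" unfolding et_def
    using assms by (intro string_map_string linear_e_map) (auto simp: string_index_def strings_def)
  then show ?thesis
  proof (cases k)
    case (Suc j)
    have "qi (int n - int j) \<noteq> 0" using assms Suc by simp
    then show ?thesis using \<open>et (Fdiv k v) = _\<close> Suc E_Fdiv[OF assms(1), of j]
      by (simp add: e_map_def algebra_simps)
  qed (simp add: e_map_def hw_D[OF assms(1)])
qed

lemma linear_eq_on_strings:
  assumes "S = UNIV" "Vector_Spaces.linear (*s) (*s) T"
    and "\<And>n k v. hw n v \<Longrightarrow> k \<le> n \<Longrightarrow> T (Fdiv k v) = T' (Fdiv k v)"
    and "Vector_Spaces.linear (*s) (*s) T'"
  shows "T = T'"
proof
  fix x
  obtain A z where A: "finite A" "A \<subseteq> string_index" "\<And>a. a \<in> A \<Longrightarrow> z a \<in> strings a" "x = sum z A"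
    using string_decomposition[of x] assms(1) by blast
  have "T (z a) = T' (z a)" if "a \<in> A" for a
    using A(2) A(3)[OF that] that assms(3) by (auto simp: strings_def string_index_def)
  then show "T x = T' x"
    unfolding A(4) linear_map_simps(5)[OF assms(2)] linear_map_simps(5)[OF assms(4)] by simp
qed

lemma linear_ft: assumes "S = UNIV" shows "Vector_Spaces.linear (*s) (*s) ft"
  and linear_et: "Vector_Spaces.linear (*s) (*s) et"
proof -
  have "x \<in> S" for x using assms by simp
  then show "Vector_Spaces.linear (*s) (*s) ft" "Vector_Spaces.linear (*s) (*s) et"
    by (simp_all add: Vector_Spaces.linear_iff vector_space_axioms ft_add ft_scale et_add et_scale)
qed

text \<open>Strings span the module, so their images determine a linear operator.\<close>

lemma ft_unique:
  assumes "S = UNIV"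
  shows "(THE T. Vector_Spaces.linear (*s) (*s) T \<and>
     (\<forall>n k v. E v = 0 \<and> K v = (qq ^ n) *s v \<and> k \<le> n \<longrightarrow> T (Fdiv k v) = Fdiv (Suc k) v)) = ft"
proof -
  have hw: "hw n v \<longleftrightarrow> E v = 0 \<and> K v = (qq ^ n) *s v" for n v
    unfolding hw_def using assms by blast
  show ?thesis
  proof (rule the_equality)
    show "Vector_Spaces.linear (*s) (*s) ft \<and>
       (\<forall>n k v. E v = 0 \<and> K v = (qq ^ n) *s v \<and> k \<le> n \<longrightarrow> ft (Fdiv k v) = Fdiv (Suc k) v)"
      using linear_ft[OF assms] ft_Fdiv unfolding hw by blast
    show "T = ft" if T: "Vector_Spaces.linear (*s) (*s) T \<and>
       (\<forall>n k v. E v = 0 \<and> K v = (qq ^ n) *s v \<and> k \<le> n \<longrightarrow> T (Fdiv k v) = Fdiv (Suc k) v)" for T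
    proof (intro linear_eq_on_strings assms linear_ft)
      show "T (Fdiv k v) = ft (Fdiv k v)" if "hw n v" "k \<le> n" for n k v
        unfolding ft_Fdiv[OF that] using T that unfolding hw by blast
    qed (use T in blast)
  qed
qed

lemma et_unique:
  assumes "S = UNIV"
  shows "(THE T. Vector_Spaces.linear (*s) (*s) T \<and>
     (\<forall>n k v. E v = 0 \<and> K v = (qq ^ n) *s v \<and> k \<le> n \<longrightarrow>
       T (Fdiv k v) = (if k = 0 then 0 else Fdiv (k - 1) v))) = et"
proof -
  have hw: "hw n v \<longleftrightarrow> E v = 0 \<and> K v = (qq ^ n) *s v" for n v
    unfolding hw_def using assms by blast
  show ?thesis
  proof (rule the_equality)
    show "Vector_Spaces.linear (*s) (*s) et \<and>
       (\<forall>n k v. E v = 0 \<and> K v = (qq ^ n) *s v \<and> k \<le> n \<longrightarrow>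
         et (Fdiv k v) = (if k = 0 then 0 else Fdiv (k - 1) v))"
      using linear_et[OF assms] et_Fdiv unfolding hw by blast
    show "T = et" if T: "Vector_Spaces.linear (*s) (*s) T \<and>
       (\<forall>n k v. E v = 0 \<and> K v = (qq ^ n) *s v \<and> k \<le> n \<longrightarrow>
         T (Fdiv k v) = (if k = 0 then 0 else Fdiv (k - 1) v))" for T
    proof (intro linear_eq_on_strings assms linear_et)
      show "T (Fdiv k v) = et (Fdiv k v)" if "hw n v" "k \<le> n" for n k v
        unfolding et_Fdiv[OF that] using T that unfolding hw by blast
    qed (use T in blast)
  qed
qed

end

section \<open>Words in the weights of a minuscule representation\<close>

lemma sum_fun_apply: "(sum f A) u = (\<Sum>a\<in>A. f a u)"
  by (induction A rule: infinite_finite_induct) auto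

definition ws :: "Qq \<Rightarrow> ('a \<Rightarrow> Qq) \<Rightarrow> 'a \<Rightarrow> Qq" where
  "ws c x = (\<lambda>w. c * x w)"

lemma ws_apply [simp]: "ws c x w = c * x w" by (simp add: ws_def)

interpretation words: vector_space ws
  by standard (auto simp: fun_eq_iff algebra_simps)

definition basis_vec :: "'a \<Rightarrow> 'a \<Rightarrow> Qq" where
  "basis_vec w = (\<lambda>u. if u = w then 1 else 0)"

lemma basis_vec_apply: "basis_vec w u = (if u = w then 1 else 0)"
  by (simp add: basis_vec_def)

definition tens :: "'a \<Rightarrow> ('a list \<Rightarrow> Qq) \<Rightarrow> 'a list \<Rightarrow> Qq" where
  "tens a v = (\<lambda>w. case w of [] \<Rightarrow> 0 | b # w' \<Rightarrow> if b = a then v w' else 0)"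

lemma tens_Nil [simp]: "tens a v [] = 0" and tens_Cons [simp]: "tens a v (b # w) = (if b = a then v w else 0)"
  by (simp_all add: tens_def)

lemma cartan_sym: "cartan i j = cartan j i"
  by (simp add: cartan_def insert_commute eq_commute)

lemma cartan_diag [simp]: "cartan i i = 2"
  by (simp add: cartan_def)

text \<open>The crystal of a minuscule representation: every weight \<open>wl i a\<close> is 1, 0 or -1, and it tells whether
\<open>a\<close> has an outgoing or an incoming arrow of colour \<open>i\<close>. The last condition is the commutation of
\<open>F\<^sub>i\<close> and \<open>E\<^sub>j\<close> on the representation with basis \<open>X\<close>.\<close>

locale letter_crystal =
  fixes X :: "'a set" and fl el :: "nat \<Rightarrow> 'a \<Rightarrow> 'a option" and wl :: "nat \<Rightarrow> 'a \<Rightarrow> int"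
  assumes finite_X: "finite X"
    and fl_el: "fl i a = Some b \<longleftrightarrow> el i b = Some a"
    and fl_X: "\<lbrakk>i \<in> E6_index; fl i a = Some b\<rbrakk> \<Longrightarrow> a \<in> X \<longleftrightarrow> b \<in> X"
    and fl_wl: "\<lbrakk>i \<in> E6_index; a \<in> X\<rbrakk> \<Longrightarrow> fl i a \<noteq> None \<longleftrightarrow> wl i a = 1"
    and el_wl: "\<lbrakk>i \<in> E6_index; a \<in> X\<rbrakk> \<Longrightarrow> el i a \<noteq> None \<longleftrightarrow> wl i a = -1"
    and wl_bound: "\<lbrakk>i \<in> E6_index; a \<in> X\<rbrakk> \<Longrightarrow> wl i a \<in> {-1, 0, 1}"
    and wl_step: "\<lbrakk>i \<in> E6_index; j \<in> E6_index; fl i a = Some b\<rbrakk> \<Longrightarrow> wl j b = wl j a - cartan j i"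
    and fl_el_comm: "\<lbrakk>i \<in> E6_index; j \<in> E6_index; i \<noteq> j; a \<in> X\<rbrakk> \<Longrightarrow>
      Option.bind (fl i a) (el j) = Option.bind (el j a) (fl i)"
begin

definition ww :: "nat \<Rightarrow> 'a list \<Rightarrow> int" where
  "ww i w = sum_list (map (wl i) w)"

lemma ww_simps [simp]: "ww i [] = 0" "ww i (a # w) = wl i a + ww i w"
  by (simp_all add: ww_def)

text \<open>The generators act on tensor powers by \<open>\<Delta> F = F \<otimes> 1 + K \<otimes> F\<close> and
\<open>\<Delta> E = E \<otimes> K\<^sup>-\<^sup>1 + 1 \<otimes> E\<close>. A vector is given by its coefficients at words, so the coefficient of
\<open>F x\<close> at a word collects coefficients of \<open>x\<close> at its predecessors: \<open>F\<close> is expressed by \<^term>\<open>el\<close>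
and \<open>E\<close> by \<^term>\<open>fl\<close>.\<close>

primrec Fw :: "nat \<Rightarrow> 'a list \<Rightarrow> ('a list \<Rightarrow> Qq) \<Rightarrow> Qq" where
  "Fw i [] x = 0"
| "Fw i (a # w) x = (case el i a of None \<Rightarrow> 0 | Some b \<Rightarrow> x (b # w))
     + qq powi (wl i a) * Fw i w (\<lambda>v. x (a # v))"

primrec Ew :: "nat \<Rightarrow> 'a list \<Rightarrow> ('a list \<Rightarrow> Qq) \<Rightarrow> Qq" where
  "Ew i [] x = 0"
| "Ew i (a # w) x = (case fl i a of None \<Rightarrow> 0 | Some b \<Rightarrow> qq powi (- ww i w) * x (b # w))
     + Ew i w (\<lambda>v. x (a # v))"

definition Fop :: "nat \<Rightarrow> ('a list \<Rightarrow> Qq) \<Rightarrow> 'a list \<Rightarrow> Qq" where "Fop i x = (\<lambda>w. Fw i w x)"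
definition Eop :: "nat \<Rightarrow> ('a list \<Rightarrow> Qq) \<Rightarrow> 'a list \<Rightarrow> Qq" where "Eop i x = (\<lambda>w. Ew i w x)"
definition Kop :: "nat \<Rightarrow> ('a list \<Rightarrow> Qq) \<Rightarrow> 'a list \<Rightarrow> Qq" where "Kop i x = (\<lambda>w. qq powi (ww i w) * x w)"

definition Words :: "nat \<Rightarrow> 'a list set" where
  "Words s = {w. set w \<subseteq> X \<and> length w = s}"

definition W :: "nat \<Rightarrow> ('a list \<Rightarrow> Qq) set" where
  "W s = {x. \<forall>w. x w \<noteq> 0 \<longrightarrow> w \<in> Words s}"

lemma W_zero: "x \<in> W s \<Longrightarrow> w \<notin> Words s \<Longrightarrow> x w = 0"
  by (auto simp: W_def)

lemma finite_Words: "finite (Words s)"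
  unfolding Words_def using finite_lists_length_eq[OF finite_X] .

lemma Words_Suc: "Words (Suc s) = (\<lambda>(a, w). a # w) ` (X \<times> Words s)"
  by (auto simp: Words_def length_Suc_conv image_iff)

lemma subspace_W: "words.subspace (W s)"
  by (auto simp: words.subspace_def W_def) (metis add.left_neutral)+

lemma basis_vec_W: "w \<in> Words s \<Longrightarrow> basis_vec w \<in> W s"
  by (simp add: W_def basis_vec_apply)

lemma Fw_linear: "Fw i w (\<lambda>v. x v + y v) = Fw i w x + Fw i w y" "Fw i w (\<lambda>v. c * x v) = c * Fw i w x"
  "Fw i w (\<lambda>v. 0) = 0"
proof -
  show "Fw i w (\<lambda>v. x v + y v) = Fw i w x + Fw i w y" "Fw i w (\<lambda>v. c * x v) = c * Fw i w x" for x y c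
    by (induction w arbitrary: x y) (simp_all add: algebra_simps split: option.split)
  from this(2)[of 0] show "Fw i w (\<lambda>v. 0) = 0" by simp
qed

lemma Ew_linear: "Ew i w (\<lambda>v. x v + y v) = Ew i w x + Ew i w y" "Ew i w (\<lambda>v. c * x v) = c * Ew i w x"
  "Ew i w (\<lambda>v. 0) = 0"
proof -
  show "Ew i w (\<lambda>v. x v + y v) = Ew i w x + Ew i w y" "Ew i w (\<lambda>v. c * x v) = c * Ew i w x" for x y c
    by (induction w arbitrary: x y) (simp_all add: algebra_simps split: option.split)
  from this(2)[of 0] show "Ew i w (\<lambda>v. 0) = 0" by simp
qed

lemma linear_Fop: "Vector_Spaces.linear ws ws (Fop i)"
  and linear_Eop: "Vector_Spaces.linear ws ws (Eop i)"
  and linear_Kop: "Vector_Spaces.linear ws ws (Kop i)"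
  by (simp_all add: Vector_Spaces.linear_iff words.vector_space_axioms fun_eq_iff Fop_def Eop_def Kop_def
      ws_def plus_fun_def Fw_linear Ew_linear algebra_simps)

lemmas Fop_lin = linear_map_simps[OF linear_Fop]
lemmas Eop_lin = linear_map_simps[OF linear_Eop]
lemmas Kop_lin = linear_map_simps[OF linear_Kop]

lemma Fw_support:
  assumes "i \<in> E6_index" "Fw i w x \<noteq> 0"
  shows "\<exists>w'. x w' \<noteq> 0 \<and> length w' = length w \<and> (set w' \<subseteq> X \<longleftrightarrow> set w \<subseteq> X) \<and>
    (\<forall>j\<in>E6_index. ww j w' = ww j w + cartan j i)"
  using assms(2)
proof (induction w arbitrary: x)
  case (Cons a w)
  show ?case
  proof (cases "Fw i w (\<lambda>v. x (a # v)) = 0")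
    case True
    then obtain b where b: "el i a = Some b" "x (b # w) \<noteq> 0"
      using Cons.prems by (cases "el i a") auto
    then have fb: "fl i b = Some a" by (simp add: fl_el)
    have "a \<in> X \<longleftrightarrow> b \<in> X" "\<And>j. j \<in> E6_index \<Longrightarrow> wl j a = wl j b - cartan j i"
      using fl_X[OF assms(1) fb] wl_step[OF assms(1) _ fb] by auto
    then show ?thesis using b(2) by (intro exI[of _ "b # w"]) auto
  next
    case False
    then obtain w' where "x (a # w') \<noteq> 0" "length w' = length w" "set w' \<subseteq> X \<longleftrightarrow> set w \<subseteq> X"
      "\<forall>j\<in>E6_index. ww j w' = ww j w + cartan j i" using Cons.IH[OF False] by blast
    then show ?thesis by (intro exI[of _ "a # w'"]) auto
  qed
qed simp

lemma Ew_support: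
  assumes "i \<in> E6_index" "Ew i w x \<noteq> 0"
  shows "\<exists>w'. x w' \<noteq> 0 \<and> length w' = length w \<and> (set w' \<subseteq> X \<longleftrightarrow> set w \<subseteq> X) \<and>
    (\<forall>j\<in>E6_index. ww j w' = ww j w - cartan j i)"
  using assms(2)
proof (induction w arbitrary: x)
  case (Cons a w)
  show ?case
  proof (cases "Ew i w (\<lambda>v. x (a # v)) = 0")
    case True
    then obtain b where b: "fl i a = Some b" "x (b # w) \<noteq> 0"
      using Cons.prems by (cases "fl i a") auto
    have "a \<in> X \<longleftrightarrow> b \<in> X" "\<And>j. j \<in> E6_index \<Longrightarrow> wl j b = wl j a - cartan j i"
      using fl_X[OF assms(1) b(1)] wl_step[OF assms(1) _ b(1)] by auto
    then show ?thesis using b(2) by (intro exI[of _ "b # w"]) auto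
  next
    case False
    then obtain w' where "x (a # w') \<noteq> 0" "length w' = length w" "set w' \<subseteq> X \<longleftrightarrow> set w \<subseteq> X"
      "\<forall>j\<in>E6_index. ww j w' = ww j w - cartan j i" using Cons.IH[OF False] by blast
    then show ?thesis by (intro exI[of _ "a # w'"]) auto
  qed
qed simp

lemma Fop_closed: assumes "i \<in> E6_index" "x \<in> W s" shows "Fop i x \<in> W s"
  unfolding W_def Fop_def
proof clarify
  fix w assume "Fw i w x \<noteq> 0"
  from Fw_support[OF assms(1) this] obtain w' where "x w' \<noteq> 0" "length w' = length w" "set w' \<subseteq> X \<longleftrightarrow> set w \<subseteq> X"
    by blast
  then show "w \<in> Words s" using assms(2) by (auto simp: W_def Words_def)
qed

lemma Eop_closed: assumes "i \<in> E6_index" "x \<in> W s" shows "Eop i x \<in> W s"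
  unfolding W_def Eop_def
proof clarify
  fix w assume "Ew i w x \<noteq> 0"
  from Ew_support[OF assms(1) this] obtain w' where "x w' \<noteq> 0" "length w' = length w" "set w' \<subseteq> X \<longleftrightarrow> set w \<subseteq> X"
    by blast
  then show "w \<in> Words s" using assms(2) by (auto simp: W_def Words_def)
qed

text \<open>The exponent \<open>e = 1\<close> is the commutation with \<open>K\<close>, and \<open>e = -1\<close> the commutation with its inverse,
which occurs in the coproduct of \<open>E\<close>.\<close>

lemma Fw_K:
  assumes "i \<in> E6_index" "j \<in> E6_index"
  shows "Fw j w (\<lambda>v. qq powi (e * ww i v) * x v) = qq powi (e * (ww i w + cartan i j)) * Fw j w x"
proof (induction w arbitrary: x)
  case (Cons a w)
  have 1: "Fw j w (\<lambda>v. qq powi (e * ww i (a # v)) * x (a # v)) =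
      qq powi (e * wl i a) * (qq powi (e * (ww i w + cartan i j)) * Fw j w (\<lambda>v. x (a # v)))"
    by (subst Cons.IH[symmetric], subst Fw_linear(2)[symmetric])
      (simp add: distrib_left qq_powi_add mult.assoc)
  have 2: "wl i b = wl i a + cartan i j" if "el j a = Some b" for b
    using wl_step[of j i b a] that assms by (simp add: fl_el)
  show ?case
  proof (cases "el j a")
    case None
    then show ?thesis unfolding Fw.simps 1 by (simp add: distrib_left qq_powi_add)
  next
    case (Some b)
    then show ?thesis unfolding Fw.simps 1 by (simp add: 2[OF Some] distrib_left qq_powi_add)
  qed
qed simp

lemma Ew_K:
  assumes "i \<in> E6_index" "j \<in> E6_index"
  shows "Ew j w (\<lambda>v. qq powi (e * ww i v) * x v) = qq powi (e * (ww i w - cartan i j)) * Ew j w x"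
proof (induction w arbitrary: x)
  case (Cons a w)
  have 1: "Ew j w (\<lambda>v. qq powi (e * ww i (a # v)) * x (a # v)) =
      qq powi (e * wl i a) * (qq powi (e * (ww i w - cartan i j)) * Ew j w (\<lambda>v. x (a # v)))"
    by (subst Cons.IH[symmetric], subst Ew_linear(2)[symmetric])
      (simp add: distrib_left qq_powi_add mult.assoc)
  have e: "e * (wl i a + ww i w - cartan i j) = e * wl i a + e * (ww i w - cartan i j)"
    by (simp add: algebra_simps)
  have 2: "e * (wl i b + ww i w) = e * wl i a + e * (ww i w - cartan i j)" if "fl j a = Some b" for b
  proof -
    have "wl i a = wl i b + cartan i j" using wl_step[OF assms(2,1) that] by simp
    then show ?thesis by (simp add: algebra_simps)
  qed
  show ?case
  proof (cases "fl j a")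
    case None
    then show ?thesis unfolding Ew.simps 1 by (simp add: e qq_powi_add)
  next
    case (Some b)
    have "qq powi (e * ww i (b # w)) = qq powi (e * wl i a) * qq powi (e * (ww i w - cartan i j))"
      using 2[OF Some] by (simp flip: qq_powi_add)
    then show ?thesis using Some unfolding Ew.simps 1 by (simp add: e distrib_left qq_powi_add)
  qed
qed simp

lemma Kop_Fop: "i \<in> E6_index \<Longrightarrow> j \<in> E6_index \<Longrightarrow> Kop i (Fop j x) = ws (qq powi (- cartan i j)) (Fop j (Kop i x))"
  using Fw_K[of i j _ 1 x] by (auto simp: Kop_def Fop_def fun_eq_iff simp flip: qq_powi_add mult.assoc)

lemma Kop_Eop: "i \<in> E6_index \<Longrightarrow> j \<in> E6_index \<Longrightarrow> Kop i (Eop j x) = ws (qq powi (cartan i j)) (Eop j (Kop i x))"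
  using Ew_K[of i j _ 1 x] by (auto simp: Kop_def Eop_def fun_eq_iff simp flip: qq_powi_add mult.assoc)

text \<open>The terms in which \<open>E\<close> and \<open>F\<close> act on different letters match by \<open>Fw_K\<close>. What remains is the
commutator on the first letter, a minuscule representation of rank one, and the commutator on the
rest; these add up by \<open>[a + b] = q^(-b) [a] + q^a [b]\<close>.\<close>

lemma Ew_Fop:
  assumes ij: "i \<in> E6_index" "j \<in> E6_index" and "set w \<subseteq> X"
  shows "Ew i w (Fop j x) = Fw j w (Eop i x) + (if i = j then qi (ww i w) * x w else 0)"
  using assms(3)
proof (induction w arbitrary: x)
  case (Cons a w)
  have aX: "a \<in> X" and IH: "Ew i w (Fop j y) = Fw j w (Eop i y) + (if i = j then qi (ww i w) * y w else 0)" for y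
    using Cons by auto
  let ?x = "\<lambda>b v. x (b # v)"
  \<comment> \<open>\<open>?D\<close> and \<open>?B\<close> are the terms in which one operator acts on the first letter and the other one
  on the remaining word.\<close>
  let ?D = "case el j a of None \<Rightarrow> 0 | Some d \<Rightarrow> Ew i w (?x d)"
  let ?B = "case fl i a of None \<Rightarrow> 0 | Some b \<Rightarrow> qq powi (wl j a - cartan i j - ww i w) * Fw j w (?x b)"
  have L1: "Ew i w (\<lambda>v. Fop j x (a # v)) = ?D + qq powi (wl j a) * Ew i w (Fop j (?x a))"
    by (cases "el j a") (simp_all add: Fop_def Ew_linear)
  have L2: "(case fl i a of None \<Rightarrow> 0 | Some b \<Rightarrow> qq powi (- ww i w) * Fop j x (b # w)) =
     (case fl i a of None \<Rightarrow> 0 | Some b \<Rightarrow> qq powi (- ww i w) * (case el j b of None \<Rightarrow> 0 | Some c \<Rightarrow> x (c # w))) + ?B"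
  proof (cases "fl i a")
    case (Some b)
    have "wl j b = wl j a - cartan i j" using wl_step[OF ij Some] by (simp add: cartan_sym)
    moreover have "qq powi (wl j a - cartan i j - ww i w) = qq powi (- ww i w) * qq powi (wl j a - cartan i j)"
      unfolding qq_powi_add[symmetric] by (rule arg_cong[of _ _ "power_int qq"]) simp
    ultimately show ?thesis using Some by (simp add: Fop_def distrib_left mult.assoc)
  qed simp
  have R1: "Fw j w (\<lambda>v. Eop i x (a # v)) = (case fl i a of None \<Rightarrow> 0 | Some b \<Rightarrow> qq powi (- (ww i w + cartan i j)) * Fw j w (?x b))
      + Fw j w (Eop i (?x a))"
    using Fw_K[OF ij, of w "-1"]
    by (cases "fl i a") (simp_all add: Eop_def Fw_linear)
  have R1': "qq powi (wl j a) * Fw j w (\<lambda>v. Eop i x (a # v)) = ?B + qq powi (wl j a) * Fw j w (Eop i (?x a))"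
  proof -
    have "qq powi (wl j a - cartan i j - ww i w) = qq powi (wl j a) * qq powi (- (ww i w + cartan i j))"
      unfolding qq_powi_add[symmetric] by (rule arg_cong[of _ _ "power_int qq"]) simp
    then show ?thesis unfolding R1 by (cases "fl i a") (simp_all add: distrib_left mult.assoc)
  qed
  have R2: "(case el j a of None \<Rightarrow> 0 | Some d \<Rightarrow> Eop i x (d # w)) =
     (case el j a of None \<Rightarrow> 0 | Some d \<Rightarrow> (case fl i d of None \<Rightarrow> 0 | Some c \<Rightarrow> qq powi (- ww i w) * x (c # w))) + ?D"
    by (cases "el j a") (simp_all add: Eop_def)
  have C: "(case fl i a of None \<Rightarrow> 0 | Some b \<Rightarrow> qq powi (- ww i w) * (case el j b of None \<Rightarrow> 0 | Some c \<Rightarrow> x (c # w)))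
     + qq powi (wl j a) * (if i = j then qi (ww i w) * x (a # w) else 0)
     = (case el j a of None \<Rightarrow> 0 | Some d \<Rightarrow> (case fl i d of None \<Rightarrow> 0 | Some c \<Rightarrow> qq powi (- ww i w) * x (c # w)))
     + (if i = j then qi (ww i (a # w)) * x (a # w) else 0)"
  proof (cases "i = j")
    case False
    have *: "Option.bind (fl i a) (el j) = Option.bind (el j a) (fl i)"
      using fl_el_comm[OF ij False aX] .
    show ?thesis using * False
      by (cases "fl i a"; cases "el j a") (auto split: option.split)
  next
    case True
    have q: "qi (wl i a + ww i w) = qq powi (- ww i w) * qi (wl i a) + qq powi (wl i a) * qi (ww i w)"
      by (rule qi_add)
    consider "wl i a = 1" | "wl i a = 0" | "wl i a = -1" using wl_bound[OF ij(1) aX] by auto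
    then show ?thesis
    proof cases
      case 1
      then obtain b where b: "fl i a = Some b" using fl_wl[OF ij(1) aX] by auto
      then have "el i b = Some a" by (simp add: fl_el)
      moreover have "el i a = None" using 1 el_wl[OF ij(1) aX] by auto
      ultimately show ?thesis using True b 1 q by (simp add: algebra_simps)
    next
      case 2
      then have "fl i a = None" "el i a = None" using fl_wl[OF ij(1) aX] el_wl[OF ij(1) aX] by auto
      then show ?thesis using True 2 q by simp
    next
      case 3
      then obtain b where b: "el i a = Some b" using el_wl[OF ij(1) aX] by auto
      then have "fl i b = Some a" by (simp add: fl_el)
      moreover have "fl i a = None" using 3 fl_wl[OF ij(1) aX] by auto
      moreover have "qi (-1) = -1" using qi_minus[of 1] by simp
      moreover from this have "inverse qq * qi (ww i w) = qi (ww i w - 1) + qq powi (- ww i w)"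
        using q 3 by (simp add: algebra_simps)
      then have "inverse qq * qi (ww i w) * x (a # w) = (qi (ww i w - 1) + qq powi (- ww i w)) * x (a # w)"
        by simp
      ultimately show ?thesis using True b 3 by (simp add: algebra_simps)
    qed
  qed
  have "Ew i (a # w) (Fop j x) = (case fl i a of None \<Rightarrow> 0 | Some b \<Rightarrow> qq powi (- ww i w) * (case el j b of None \<Rightarrow> 0 | Some c \<Rightarrow> x (c # w)))
     + ?B + (?D + qq powi (wl j a) * (Fw j w (Eop i (?x a)) + (if i = j then qi (ww i w) * x (a # w) else 0)))"
    unfolding Ew.simps L1 L2 IH ..
  moreover have "Fw j (a # w) (Eop i x) = (case el j a of None \<Rightarrow> 0 | Some d \<Rightarrow> (case fl i d of None \<Rightarrow> 0 | Some c \<Rightarrow> qq powi (- ww i w) * x (c # w))) + ?D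
    + (?B + qq powi (wl j a) * Fw j w (Eop i (?x a)))"
    unfolding Fw.simps R1' R2 ..
  ultimately show ?case using C by (simp add: distrib_left)
qed simp

lemma Eop_Fop:
  assumes "i \<in> E6_index" "j \<in> E6_index" "x \<in> W s"
  shows "Eop i (Fop j x) = Fop j (Eop i x) + (if i = j then (\<lambda>w. qi (ww i w) * x w) else 0)"
proof
  fix w
  show "Eop i (Fop j x) w = (Fop j (Eop i x) + (if i = j then (\<lambda>w. qi (ww i w) * x w) else 0)) w"
  proof (cases "w \<in> Words s")
    case True
    then show ?thesis using Ew_Fop[OF assms(1,2), of w x] by (simp add: Words_def Eop_def Fop_def)
  next
    case False
    have "Eop i (Fop j x) \<in> W s" "Fop j (Eop i x) \<in> W s"
      using assms by (auto intro: Eop_closed Fop_closed)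
    then have "Eop i (Fop j x) w = 0" "Fop j (Eop i x) w = 0" "x w = 0"
      using False W_zero assms(3) by blast+
    then show ?thesis by simp
  qed
qed

lemma Kop_eigen: "Kop i x = ws (qq powi n) x \<longleftrightarrow> (\<forall>w. x w \<noteq> 0 \<longrightarrow> ww i w = n)"
  by (auto simp: Kop_def fun_eq_iff qq_powi_inject)

lemma ww_bound: assumes "i \<in> E6_index" "w \<in> Words s" shows "\<bar>ww i w\<bar> \<le> int s"
proof -
  have "set w \<subseteq> X \<Longrightarrow> \<bar>ww i w\<bar> \<le> int (length w)"
  proof (induction w)
    case (Cons a w)
    then show ?case using wl_bound[OF assms(1), of a] by auto
  qed simp
  then show ?thesis using assms(2) by (simp add: Words_def)
qed

lemma Fop_pow_support:
  assumes "i \<in> E6_index"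
  shows "(Fop i ^^ N) x w \<noteq> 0 \<Longrightarrow> \<exists>w'. x w' \<noteq> 0 \<and> ww i w' = ww i w + 2 * int N"
proof (induction N arbitrary: w)
  case (Suc N)
  then have "Fw i w ((Fop i ^^ N) x) \<noteq> 0" by (simp add: Fop_def[of i "(Fop i ^^ N) x"])
  from Fw_support[OF assms this] obtain w' where "(Fop i ^^ N) x w' \<noteq> 0" "ww i w' = ww i w + cartan i i"
    using assms by blast
  with Suc.IH[of w'] show ?case by auto
qed auto

lemma Eop_pow_support:
  assumes "i \<in> E6_index"
  shows "(Eop i ^^ N) x w \<noteq> 0 \<Longrightarrow> \<exists>w'. x w' \<noteq> 0 \<and> ww i w' = ww i w - 2 * int N"
proof (induction N arbitrary: w)
  case (Suc N)
  then have "Ew i w ((Eop i ^^ N) x) \<noteq> 0" by (simp add: Eop_def[of i "(Eop i ^^ N) x"])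
  from Ew_support[OF assms this] obtain w' where "(Eop i ^^ N) x w' \<noteq> 0" "ww i w' = ww i w - cartan i i"
    using assms by blast
  with Suc.IH[of w'] show ?case by auto
qed auto

lemma W_expansion: assumes "x \<in> W s" shows "x = (\<Sum>w\<in>Words s. ws (x w) (basis_vec w))"
proof
  fix u
  have "(\<Sum>w\<in>Words s. ws (x w) (basis_vec w)) u = (\<Sum>w\<in>Words s. if u = w then x w else 0)"
    unfolding sum_fun_apply by (intro sum.cong) (auto simp: basis_vec_apply)
  also have "\<dots> = x u" using assms finite_Words[of s] by (auto simp: W_def)
  finally show "x u = (\<Sum>w\<in>Words s. ws (x w) (basis_vec w)) u" by simp
qed

text \<open>Weights of words of length \<open>s\<close> lie between \<open>-s\<close> and \<open>s\<close>, which bounds the nilpotency orders.\<close>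

lemma sl2: assumes i: "i \<in> E6_index" shows "sl2_module ws (W s) (Eop i) (Fop i) (Kop i)"
proof (intro sl2_module.intro sl2_module_axioms.intro words.vector_space_axioms)
  show "words.subspace (W s)" by (rule subspace_W)
  show "Vector_Spaces.linear ws ws (Eop i)" "Vector_Spaces.linear ws ws (Fop i)" "Vector_Spaces.linear ws ws (Kop i)"
    by (rule linear_Eop linear_Fop linear_Kop)+
  show "Eop i v \<in> W s" "Fop i v \<in> W s" if "v \<in> W s" for v using that i Eop_closed Fop_closed by auto
  show "Kop i (Eop i v) = ws (qq powi (n + 2)) (Eop i v)" if "Kop i v = ws (qq powi n) v" for v n
    unfolding Kop_Eop[OF i i] that by (simp add: Eop_lin fun_eq_iff qq_powi_add mult_ac)
  show "Kop i (Fop i v) = ws (qq powi (n - 2)) (Fop i v)" if "Kop i v = ws (qq powi n) v" for v n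
    unfolding Kop_Fop[OF i i] that using qq_powi_add[of n "-2"] by (simp add: Fop_lin fun_eq_iff mult_ac)
  show "Eop i (Fop i v) = Fop i (Eop i v) + ws (qi n) v" if "v \<in> W s" "Kop i v = ws (qq powi n) v" for v n
  proof -
    have "(\<lambda>w. qi (ww i w) * v w) = ws (qi n) v" using that(2) unfolding Kop_eigen by (auto simp: fun_eq_iff)
    then show ?thesis using Eop_Fop[OF i i that(1)] by simp
  qed
  show "W s \<subseteq> words.span {v \<in> W s. \<exists>n. Kop i v = ws (qq powi n) v}"
  proof
    fix x assume "x \<in> W s"
    then have x: "x = (\<Sum>w\<in>Words s. ws (x w) (basis_vec w))" by (rule W_expansion)
    have "Kop i (basis_vec w) = ws (qq powi (ww i w)) (basis_vec w)" for w
      unfolding Kop_eigen by (simp add: basis_vec_apply)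
    then have "basis_vec w \<in> {v \<in> W s. \<exists>n. Kop i v = ws (qq powi n) v}" if "w \<in> Words s" for w
      using basis_vec_W[OF that] by blast
    then show "x \<in> words.span {v \<in> W s. \<exists>n. Kop i v = ws (qq powi n) v}"
      by (subst x) (intro words.span_sum words.span_scale words.span_base)
  qed
  show "\<exists>n. (Eop i ^^ n) v = 0" if v: "v \<in> W s" for v
  proof (intro exI[of _ "Suc s"] ext, rule ccontr)
    fix w assume nz: "(Eop i ^^ Suc s) v w \<noteq> 0 w"
    have "(Eop i ^^ n) v \<in> W s" for n by (induction n) (auto intro: v Eop_closed i)
    then have "w \<in> Words s" using nz unfolding W_def by (metis (mono_tags, lifting) mem_Collect_eq zero_fun_apply)
    moreover obtain w' where "v w' \<noteq> 0" "ww i w' = ww i w - 2 * int (Suc s)"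
      using Eop_pow_support[OF i, of "Suc s" v w] nz by auto
    moreover have "w' \<in> Words s" using v \<open>v w' \<noteq> 0\<close> by (simp add: W_def)
    ultimately show False using ww_bound[OF i, of w s] ww_bound[OF i, of w' s] by simp
  qed
  show "\<exists>n. (Fop i ^^ n) v = 0" if v: "v \<in> W s" for v
  proof (intro exI[of _ "Suc s"] ext, rule ccontr)
    fix w assume nz: "(Fop i ^^ Suc s) v w \<noteq> 0 w"
    have "(Fop i ^^ n) v \<in> W s" for n by (induction n) (auto intro: v Fop_closed i)
    then have "w \<in> Words s" using nz unfolding W_def by (metis (mono_tags, lifting) mem_Collect_eq zero_fun_apply)
    moreover obtain w' where "v w' \<noteq> 0" "ww i w' = ww i w + 2 * int (Suc s)"
      using Fop_pow_support[OF i, of "Suc s" v w] nz by auto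
    moreover have "w' \<in> Words s" using v \<open>v w' \<noteq> 0\<close> by (simp add: W_def)
    ultimately show False using ww_bound[OF i, of w s] ww_bound[OF i, of w' s] by simp
  qed
qed

section \<open>The contravariant form\<close>

text \<open>The form for which the words are orthonormal.\<close>

definition ip :: "nat \<Rightarrow> ('a list \<Rightarrow> Qq) \<Rightarrow> ('a list \<Rightarrow> Qq) \<Rightarrow> Qq" where
  "ip s x y = (\<Sum>w\<in>Words s. x w * y w)"

lemma ip_sym: "ip s x y = ip s y x"
  by (simp add: ip_def mult.commute)

lemma ip_add: "ip s (x + y) z = ip s x z + ip s y z"
  and ip_diff: "ip s (x - y) z = ip s x z - ip s y z"
  and ip_zero: "ip s 0 z = 0"
  and ip_scale: "ip s (ws c x) z = c * ip s x z"
  by (simp_all add: ip_def distrib_right left_diff_distrib sum.distrib sum_subtractf sum_distrib_left mult.assoc)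

lemma ip_sum: "ip s (sum f A) z = (\<Sum>a\<in>A. ip s (f a) z)"
proof (induction A rule: infinite_finite_induct)
  case (insert a A)
  show ?case
    unfolding sum.insert[OF insert.hyps] ip_add insert.IH ..
qed (simp_all add: ip_zero[unfolded zero_fun_def] ip_zero)

lemmas ip_linear = ip_add ip_scale ip_zero ip_diff ip_sum

lemma ip_linear_right: "ip s z (x + y) = ip s z x + ip s z y" "ip s z (ws c x) = c * ip s z x"
  "ip s z 0 = 0" "ip s z (x - y) = ip s z x - ip s z y" "ip s z (sum f A) = (\<Sum>a\<in>A. ip s z (f a))"
  using ip_linear[of s] by (simp_all add: ip_sym[of s z])

lemma ip_Suc: "ip (Suc s) x y = (\<Sum>a\<in>X. ip s (\<lambda>v. x (a # v)) (\<lambda>v. y (a # v)))"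
proof -
  have "ip (Suc s) x y = (\<Sum>p\<in>X \<times> Words s. x (fst p # snd p) * y (fst p # snd p))"
    unfolding ip_def Words_Suc by (subst sum.reindex) (auto simp: inj_on_def case_prod_unfold)
  then show ?thesis by (simp add: ip_def sum.cartesian_product case_prod_unfold)
qed

lemma ip_basis_vec: "w \<in> Words s \<Longrightarrow> ip s x (basis_vec w) = x w"
  using finite_Words[of s] by (simp add: ip_def basis_vec_apply if_distrib cong: if_cong)

lemma sum_el_fl:
  assumes "i \<in> E6_index"
  shows "(\<Sum>a\<in>X. case el i a of None \<Rightarrow> 0 | Some b \<Rightarrow> g b a) = (\<Sum>a\<in>X. case fl i a of None \<Rightarrow> 0 | Some b \<Rightarrow> (g a b :: Qq))"
proof -
  have 1: "(case el i a of None \<Rightarrow> 0 | Some b \<Rightarrow> g b a) = (\<Sum>b\<in>X. if fl i b = Some a then g b a else 0)" if "a \<in> X" for a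
  proof (cases "el i a")
    case None
    then have "\<And>b. fl i b \<noteq> Some a" using fl_el[of i _ a] by simp
    then show ?thesis using None by simp
  next
    case (Some b)
    have "b \<in> X" using that Some fl_X[OF assms, of b a] by (simp add: fl_el)
    moreover have "(if fl i b' = Some a then g b' a else 0) = (if b' = b then g b a else 0)" for b'
      using Some by (auto simp: fl_el)
    ultimately show ?thesis using Some finite_X by simp
  qed
  have 2: "(case fl i b of None \<Rightarrow> 0 | Some a \<Rightarrow> g b a) = (\<Sum>a\<in>X. if fl i b = Some a then g b a else 0)" if "b \<in> X" for b
    using that fl_X[OF assms, of b] finite_X by (cases "fl i b") simp_all
  have "(\<Sum>a\<in>X. case el i a of None \<Rightarrow> 0 | Some b \<Rightarrow> g b a) = (\<Sum>a\<in>X. \<Sum>b\<in>X. if fl i b = Some a then g b a else 0)"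
    using 1 by (rule sum.cong[OF refl])
  also have "\<dots> = (\<Sum>b\<in>X. \<Sum>a\<in>X. if fl i b = Some a then g b a else 0)" by (rule sum.swap)
  also have "\<dots> = (\<Sum>b\<in>X. case fl i b of None \<Rightarrow> 0 | Some a \<Rightarrow> g b a)"
    using 2 by (intro sum.cong refl) simp
  finally show ?thesis .
qed

text \<open>Contravariance of the form, by induction on the length: the coproducts of \<open>F\<close> and of \<open>q\<^sup>-\<^sup>1 K E\<close>
are transposed to each other letter by letter.\<close>

lemma ip_F:
  assumes "i \<in> E6_index"
  shows "ip s (Fop i x) y = inverse qq * ip s x (Kop i (Eop i y))"
proof (induction s arbitrary: x y)
  case 0
  have "Words 0 = {[]}" by (auto simp: Words_def)
  then show ?case by (simp add: ip_def Fop_def Kop_def Eop_def)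
next
  case (Suc s)
  let ?s = "\<lambda>x a v. x (a # v) :: Qq"
  have 1: "?s (Fop i x) a = (case el i a of None \<Rightarrow> 0 | Some b \<Rightarrow> ?s x b) + ws (qq powi (wl i a)) (Fop i (?s x a))" for a
    by (auto simp: Fop_def fun_eq_iff split: option.split)
  have 2: "?s (Kop i (Eop i y)) a = (case fl i a of None \<Rightarrow> 0 | Some b \<Rightarrow> ws (qq powi (wl i a)) (?s y b))
      + ws (qq powi (wl i a)) (Kop i (Eop i (?s y a)))" for a
  proof
    fix w
    have "qq powi (wl i a + ww i w) * qq powi (- ww i w) = qq powi (wl i a)" by (simp flip: qq_powi_add)
    then show "?s (Kop i (Eop i y)) a w = ((case fl i a of None \<Rightarrow> 0 | Some b \<Rightarrow> ws (qq powi (wl i a)) (?s y b))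
      + ws (qq powi (wl i a)) (Kop i (Eop i (?s y a)))) w"
      by (simp add: Eop_def Kop_def distrib_left qq_powi_add flip: mult.assoc split: option.split)
  qed
  have "ip (Suc s) (Fop i x) y = (\<Sum>a\<in>X. ip s (case el i a of None \<Rightarrow> 0 | Some b \<Rightarrow> ?s x b) (?s y a))
      + (\<Sum>a\<in>X. qq powi (wl i a) * ip s (Fop i (?s x a)) (?s y a))"
    unfolding ip_Suc 1 ip_linear sum.distrib ..
  also have "(\<Sum>a\<in>X. ip s (case el i a of None \<Rightarrow> 0 | Some b \<Rightarrow> ?s x b) (?s y a))
     = (\<Sum>a\<in>X. case el i a of None \<Rightarrow> 0 | Some b \<Rightarrow> ip s (?s x b) (?s y a))"
    by (intro sum.cong refl) (simp add: ip_linear split: option.split)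
  also have "\<dots> = (\<Sum>a\<in>X. case fl i a of None \<Rightarrow> 0 | Some b \<Rightarrow> ip s (?s x a) (?s y b))"
    by (rule sum_el_fl[OF assms])
  also have "\<dots> = (\<Sum>a\<in>X. inverse qq * ip s (?s x a) (case fl i a of None \<Rightarrow> 0 | Some b \<Rightarrow> ws (qq powi (wl i a)) (?s y b)))"
  proof (intro sum.cong refl)
    fix a assume "a \<in> X"
    then show "(case fl i a of None \<Rightarrow> 0 | Some b \<Rightarrow> ip s (?s x a) (?s y b)) =
       inverse qq * ip s (?s x a) (case fl i a of None \<Rightarrow> 0 | Some b \<Rightarrow> ws (qq powi (wl i a)) (?s y b))"
      using fl_wl[OF assms, of a] by (cases "fl i a") (simp_all add: ip_linear_right)
  qed
  also have "(\<Sum>a\<in>X. qq powi (wl i a) * ip s (Fop i (?s x a)) (?s y a)) =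
     (\<Sum>a\<in>X. inverse qq * ip s (?s x a) (ws (qq powi (wl i a)) (Kop i (Eop i (?s y a)))))"
    unfolding Suc.IH ip_linear_right by (simp add: mult_ac)
  finally have "ip (Suc s) (Fop i x) y = (\<Sum>a\<in>X. inverse qq * ip s (?s x a) (case fl i a of None \<Rightarrow> 0 | Some b \<Rightarrow> ws (qq powi (wl i a)) (?s y b)))
     + (\<Sum>a\<in>X. inverse qq * ip s (?s x a) (ws (qq powi (wl i a)) (Kop i (Eop i (?s y a)))))" .
  then show ?case unfolding ip_Suc 2 ip_linear_right sum.distrib distrib_left sum_distrib_left .
qed

lemma ip_K: "ip s (Kop i x) y = ip s x (Kop i y)"
  by (simp add: ip_def Kop_def mult_ac)

lemma ip_FE:
  assumes "i \<in> E6_index"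
  shows "ip s (Fop i (Eop i x)) y = ip s x (Fop i (Eop i y))"
proof -
  have "ip s (Fop i (Eop i x)) y = inverse qq * ip s (Kop i (Eop i x)) (Eop i y)"
    unfolding ip_F[OF assms] ip_K ..
  also have "\<dots> = ip s (Fop i (Eop i y)) x"
    unfolding ip_F[OF assms] by (simp add: ip_sym)
  finally show ?thesis by (simp add: ip_sym)
qed

section \<open>The lattice of words\<close>

definition LW :: "nat \<Rightarrow> ('a list \<Rightarrow> Qq) set" where
  "LW s = {x \<in> W s. \<forall>w. x w \<in> A0}"

definition mW :: "nat \<Rightarrow> ('a list \<Rightarrow> Qq) set" where
  "mW s = {x \<in> W s. \<forall>w. x w \<in> m0}"

text \<open>The lattice is described by the norm, since a sum of squares is regular at \<open>q = 0\<close> only if all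
its terms are. The same holds below for \<open>q\<close> times the lattice and for the zero vector.\<close>

lemma LW_iff: assumes "x \<in> W s" shows "x \<in> LW s \<longleftrightarrow> ip s x x \<in> A0"
proof
  assume "x \<in> LW s"
  then show "ip s x x \<in> A0" unfolding ip_def by (intro A0_sum A0_mult) (auto simp: LW_def)
next
  assume "ip s x x \<in> A0"
  then have "x w \<in> A0" if "w \<in> Words s" for w
    using sum_squares_A0[OF finite_Words, of x s w] that by (simp add: ip_def)
  then have "x w \<in> A0" for w using W_zero[OF assms, of w] by (cases "w \<in> Words s") auto
  then show "x \<in> LW s" using assms by (simp add: LW_def)
qed

lemma mW_iff: assumes "x \<in> W s" shows "x \<in> mW s \<longleftrightarrow> ip s x x \<in> m0"
proof
  assume "x \<in> mW s"
  then show "ip s x x \<in> m0" unfolding ip_def by (intro m0_sum m0_mult m0_A0) (auto simp: mW_def)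
next
  assume "ip s x x \<in> m0"
  then have "x w \<in> m0" if "w \<in> Words s" for w
    using sum_squares_m0[OF finite_Words, of x s w] that by (simp add: ip_def)
  then have "x w \<in> m0" for w using W_zero[OF assms, of w] by (cases "w \<in> Words s") auto
  then show "x \<in> mW s" using assms by (simp add: mW_def)
qed

lemma ip_definite: assumes "x \<in> W s" "ip s x x = 0" shows "x = 0"
proof
  fix w
  have "x w = 0" if "w \<in> Words s"
    using sum_squares_eq_0[OF finite_Words, of x s w] that assms(2) by (simp add: ip_def)
  then show "x w = 0 w" using W_zero[OF assms(1), of w] by (cases "w \<in> Words s") auto
qed

lemma LW_W: "x \<in> LW s \<Longrightarrow> x \<in> W s" and mW_W: "x \<in> mW s \<Longrightarrow> x \<in> W s"
  and mW_LW: "x \<in> mW s \<Longrightarrow> x \<in> LW s"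
  by (auto simp: LW_def mW_def m0_A0)

lemma LW_lin: "x \<in> LW s \<Longrightarrow> y \<in> LW s \<Longrightarrow> x + y \<in> LW s" "c \<in> A0 \<Longrightarrow> x \<in> LW s \<Longrightarrow> ws c x \<in> LW s"
  "x \<in> LW s \<Longrightarrow> y \<in> LW s \<Longrightarrow> x - y \<in> LW s" "0 \<in> LW s"
  using words.subspace_add[OF subspace_W] words.subspace_scale[OF subspace_W] words.subspace_diff[OF subspace_W]
    words.subspace_0[OF subspace_W]
  by (auto simp: LW_def A0_add A0_mult A0_diff)

lemma mW_lin: "x \<in> mW s \<Longrightarrow> y \<in> mW s \<Longrightarrow> x + y \<in> mW s" "c \<in> A0 \<Longrightarrow> x \<in> mW s \<Longrightarrow> ws c x \<in> mW s"
  "x \<in> mW s \<Longrightarrow> y \<in> mW s \<Longrightarrow> x - y \<in> mW s" "0 \<in> mW s"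
  using words.subspace_add[OF subspace_W] words.subspace_scale[OF subspace_W] words.subspace_diff[OF subspace_W]
    words.subspace_0[OF subspace_W]
  by (auto simp: mW_def m0_add m0_mult m0_diff)

lemma LW_sum: "(\<And>a. a \<in> A \<Longrightarrow> f a \<in> LW s) \<Longrightarrow> sum f A \<in> LW s"
  by (induction A rule: infinite_finite_induct) (auto intro: LW_lin)

lemma mW_qq: "x \<in> mW s \<longleftrightarrow> (\<exists>y\<in>LW s. x = ws qq y)"
proof
  assume x: "x \<in> mW s"
  have "ws (inverse qq) x \<in> LW s"
  proof -
    have "inverse qq * x w \<in> A0" for w
    proof -
      have "x w \<in> m0" using x by (simp add: mW_def)
      then show ?thesis by (rule m0_E) (simp flip: mult.assoc)
    qed
    then show ?thesis using x words.subspace_scale[OF subspace_W] by (auto simp: LW_def mW_def)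
  qed
  then show "\<exists>y\<in>LW s. x = ws qq y" by (intro bexI[of _ "ws (inverse qq) x"]) (auto simp: fun_eq_iff)
next
  assume "\<exists>y\<in>LW s. x = ws qq y"
  then show "x \<in> mW s" using words.subspace_scale[OF subspace_W] by (auto simp: LW_def mW_def m0_I)
qed

lemma basis_vec_LW: "w \<in> Words s \<Longrightarrow> basis_vec w \<in> LW s"
  using basis_vec_W[of w s] by (simp add: LW_def basis_vec_apply)

lemma basis_vec_mW: "w \<in> Words s \<Longrightarrow> basis_vec w \<notin> mW s"
  using one_notin_m0 by (auto simp: mW_def basis_vec_apply split: if_splits)

abbreviation wft :: "nat \<Rightarrow> nat \<Rightarrow> ('a list \<Rightarrow> Qq) \<Rightarrow> 'a list \<Rightarrow> Qq" where
  "wft s i \<equiv> sl2_module.ft ws (W s) (Eop i) (Fop i) (Kop i)"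
abbreviation wet :: "nat \<Rightarrow> nat \<Rightarrow> ('a list \<Rightarrow> Qq) \<Rightarrow> 'a list \<Rightarrow> Qq" where
  "wet s i \<equiv> sl2_module.et ws (W s) (Eop i) (Fop i) (Kop i)"

context
  fixes i s :: nat
  assumes i: "i \<in> E6_index"
begin

interpretation M: sl2_module ws "W s" "Eop i" "Fop i" "Kop i" by (rule sl2[OF i])

text \<open>Both \<open>K\<close> and \<open>F E\<close> are self-adjoint, and their eigenvalues separate the strings.\<close>

lemma strings_orthogonal:
  assumes "x \<in> M.strings a" "y \<in> M.strings b" "a \<noteq> b"
  shows "ip s x y = 0"
proof (rule ccontr)
  assume nz: "ip s x y \<noteq> 0"
  obtain n k where a: "a = (n, k)" by (cases a)
  obtain n' k' where b: "b = (n', k')" by (cases b)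
  have "qq powi (int n - 2 * int k) * ip s x y = qq powi (int n' - 2 * int k') * ip s x y"
    using ip_K[of s i x y] M.strings_weight assms(1,2) unfolding a b by (simp add: ip_linear ip_linear_right)
  moreover have "qi (int k) * qi (int n - int k + 1) * ip s x y = qi (int k') * qi (int n' - int k' + 1) * ip s x y"
    using ip_FE[OF i, of s x y] M.strings_F_E assms(1,2) unfolding a b by (simp add: ip_linear ip_linear_right)
  ultimately have "int n - 2 * int k = int n' - 2 * int k'"
    "qi (int k) * qi (int n - int k + 1) = qi (int k') * qi (int n' - int k' + 1)"
    using nz by (simp_all add: qq_powi_inject)
  then have "int n = int n'" "int k = int k'" using qi_string_inj[of "int n" "int k" "int n'" "int k'"] by auto
  then show False using assms(3) a b by simp
qed

lemma ip_Eop_string: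
  assumes "x \<in> M.strings (n, k)"
  shows "ip s (Eop i x) (Eop i x) = qq powi (2 * int k - int n - 1) * (qi (int k) * qi (int n - int k + 1)) * ip s x x"
proof -
  have "Kop i (Eop i x) = ws (qq powi (int n - 2 * int k + 2)) (Eop i x)"
    using M.strings_weight[OF assms] M.strings_closed[OF assms] by (rule M.K_E[rotated])
  then have "ip s (Fop i (Eop i x)) x = inverse qq * (qq powi (int n - 2 * int k + 2) * ip s (Eop i x) (Eop i x))"
    using ip_F[OF i, of s "Eop i x" x] by (simp add: ip_linear_right)
  also have "inverse qq * (qq powi (int n - 2 * int k + 2) * ip s (Eop i x) (Eop i x)) =
      qq powi (int n - 2 * int k + 1) * ip s (Eop i x) (Eop i x)"
  proof -
    have "int n - 2 * int k + 2 = 1 + (int n - 2 * int k + 1)" by simp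
    then have "qq powi (int n - 2 * int k + 2) = qq * qq powi (int n - 2 * int k + 1)"
      by (simp only: qq_powi_add power_int_1_right)
    then show ?thesis by simp
  qed
  finally have "qq powi (int n - 2 * int k + 1) * ip s (Eop i x) (Eop i x) = (qi (int k) * qi (int n - int k + 1)) * ip s x x"
    using M.strings_F_E[OF assms] by (simp add: ip_linear)
  then have "qq powi (2 * int k - int n - 1) * (qq powi (int n - 2 * int k + 1) * ip s (Eop i x) (Eop i x)) =
     qq powi (2 * int k - int n - 1) * (qi (int k) * qi (int n - int k + 1)) * ip s x x" by simp
  moreover have "qq powi (2 * int k - int n - 1) * qq powi (int n - 2 * int k + 1) = 1"
    by (simp flip: qq_powi_add)
  ultimately show ?thesis by (simp flip: mult.assoc)
qed

lemma ip_Fop_string: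
  assumes "x \<in> M.strings (n, k)"
  shows "ip s (Fop i x) (Fop i x) = qq powi (int n - 2 * int k - 1) * (qi (int k + 1) * qi (int n - int k)) * ip s x x"
proof -
  have xW: "x \<in> W s" by (rule M.strings_closed[OF assms])
  have K: "Kop i x = ws (qq powi (int n - 2 * int k)) x" using M.strings_weight[OF assms] .
  have EF: "Eop i (Fop i x) = ws (qi (int k + 1) * qi (int n - int k)) x"
    unfolding M.E_F[OF xW K] M.strings_F_E[OF assms] words.scale_left_distrib[symmetric] qi_string_step ..
  have "ip s (Fop i x) (Fop i x) = inverse qq * (qi (int k + 1) * qi (int n - int k) * (qq powi (int n - 2 * int k) * ip s x x))"
    unfolding ip_F[OF i] EF Kop_lin K by (simp add: ip_linear_right)
  moreover have "qq powi (int n - 2 * int k) = qq * qq powi (int n - 2 * int k - 1)"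
    using qq_powi_add[of "int n - 2 * int k - 1" 1] by simp
  ultimately show ?thesis by simp
qed

lemma qi_ratio_A0: "qq powi (int m - int k) * qi (int (Suc m)) * inverse (qi (int (Suc k))) \<in> A0"
proof -
  have "qq powi (int m - int k) * qi (int (Suc m)) * inverse (qi (int (Suc k)))
    = (qq ^ m * qint (Suc m)) * inverse (qq ^ k * qint (Suc k))"
    by (simp add: qint_qi power_int_diff field_simps)
  then show ?thesis using A0_mult[OF qint_leading_A0 qint_leading_inverse] by simp
qed

text \<open>On \<open>strings (n, k)\<close> the operator \<open>F / [k + 1]\<close> multiplies norms by \<open>q^(n-2k-1) [n-k] / [k+1]\<close>, which
is regular at \<open>q = 0\<close> by the leading terms of quantum integers.\<close>

lemma f_map_norm:
  assumes "x \<in> M.strings a" "a \<in> M.string_index"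
  shows "\<exists>c\<in>A0. ip s (M.f_map a x) (M.f_map a x) = c * ip s x x"
proof -
  obtain n k where a: "a = (n, k)" by (cases a)
  have k: "k \<le> n" using assms(2) by (simp add: a M.string_index_def)
  let ?c = "inverse (qi (int k + 1)) * inverse (qi (int k + 1)) * (qq powi (int n - 2 * int k - 1) * (qi (int k + 1) * qi (int n - int k)))"
  have nz: "qi (int k + 1) \<noteq> 0" by simp
  have "ip s (M.f_map a x) (M.f_map a x) = ?c * ip s x x"
    using ip_Fop_string[of x n k] assms(1) unfolding a
    by (simp add: M.f_map_def ip_linear ip_linear_right qint_qi add.commute mult_ac)
  moreover have "?c = qq powi (int n - 2 * int k - 1) * qi (int n - int k) * inverse (qi (int k + 1))"
    using nz by (simp add: mult_ac)
  moreover have "qq powi (int n - 2 * int k - 1) * qi (int n - int k) * inverse (qi (int k + 1)) \<in> A0"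
  proof (cases "k = n")
    case False
    then obtain m where m: "n = k + Suc m" using k by (metis add_Suc_right less_iff_Suc_add le_neq_implies_less)
    have e: "int m - int k = int n - 2 * int k - 1" "int (Suc m) = int n - int k" "int (Suc k) = int k + 1"
      using m by simp_all
    show ?thesis using qi_ratio_A0[of m k] unfolding e .
  qed simp
  ultimately show ?thesis by metis
qed

lemma e_map_norm:
  assumes "x \<in> M.strings a" "a \<in> M.string_index"
  shows "\<exists>c\<in>A0. ip s (M.e_map a x) (M.e_map a x) = c * ip s x x"
proof -
  obtain n k where a: "a = (n, k)" by (cases a)
  have k: "k \<le> n" using assms(2) by (simp add: a M.string_index_def)
  let ?r = "qi (int n - int k + 1)"
  let ?c = "inverse ?r * inverse ?r * (qq powi (2 * int k - int n - 1) * (qi (int k) * ?r))"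
  have nz: "?r \<noteq> 0" using k by simp
  have "ip s (M.e_map a x) (M.e_map a x) = ?c * ip s x x"
    using ip_Eop_string[of x n k] assms(1) unfolding a
    by (simp add: M.e_map_def ip_linear ip_linear_right mult_ac)
  moreover have "?c = qq powi (2 * int k - int n - 1) * qi (int k) * inverse ?r"
    using nz by (simp add: mult_ac)
  moreover have "qq powi (2 * int k - int n - 1) * qi (int k) * inverse ?r \<in> A0"
  proof (cases k)
    case (Suc m)
    obtain d where d: "n = k + d" using k by (metis le_iff_add)
    have e: "int m - int d = 2 * int k - int n - 1" "int (Suc d) = int n - int k + 1" using d Suc by simp_all
    show ?thesis using qi_ratio_A0[of m d] unfolding e Suc[symmetric] .
  qed simp
  ultimately show ?thesis by metis
qed

text \<open>By orthogonality the norm of \<open>x\<close> is the sum of the norms of its components in the strings, so all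
coefficients of all components occur in one sum of squares. Hence the components lie in the lattice
if \<open>x\<close> does.\<close>

lemma string_map_lattice:
  assumes "x \<in> LW s"
    and G: "\<And>a. Vector_Spaces.linear ws ws (G a)"
    and closed: "\<And>a v. v \<in> W s \<Longrightarrow> G a v \<in> W s"
    and norm: "\<And>a v. v \<in> M.strings a \<Longrightarrow> a \<in> M.string_index \<Longrightarrow> \<exists>c\<in>A0. ip s (G a v) (G a v) = c * ip s v v"
  shows "M.string_map G x \<in> LW s"
proof -
  have xW: "x \<in> W s" using assms(1) by (rule LW_W)
  obtain A z where A: "finite A" "A \<subseteq> M.string_index" "\<And>a. a \<in> A \<Longrightarrow> z a \<in> M.strings a" "x = sum z A"
    using M.string_decomposition[OF xW] by blast
  have "ip s x x = (\<Sum>a\<in>A. \<Sum>b\<in>A. ip s (z a) (z b))"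
    unfolding A(4) ip_linear ip_linear_right by (rule sum.swap)
  also have "\<dots> = (\<Sum>a\<in>A. ip s (z a) (z a))"
  proof (rule sum.cong[OF refl])
    fix a assume a: "a \<in> A"
    have "(\<Sum>b\<in>A. ip s (z a) (z b)) = (\<Sum>b\<in>A. if a = b then ip s (z a) (z b) else 0)"
    proof (intro sum.cong refl)
      fix b assume "b \<in> A"
      then show "ip s (z a) (z b) = (if a = b then ip s (z a) (z b) else 0)"
        using strings_orthogonal[OF A(3)[OF a] A(3)[of b]] by simp
    qed
    then show "(\<Sum>b\<in>A. ip s (z a) (z b)) = ip s (z a) (z a)" using A(1) a by simp
  qed
  also have "\<dots> = (\<Sum>p\<in>A \<times> Words s. z (fst p) (snd p) * z (fst p) (snd p))"
    by (simp add: ip_def sum.cartesian_product case_prod_unfold)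
  finally have "(\<Sum>p\<in>A \<times> Words s. z (fst p) (snd p) * z (fst p) (snd p)) \<in> A0"
    using LW_iff[OF xW] assms(1) by simp
  note sq = sum_squares_A0[OF finite_cartesian_product[OF A(1) finite_Words] this]
  have zA: "z a w \<in> A0" if "a \<in> A" "w \<in> Words s" for a w
    using sq[of "(a, w)"] that by simp
  have zL: "z a \<in> LW s" if a: "a \<in> A" for a
  proof -
    have zW: "z a \<in> W s" using M.strings_closed A(3)[OF a] by blast
    have "z a w \<in> A0" for w using zA[OF a, of w] W_zero[OF zW, of w] by (cases "w \<in> Words s") auto
    then show ?thesis using zW by (simp add: LW_def)
  qed
  have "G a (z a) \<in> LW s" if a: "a \<in> A" for a
  proof -
    have W: "G a (z a) \<in> W s" using closed LW_W[OF zL[OF a]] .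
    have "a \<in> M.string_index" using A(2) a by blast
    from norm[OF A(3)[OF a] this] obtain c where c: "c \<in> A0" "ip s (G a (z a)) (G a (z a)) = c * ip s (z a) (z a)" by blast
    then have "ip s (G a (z a)) (G a (z a)) \<in> A0"
      using LW_iff[OF LW_W[OF zL[OF a]]] zL[OF a] by (simp add: A0_mult)
    then show ?thesis using LW_iff[OF W] by simp
  qed
  then have "(\<Sum>a\<in>A. G a (z a)) \<in> LW s" by (rule LW_sum)
  moreover have "M.string_map G x = (\<Sum>a\<in>A. G a (z a))"
    unfolding A(4) by (rule M.string_map_sum[OF G A(1-3)])
  ultimately show ?thesis by simp
qed

lemma wft_LW: assumes "x \<in> LW s" shows "wft s i x \<in> LW s"
  unfolding M.ft_def
proof (rule string_map_lattice[OF assms M.linear_f_map])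
  show "M.f_map a v \<in> W s" if "v \<in> W s" for a v
    using that Fop_closed[OF i] words.subspace_scale[OF subspace_W] by (simp add: M.f_map_def)
qed (rule f_map_norm)

lemma wet_LW: assumes "x \<in> LW s" shows "wet s i x \<in> LW s"
  unfolding M.et_def
proof (rule string_map_lattice[OF assms M.linear_e_map])
  show "M.e_map a v \<in> W s" if "v \<in> W s" for a v
    using that Eop_closed[OF i] words.subspace_scale[OF subspace_W] by (simp add: M.e_map_def)
qed (rule e_map_norm)

lemma wft_mW: "x \<in> mW s \<Longrightarrow> wft s i x \<in> mW s"
  unfolding mW_qq using wft_LW M.ft_scale LW_W by blast

lemma wet_mW: "x \<in> mW s \<Longrightarrow> wet s i x \<in> mW s"
  unfolding mW_qq using wet_LW M.et_scale LW_W by blast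

lemma wft_cong:
  assumes "x \<in> W s" "y \<in> W s" "x - y \<in> mW s" shows "wft s i x - wft s i y \<in> mW s"
proof -
  have "wft s i x = wft s i (x - y) + wft s i y"
    using M.ft_add[of "x - y" y] assms(2) mW_W[OF assms(3)] by simp
  then show ?thesis using wft_mW[OF assms(3)] by simp
qed

lemma wet_cong:
  assumes "x \<in> W s" "y \<in> W s" "x - y \<in> mW s" shows "wet s i x - wet s i y \<in> mW s"
proof -
  have "wet s i x = wet s i (x - y) + wet s i y"
    using M.et_add[of "x - y" y] assms(2) mW_W[OF assms(3)] by simp
  then show ?thesis using wet_mW[OF assms(3)] by simp
qed

end

section \<open>The signature rule\<close>

text \<open>The number of steps up the string through a word: reading from the right, a letter with an
incoming arrow counts one, and a letter with an outgoing arrow cancels one such letter to its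
right. The operators below follow Kashiwara's rule, by which \<open>f\<close> acts on the left factor of
\<open>a \<otimes> w\<close> iff \<open>\<phi>(a) > \<epsilon>(w)\<close>.\<close>

primrec word_eps :: "nat \<Rightarrow> 'a list \<Rightarrow> nat" where
  "word_eps i [] = 0"
| "word_eps i (a # w) = (if fl i a \<noteq> None then word_eps i w - 1 else if el i a \<noteq> None then word_eps i w + 1 else word_eps i w)"

primrec word_f :: "nat \<Rightarrow> 'a list \<Rightarrow> 'a list option" where
  "word_f i [] = None"
| "word_f i (a # w) = (if fl i a \<noteq> None \<and> word_eps i w = 0 then map_option (\<lambda>b. b # w) (fl i a)
     else map_option ((#) a) (word_f i w))"

primrec word_e :: "nat \<Rightarrow> 'a list \<Rightarrow> 'a list option" where
  "word_e i [] = None"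
| "word_e i (a # w) = (if word_eps i w = 0 then map_option (\<lambda>b. b # w) (el i a)
     else if word_eps i w = 1 \<and> fl i a \<noteq> None then None else map_option ((#) a) (word_e i w))"

lemma tens_lin: "tens a (ws c v) = ws c (tens a v)" "tens a (x + y) = tens a x + tens a y" "tens a 0 = 0"
proof -
  show "tens a (ws c v) = ws c (tens a v)"
  proof
    fix w show "tens a (ws c v) w = ws c (tens a v) w" by (cases w) simp_all
  qed
  show "tens a (x + y) = tens a x + tens a y"
  proof
    fix w show "tens a (x + y) w = (tens a x + tens a y) w" by (cases w) simp_all
  qed
  show "tens a 0 = 0"
  proof
    fix w show "tens a 0 w = 0 w" by (cases w) simp_all
  qed
qed

lemma tens_basis_vec: "tens a (basis_vec w) = basis_vec (a # w)"
proof
  fix u show "tens a (basis_vec w) u = basis_vec (a # w) u"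
    by (cases u) (simp_all add: basis_vec_apply)
qed

lemma tens_W: "a \<in> X \<Longrightarrow> v \<in> W s \<Longrightarrow> tens a v \<in> W (Suc s)"
  by (auto simp: W_def tens_def Words_def split: list.splits if_splits)

lemma tens_slice: "(\<lambda>u. tens a v (c # u)) = (if c = a then v else (\<lambda>_. 0))"
  by auto

lemma Fop_tens: "Fop i (tens a v) = (case fl i a of None \<Rightarrow> 0 | Some b \<Rightarrow> tens b v) + ws (qq powi (wl i a)) (tens a (Fop i v))"
proof
  fix w
  show "Fop i (tens a v) w = ((case fl i a of None \<Rightarrow> 0 | Some b \<Rightarrow> tens b v) + ws (qq powi (wl i a)) (tens a (Fop i v))) w"
  proof (cases w)
    case Nil
    then show ?thesis by (simp add: Fop_def split: option.split)
  next
    case (Cons c u)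
    have "(case el i c of None \<Rightarrow> 0 | Some b \<Rightarrow> tens a v (b # u)) =
      (case fl i a of None \<Rightarrow> 0 | Some b \<Rightarrow> if c = b then v u else 0)"
      using fl_el[of i a c] by (cases "el i c"; cases "fl i a") auto
    moreover have "(case fl i a of None \<Rightarrow> 0 | Some b \<Rightarrow> tens b v) (c # u) = (case fl i a of None \<Rightarrow> 0 | Some b \<Rightarrow> if c = b then v u else 0)"
      by (simp split: option.split)
    ultimately show ?thesis using Cons by (simp add: Fop_def tens_slice Fw_linear del: tens_Cons) simp
  qed
qed

lemma Eop_tens: "Eop i (tens a v) = (case el i a of None \<Rightarrow> 0 | Some b \<Rightarrow> tens b (\<lambda>u. qq powi (- ww i u) * v u)) + tens a (Eop i v)"
proof
  fix w
  show "Eop i (tens a v) w = ((case el i a of None \<Rightarrow> 0 | Some b \<Rightarrow> tens b (\<lambda>u. qq powi (- ww i u) * v u)) + tens a (Eop i v)) w"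
  proof (cases w)
    case Nil
    then show ?thesis by (simp add: Eop_def split: option.split)
  next
    case (Cons c u)
    have "(case fl i c of None \<Rightarrow> 0 | Some b \<Rightarrow> qq powi (- ww i u) * tens a v (b # u)) =
      (case el i a of None \<Rightarrow> 0 | Some b \<Rightarrow> if c = b then qq powi (- ww i u) * v u else 0)"
      using fl_el[of i c a] by (cases "fl i c"; cases "el i a") auto
    moreover have "(case el i a of None \<Rightarrow> 0 | Some b \<Rightarrow> tens b (\<lambda>u. qq powi (- ww i u) * v u)) (c # u) =
      (case el i a of None \<Rightarrow> 0 | Some b \<Rightarrow> if c = b then qq powi (- ww i u) * v u else 0)"
      by (simp split: option.split)
    ultimately show ?thesis using Cons by (simp add: Eop_def tens_slice Ew_linear del: tens_Cons) simp
  qed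
qed

lemma Kop_tens: "Kop i (tens a v) = ws (qq powi (wl i a)) (tens a (Kop i v))"
proof
  fix w show "Kop i (tens a v) w = ws (qq powi (wl i a)) (tens a (Kop i v)) w"
    by (cases w) (simp_all add: Kop_def qq_powi_add)
qed

text \<open>Congruence modulo \<open>q\<close>, coefficient by coefficient.\<close>

definition near :: "('a list \<Rightarrow> Qq) \<Rightarrow> ('a list \<Rightarrow> Qq) \<Rightarrow> bool" where
  "near x y \<longleftrightarrow> (\<forall>u. x u - y u \<in> m0)"

lemma near_tens: "near x y \<Longrightarrow> near (tens a x) (tens a y)"
  unfolding near_def
proof
  fix u assume "\<forall>u. x u - y u \<in> m0"
  then show "tens a x u - tens a y u \<in> m0" by (cases u) auto
qed

lemma near_perturb:
  assumes "near x y" "\<And>u. z u \<in> m0" shows "near (x + z) y"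
  unfolding near_def
proof
  fix u
  have "(x u - y u) + z u \<in> m0" using assms by (intro m0_add) (auto simp: near_def)
  then show "(x + z) u - y u \<in> m0" by (simp add: algebra_simps)
qed

lemma near_A0: assumes "near x (basis_vec w)" shows "x u \<in> A0"
proof -
  have "x u = (x u - basis_vec w u) + basis_vec w u" by simp
  moreover have "x u - basis_vec w u \<in> A0" using assms m0_A0 by (simp add: near_def)
  moreover have "basis_vec w u \<in> A0" by (simp add: basis_vec_apply)
  ultimately show ?thesis using A0_add by metis
qed

lemma tens_A0: "(\<And>u. x u \<in> A0) \<Longrightarrow> tens a x u \<in> A0"
  by (cases u) auto

abbreviation Fd :: "nat \<Rightarrow> nat \<Rightarrow> ('a list \<Rightarrow> Qq) \<Rightarrow> 'a list \<Rightarrow> Qq" where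
  "Fd i \<equiv> sl2_module.Fdiv ws (Fop i)"

text \<open>The string generated by the highest weight vector \<open>v\<close> of weight \<open>n\<close> runs modulo \<open>q\<close> through the words
\<open>c 0, ..., c n\<close>, and these words form a string for the signature rule.\<close>

definition word_string :: "nat \<Rightarrow> nat \<Rightarrow> nat \<Rightarrow> ('a list \<Rightarrow> Qq) \<Rightarrow> (nat \<Rightarrow> 'a list) \<Rightarrow> bool" where
  "word_string i s n v c \<longleftrightarrow> v \<in> W s \<and> Eop i v = 0 \<and> Kop i v = ws (qq powi int n) v \<and>
     (\<forall>j\<le>n. c j \<in> Words s \<and> near (Fd i j v) (basis_vec (c j)) \<and> word_eps i (c j) = j \<and>
        word_f i (c j) = (if j < n then Some (c (Suc j)) else None) \<and>
        word_e i (c j) = (if j = 0 then None else Some (c (j - 1))))"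

lemma near_mW: "x \<in> W s \<Longrightarrow> y \<in> W s \<Longrightarrow> near x y \<longleftrightarrow> x - y \<in> mW s"
  using words.subspace_diff[OF subspace_W] by (auto simp: mW_def near_def)

definition opt_vec :: "'a list option \<Rightarrow> 'a list \<Rightarrow> Qq" where
  "opt_vec x = (case x of None \<Rightarrow> 0 | Some w \<Rightarrow> basis_vec w)"

lemma word_stringI:
  assumes "v \<in> W s" "Eop i v = 0" "Kop i v = ws (qq powi int n) v"
    and "\<And>j. j \<le> n \<Longrightarrow> c j \<in> Words s" "\<And>j. j \<le> n \<Longrightarrow> near (Fd i j v) (basis_vec (c j))"
    and "\<And>j. j \<le> n \<Longrightarrow> word_eps i (c j) = j"
    and "\<And>j. j \<le> n \<Longrightarrow> word_f i (c j) = (if j < n then Some (c (Suc j)) else None)"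
    and "\<And>j. j \<le> n \<Longrightarrow> word_e i (c j) = (if j = 0 then None else Some (c (j - 1)))"
  shows "word_string i s n v c"
  unfolding word_string_def using assms by blast

lemma word_string_base:
  assumes "word_string i s n v c" shows "v \<in> W s" "Eop i v = 0" "Kop i v = ws (qq powi int n) v"
  using assms unfolding word_string_def by blast+

lemma word_string_at:
  assumes "word_string i s n v c" "j \<le> n"
  shows "c j \<in> Words s" "near (Fd i j v) (basis_vec (c j))" "word_eps i (c j) = j"
    "word_f i (c j) = (if j < n then Some (c (Suc j)) else None)"
    "word_e i (c j) = (if j = 0 then None else Some (c (j - 1)))"
  using assms unfolding word_string_def by blast+

context
  fixes i :: nat
  assumes i: "i \<in> E6_index"
begin

lemma fl_Some_facts:
  assumes "a \<in> X" "fl i a = Some b"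
  shows "el i a = None" "fl i b = None" "el i b = Some a" "wl i a = 1" "wl i b = -1" "b \<in> X"
proof -
  show b: "b \<in> X" using fl_X[OF i assms(2)] assms(1) by simp
  show eb: "el i b = Some a" using assms(2) by (simp add: fl_el)
  show a1: "wl i a = 1" using fl_wl[OF i assms(1)] assms(2) by simp
  show b1: "wl i b = -1" using el_wl[OF i b] eb by simp
  show "el i a = None" using el_wl[OF i assms(1)] a1 by auto
  show "fl i b = None" using fl_wl[OF i b] b1 by auto
qed

lemma word_string_hw:
  assumes "word_string i s n v c" shows "sl2_module.hw ws (W s) (Eop i) (Kop i) n v"
proof -
  interpret sl2_module ws "W s" "Eop i" "Fop i" "Kop i" by (rule sl2[OF i])
  show ?thesis using assms by (simp add: hw_def word_string_def)
qed

lemma word_string_D: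
  assumes "word_string i s n v c"
  shows "Fop i (Fd i k v) = ws (qint (Suc k)) (Fd i (Suc k) v)"
    "Eop i (Fd i (Suc k) v) = ws (qi (int n - int k)) (Fd i k v)"
    "Kop i (Fd i k v) = ws (qq powi (int n - 2 * int k)) (Fd i k v)"
    "Fd i (Suc n) v = 0" "Fd i 0 v = v" "Fd i k v \<in> W s"
    "k \<le> Suc n \<Longrightarrow> Fd i k v u \<in> A0"
proof -
  interpret sl2_module ws "W s" "Eop i" "Fop i" "Kop i" by (rule sl2[OF i])
  note hw = word_string_hw[OF assms]
  show "Fop i (Fd i k v) = ws (qint (Suc k)) (Fd i (Suc k) v)" by (rule F_Fdiv)
  show "Eop i (Fd i (Suc k) v) = ws (qi (int n - int k)) (Fd i k v)" by (rule E_Fdiv[OF hw])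
  show "Kop i (Fd i k v) = ws (qq powi (int n - 2 * int k)) (Fd i k v)" by (rule Fdiv_weight[OF hw])
  show e: "Fd i (Suc n) v = 0" by (rule Fdiv_end[OF hw])
  show "Fd i 0 v = v" by simp
  show "Fd i k v \<in> W s" by (rule Fdiv_closed[OF hw_D(1)[OF hw]])
  show "Fd i k v u \<in> A0" if "k \<le> Suc n"
  proof (cases "k = Suc n")
    case False
    then have "near (Fd i k v) (basis_vec (c k))" using that assms by (simp add: word_string_def)
    then show ?thesis by (rule near_A0)
  qed (simp add: e)
qed

lemma Fd_eqI: "z 0 = v \<Longrightarrow> (\<And>k. Fop i (z k) = ws (qint (Suc k)) (z (Suc k))) \<Longrightarrow> Fd i k v = z k"
  using sl2_module.Fdiv_eqI[OF sl2[OF i]] .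

lemma word_string_Nil: "word_string i 0 0 (basis_vec []) (\<lambda>_. [])"
proof -
  interpret sl2_module ws "W 0" "Eop i" "Fop i" "Kop i" by (rule sl2[OF i])
  have w: "[] \<in> Words 0" by (simp add: Words_def)
  have "Ew i w (basis_vec []) = 0" for w
    by (cases w) (auto simp: basis_vec_apply Ew_linear split: option.split)
  then have "Eop i (basis_vec []) = 0" by (simp add: Eop_def fun_eq_iff)
  moreover have "Kop i (basis_vec []) = ws (qq powi int 0) (basis_vec [])"
    unfolding Kop_eigen by (simp add: basis_vec_apply)
  ultimately show ?thesis
    using w basis_vec_W[OF w] by (simp add: word_string_def near_def)
qed

lemma word_string_singlet:
  assumes "word_string i s n v c" "a \<in> X" "fl i a = None" "el i a = None"
  shows "word_string i (Suc s) n (tens a v) (\<lambda>j. a # c j)"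
proof -
  note D = word_string_D[OF assms(1)]
  have wl: "wl i a = 0" using fl_wl[OF i assms(2)] el_wl[OF i assms(2)] wl_bound[OF i assms(2)] assms(3,4) by auto
  have Fd: "Fd i k (tens a v) = tens a (Fd i k v)" for k
  proof (rule Fd_eqI)
    show "Fop i (tens a (Fd i k v)) = ws (qint (Suc k)) (tens a (Fd i (Suc k) v))" for k
      unfolding Fop_tens D(1) using assms(3) wl by (simp add: tens_lin)
  qed (simp only: D(5))
  note at = word_string_at[OF assms(1)] and base = word_string_base[OF assms(1)]
  show ?thesis
  proof (rule word_stringI)
    show "tens a v \<in> W (Suc s)" by (rule tens_W[OF assms(2) base(1)])
    show "Eop i (tens a v) = 0" "Kop i (tens a v) = ws (qq powi int n) (tens a v)"
      using assms(3,4) wl base by (simp_all add: Eop_tens Kop_tens tens_lin)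
    fix j assume j: "j \<le> n"
    show "a # c j \<in> Words (Suc s)" using at(1)[OF j] assms(2) by (simp add: Words_def)
    show "near (Fd i j (tens a v)) (basis_vec (a # c j))"
      unfolding Fd tens_basis_vec[symmetric] by (rule near_tens[OF at(2)[OF j]])
    show "word_eps i (a # c j) = j" "word_f i (a # c j) = (if j < n then Some (a # c (Suc j)) else None)"
      "word_e i (a # c j) = (if j = 0 then None else Some (a # c (j - 1)))"
      using assms(3,4) at(3-5)[OF j] by simp_all
  qed
qed

text \<open>Prefixing a string of length \<open>n\<close> with a doublet \<open>a \<rightarrow> b\<close> decomposes the tensor product into two
strings, of lengths \<open>n + 1\<close> and \<open>n - 1\<close>. The long one is generated by \<open>a \<otimes> v\<close>, and
\<open>F^(k) (a \<otimes> v) = q^k (a \<otimes> F^(k) v) + b \<otimes> F^(k-1) v\<close>. Modulo \<open>q\<close> only the second term counts for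
\<open>k > 0\<close>.\<close>

lemma word_string_doublet_long:
  assumes "word_string i s n v c" "a \<in> X" "fl i a = Some b"
  shows "word_string i (Suc s) (Suc n) (tens a v) (\<lambda>j. case j of 0 \<Rightarrow> a # c 0 | Suc j \<Rightarrow> b # c j)"
proof -
  note D = word_string_D[OF assms(1)] and ab = fl_Some_facts[OF assms(2,3)]
  define z where "z k = (case k of 0 \<Rightarrow> tens a (Fd i 0 v)
    | Suc j \<Rightarrow> ws (qq ^ Suc j) (tens a (Fd i (Suc j) v)) + tens b (Fd i j v))" for k
  have Fd: "Fd i k (tens a v) = z k" for k
  proof (rule Fd_eqI)
    show "z 0 = tens a v" by (simp add: z_def D(5))
    show "Fop i (z k) = ws (qint (Suc k)) (z (Suc k))" for k
    proof (cases k)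
      case 0
      then show ?thesis unfolding z_def
        by (simp add: Fop_tens D(1) assms(3) ab tens_lin fun_eq_iff qint_qi)
    next
      case (Suc j)
      show ?thesis
      proof
        fix u
        let ?A = "tens a (Fd i (Suc (Suc j)) v) u" and ?B = "tens b (Fd i (Suc j) v) u"
        have "Fop i (z k) u = qq ^ Suc j * (?B + qq * (qint (Suc (Suc j)) * ?A)) + inverse qq * (qint (Suc j) * ?B)"
          unfolding z_def Suc
          by (simp add: Fop_lin Fop_tens D(1) assms(3) ab tens_lin power_int_minus)
        also have "\<dots> = (inverse qq * qint (Suc j) + qq ^ Suc j) * ?B + qint (Suc (Suc j)) * qq ^ Suc (Suc j) * ?A"
          by (simp add: algebra_simps)
        also have "\<dots> = ws (qint (Suc k)) (z (Suc k)) u"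
          unfolding qint_Suc_Suc[symmetric] by (simp add: z_def Suc algebra_simps)
        finally show "Fop i (z k) u = ws (qint (Suc k)) (z (Suc k)) u" .
      qed
    qed
  qed
  note at = word_string_at[OF assms(1)] and base = word_string_base[OF assms(1)]
  have E: "Eop i (tens a v) = 0" using base ab by (simp add: Eop_tens tens_lin)
  have K: "Kop i (tens a v) = ws (qq powi int (Suc n)) (tens a v)"
    unfolding Kop_tens ab base(3) tens_lin using qq_powi_add[of 1 "int n"] by (simp add: fun_eq_iff)
  have near: "near (Fd i j (tens a v)) (basis_vec (case j of 0 \<Rightarrow> a # c 0 | Suc j \<Rightarrow> b # c j))" if "j \<le> Suc n" for j
  proof (cases j)
    case 0
    have "near (tens a (Fd i 0 v)) (tens a (basis_vec (c 0)))"
      by (rule near_tens[OF at(2)]) simp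
    then show ?thesis unfolding Fd z_def using 0 by (simp add: tens_basis_vec)
  next
    case (Suc l)
    have "near (tens b (Fd i l v)) (tens b (basis_vec (c l)))"
      by (rule near_tens[OF at(2)]) (use that Suc in simp)
    then have "near (tens b (Fd i l v) + ws (qq ^ Suc l) (tens a (Fd i (Suc l) v))) (tens b (basis_vec (c l)))"
    proof (rule near_perturb)
      fix u
      have "tens a (Fd i (Suc l) v) u \<in> A0" using that Suc by (intro tens_A0 D(7)) simp
      then have "qq * (qq ^ l * tens a (Fd i (Suc l) v) u) \<in> m0" by (intro m0_I A0_mult A0_power A0_qq)
      then show "ws (qq ^ Suc l) (tens a (Fd i (Suc l) v)) u \<in> m0" by (simp add: mult.assoc)
    qed
    then show ?thesis unfolding Fd z_def using Suc by (simp add: tens_basis_vec add.commute)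
  qed
  show ?thesis
  proof (rule word_stringI)
    fix j assume j: "j \<le> Suc n"
    let ?c = "\<lambda>j. case j of 0 \<Rightarrow> a # c 0 | Suc j \<Rightarrow> b # c j"
    show "near (Fd i j (tens a v)) (basis_vec (?c j))" by (rule near[OF j])
    show "?c j \<in> Words (Suc s)"
      using j at(1)[of 0] at(1)[of "j - 1"] assms(2) ab(6) by (cases j) (auto simp: Words_def)
    show "word_eps i (?c j) = j" "word_f i (?c j) = (if j < Suc n then Some (?c (Suc j)) else None)"
      "word_e i (?c j) = (if j = 0 then None else Some (?c (j - 1)))"
      using j at(3-5)[of 0] at(3-5)[of "j - 1"] ab assms(3)
      by (cases j; cases "j - 1"; simp)+
  qed (rule tens_W[OF assms(2) base(1)] E K)+
qed

text \<open>The highest weight vector of the short string is \<open>v' = a \<otimes> F v - q^n [n] (b \<otimes> v)\<close>, and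
\<open>F^(k) v' = q^k [k+1] (a \<otimes> F^(k+1) v) - q^n [n-k] (b \<otimes> F^(k) v)\<close>. Modulo \<open>q\<close> the first coefficient
is one and the second is zero for \<open>k < n\<close>.\<close>

lemma word_string_doublet_short:
  assumes "word_string i s (Suc m) v c" "a \<in> X" "fl i a = Some b"
  shows "\<exists>v'. word_string i (Suc s) m v' (\<lambda>j. a # c (Suc j))"
proof -
  note D = word_string_D[OF assms(1)] and ab = fl_Some_facts[OF assms(2,3)]
  let ?n = "Suc m"
  define z where "z k = ws (qq ^ k * qint (Suc k)) (tens a (Fd i (Suc k) v))
    - ws (qq ^ ?n * qi (int ?n - int k)) (tens b (Fd i k v))" for k
  have Fd: "Fd i k (z 0) = z k" for k
  proof (rule Fd_eqI)
    fix k
    show "Fop i (z k) = ws (qint (Suc k)) (z (Suc k))"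
    proof
      fix u
      let ?A = "tens a (Fd i (Suc (Suc k)) v) u" and ?B = "tens b (Fd i (Suc k) v) u"
      have 1: "Fop i (z k) u = qq ^ k * qint (Suc k) * (?B + qq * (qint (Suc (Suc k)) * ?A))
          - qq ^ ?n * qi (int ?n - int k) * (inverse qq * (qint (Suc k) * ?B))"
        unfolding z_def by (simp add: Fop_lin Fop_tens D(1) assms(3) ab tens_lin power_int_minus)
      have "qi (1 + (int ?n - int (Suc k))) = qq powi (- (int ?n - int (Suc k))) * qi 1 + qq powi 1 * qi (int ?n - int (Suc k))"
        by (rule qi_add)
      moreover have "1 + (int ?n - int (Suc k)) = int ?n - int k" by simp
      ultimately have 2: "qi (int ?n - int k) = qq powi (int (Suc k) - int ?n) + qq * qi (int ?n - int (Suc k))"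
        by (simp only: qi_1 power_int_1_right minus_diff_eq mult_1_right)
      have 3: "qq ^ ?n * inverse qq * qq powi (int (Suc k) - int ?n) = qq ^ k"
      proof -
        have "qq ^ ?n * qq powi (int (Suc k) - int ?n) = qq ^ Suc k"
          by (simp add: power_int_diff del: power_Suc of_nat_Suc)
        then show ?thesis by (simp add: mult_ac)
      qed
      have 4: "qq ^ ?n * qi (int ?n - int k) * inverse qq = qq ^ k + qq ^ ?n * qi (int ?n - int (Suc k))"
        unfolding 2 distrib_left distrib_right 3[symmetric] by (simp add: mult_ac)
      have "Fop i (z k) u = qq ^ k * qint (Suc k) * (?B + qq * (qint (Suc (Suc k)) * ?A))
          - (qq ^ k + qq ^ ?n * qi (int ?n - int (Suc k))) * (qint (Suc k) * ?B)"
        unfolding 1 by (simp only: mult.assoc[symmetric] 4)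
      then show "Fop i (z k) u = ws (qint (Suc k)) (z (Suc k)) u"
        by (simp add: z_def algebra_simps)
    qed
  qed simp
  have nb: "qi (int ?n - 0) = qi (int ?n)" by simp
  note at = word_string_at[OF assms(1)] and base = word_string_base[OF assms(1)]
  note Ev = base(2,3,1)
  have z0: "z 0 = tens a (Fd i (Suc 0) v) - ws (qq ^ ?n * qi (int ?n)) (tens b v)"
    unfolding z_def D(5) by (simp add: qint_qi fun_eq_iff)
  have zW: "z 0 \<in> W (Suc s)" unfolding z0 using tens_W ab(6) assms(2) D(6) Ev(3)
    by (intro words.subspace_diff[OF subspace_W] words.subspace_scale[OF subspace_W]) auto
  have E: "Eop i (z 0) = 0"
  proof -
    have kv: "(\<lambda>u. qq powi (- ww i u) * v u) = ws (qq powi (- int ?n)) v"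
      using Ev(2) unfolding Kop_eigen by (auto simp: fun_eq_iff)
    have e1: "Eop i (Fd i (Suc 0) v) = ws (qi (int ?n)) v" using D(2)[of 0] D(5) by simp
    have p: "qq ^ ?n * qq powi (- int ?n) = 1"
      by (simp add: power_int_minus del: of_nat_Suc power_Suc)
    have e2: "ws (qq ^ ?n * qi (int ?n)) (ws (qq powi (- int ?n)) y) = ws (qi (int ?n)) y" for y :: "'a list \<Rightarrow> Qq"
    proof
      fix u
      have "ws (qq ^ ?n * qi (int ?n)) (ws (qq powi (- int ?n)) y) u = (qq ^ ?n * qq powi (- int ?n)) * (qi (int ?n) * y u)"
        by (simp only: ws_apply mult_ac)
      then show "ws (qq ^ ?n * qi (int ?n)) (ws (qq powi (- int ?n)) y) u = ws (qi (int ?n)) y u"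
        unfolding p by simp
    qed
    show ?thesis unfolding z0 Eop_lin Eop_tens kv ab Ev(1) e1 tens_lin option.case e2 add_0_right add_0_left
      by (rule diff_self)
  qed
  have K: "Kop i (z 0) = ws (qq powi int m) (z 0)"
  proof -
    have 1: "qq * qq powi (int ?n - 2 * int (Suc 0)) = qq powi int m"
      using qq_powi_add[of 1 "int ?n - 2 * int (Suc 0)"] by simp
    have 2: "inverse qq * qq powi int ?n = qq powi int m"
      by (simp only: power_int_of_nat) simp
    show ?thesis unfolding z0 Kop_lin Kop_tens ab D(3) Ev(2) tens_lin using 1 2
      by (simp add: fun_eq_iff power_int_minus right_diff_distrib mult.left_commute del: of_nat_Suc flip: mult.assoc)
  qed
  have near: "near (Fd i j (z 0)) (basis_vec (a # c (Suc j)))" if j: "j \<le> m" for j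
  proof -
    have A: "tens a (Fd i (Suc j) v) u \<in> A0" "tens b (Fd i j v) u \<in> A0" for u
      using j by (auto intro!: tens_A0 D(7))
    \<comment> \<open>The second coefficient is \<open>q^(j+1)\<close> times the normalised quantum integer \<open>q^d [d+1]\<close>.\<close>
    obtain d where d: "m = j + d" using j by (metis le_iff_add)
    have 1: "qq ^ ?n * qi (int ?n - int j) = qq * (qq ^ j * (qq ^ d * qint (Suc d)))"
      using d by (simp add: qint_qi power_add)
    have "near (tens a (Fd i (Suc j) v)) (tens a (basis_vec (c (Suc j))))"
      by (rule near_tens[OF at(2)]) (use j in simp)
    then have "near (tens a (Fd i (Suc j) v) + (ws (qq ^ j * qint (Suc j) - 1) (tens a (Fd i (Suc j) v))
      - ws (qq ^ ?n * qi (int ?n - int j)) (tens b (Fd i j v)))) (tens a (basis_vec (c (Suc j))))"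
    proof (rule near_perturb)
      fix u
      have "(qq ^ j * qint (Suc j) - 1) * tens a (Fd i (Suc j) v) u \<in> m0"
        using A by (intro m0_mult' qint_leading)
      moreover have "qq ^ ?n * qi (int ?n - int j) * tens b (Fd i j v) u \<in> m0"
        unfolding 1 using A by (intro m0_mult' m0_I A0_mult A0_power A0_qq qint_leading_A0)
      ultimately show "(ws (qq ^ j * qint (Suc j) - 1) (tens a (Fd i (Suc j) v))
        - ws (qq ^ ?n * qi (int ?n - int j)) (tens b (Fd i j v))) u \<in> m0"
        unfolding fun_diff_def ws_apply by (rule m0_diff)
    qed
    moreover have "tens a (Fd i (Suc j) v) + (ws (qq ^ j * qint (Suc j) - 1) (tens a (Fd i (Suc j) v))
      - ws (qq ^ ?n * qi (int ?n - int j)) (tens b (Fd i j v))) = z j"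
      unfolding z_def by (simp add: fun_eq_iff left_diff_distrib)
    ultimately show ?thesis unfolding Fd tens_basis_vec by simp
  qed
  have "word_string i (Suc s) m (z 0) (\<lambda>j. a # c (Suc j))"
  proof (rule word_stringI)
    fix j assume j: "j \<le> m"
    show "near (Fd i j (z 0)) (basis_vec (a # c (Suc j)))" by (rule near[OF j])
    show "a # c (Suc j) \<in> Words (Suc s)" using at(1)[of "Suc j"] j assms(2) by (simp add: Words_def)
    show "word_eps i (a # c (Suc j)) = j" "word_f i (a # c (Suc j)) = (if j < m then Some (a # c (Suc (Suc j))) else None)"
      "word_e i (a # c (Suc j)) = (if j = 0 then None else Some (a # c (Suc (j - 1))))"
      using at(3-5)[of "Suc j"] j assms(3) ab by (cases j; simp)+
  qed (rule zW E K)+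
  then show ?thesis by (rule exI[of _ "z 0"])
qed

text \<open>Induction on the word: a first letter without arrows of colour \<open>i\<close> prolongs all words of a string,
and the two letters of a doublet distribute the words over the long and the short string.\<close>

lemma word_in_string:
  assumes "w \<in> Words s"
  shows "\<exists>n v c k. word_string i s n v c \<and> k \<le> n \<and> c k = w"
  using assms
proof (induction w arbitrary: s)
  case Nil
  then have "s = 0" by (simp add: Words_def)
  then show ?case using word_string_Nil by blast
next
  case (Cons a w)
  then obtain s' where s: "s = Suc s'" and w: "w \<in> Words s'" and a: "a \<in> X"
    by (cases s) (auto simp: Words_def)
  from Cons.IH[OF w] obtain n v c k where str: "word_string i s' n v c" and k: "k \<le> n" "c k = w" by blast
  consider "fl i a = None" "el i a = None" | b where "fl i a = Some b" | b where "el i a = Some b"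
    by (cases "fl i a"; cases "el i a") auto
  then show ?case
  proof cases
    case 1
    from word_string_singlet[OF str a this] show ?thesis unfolding s using k by blast
  next
    case 2
    show ?thesis
    proof (cases k)
      case 0
      have "(case 0 of 0 \<Rightarrow> a # c 0 | Suc j \<Rightarrow> b # c j) = a # w" using k 0 by simp
      then show ?thesis unfolding s using word_string_doublet_long[OF str a 2] by blast
    next
      case (Suc l)
      then obtain m where m: "n = Suc m" using k by (cases n) auto
      from word_string_doublet_short[OF str[unfolded m] a 2] obtain v' where
        "word_string i (Suc s') m v' (\<lambda>j. a # c (Suc j))" by blast
      then show ?thesis unfolding s using k Suc m by blast
    qed
  next
    case 3
    \<comment> \<open>A lower letter of a doublet occurs only in long strings.\<close>
    then have fb: "fl i b = Some a" by (simp add: fl_el)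
    then have b: "b \<in> X" using fl_X[OF i fb] a by simp
    have "(case Suc k of 0 \<Rightarrow> b # c 0 | Suc j \<Rightarrow> a # c j) = a # w" using k by simp
    then show ?thesis unfolding s using word_string_doublet_long[OF str b fb] k by blast
  qed
qed

text \<open>The signature rule satisfies the crystal axioms because it is read off from strings.\<close>

lemma word_f_word_e: assumes "w \<in> Words s" shows
  "word_f i w = Some w' \<Longrightarrow> w' \<in> Words s \<and> word_e i w' = Some w"
  "word_e i w = Some w' \<Longrightarrow> w' \<in> Words s \<and> word_f i w' = Some w"
  "word_e i w = None \<longleftrightarrow> word_eps i w = 0"
proof -
  from word_in_string[OF assms] obtain n v c k where str: "word_string i s n v c" and k: "k \<le> n" "c k = w" by blast
  note at = word_string_at[OF str]
  show "w' \<in> Words s \<and> word_e i w' = Some w" if "word_f i w = Some w'"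
  proof -
    have "k < n" "w' = c (Suc k)" using at(4)[OF k(1)] k that by (auto split: if_splits)
    then show ?thesis using at(1,5)[of "Suc k"] k by simp
  qed
  show "w' \<in> Words s \<and> word_f i w' = Some w" if "word_e i w = Some w'"
  proof -
    have "k \<noteq> 0" "w' = c (k - 1)" using at(5)[OF k(1)] k that by (auto split: if_splits)
    then show ?thesis using at(1,4)[of "k - 1"] k by simp
  qed
  show "word_e i w = None \<longleftrightarrow> word_eps i w = 0" using at(3,5)[OF k(1)] k by simp
qed

lemma wft_wet_basis_vec:
  assumes w: "w \<in> Words s"
  shows "wft s i (basis_vec w) - opt_vec (word_f i w) \<in> mW s"
    and "wet s i (basis_vec w) - opt_vec (word_e i w) \<in> mW s"
proof -
  interpret M: sl2_module ws "W s" "Eop i" "Fop i" "Kop i" by (rule sl2[OF i])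
  from word_in_string[OF assms] obtain n v c k where str: "word_string i s n v c" and k: "k \<le> n" "c k = w" by blast
  note hw = word_string_hw[OF str] and D = word_string_D[OF str]
  have str': "c j \<in> Words s \<and> Fd i j v - basis_vec (c j) \<in> mW s" if "j \<le> n" for j
    using near_mW[OF D(6) basis_vec_W] word_string_at(1,2)[OF str that] by blast
  have 1: "basis_vec w - Fd i k v \<in> mW s"
    using mW_lin(3)[OF mW_lin(4) conjunct2[OF str'[OF k(1)]]] k(2) by simp
  have "wft s i (basis_vec w) - wft s i (Fd i k v) \<in> mW s"
    by (rule wft_cong[OF i basis_vec_W[OF w] D(6) 1])
  moreover have "wft s i (Fd i k v) - opt_vec (word_f i w) \<in> mW s"
  proof (cases "k = n")
    case True
    then have "word_f i w = None" using word_string_at(4)[OF str k(1)] k by simp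
    then show ?thesis using M.ft_Fdiv[OF hw k(1)] D(4) True mW_lin(4) by (simp add: opt_vec_def)
  next
    case False
    then have "word_f i w = Some (c (Suc k))" using word_string_at(4)[OF str k(1)] k by simp
    then show ?thesis using M.ft_Fdiv[OF hw k(1)] str'[of "Suc k"] False k by (simp add: opt_vec_def)
  qed
  ultimately have "(wft s i (basis_vec w) - wft s i (Fd i k v)) + (wft s i (Fd i k v) - opt_vec (word_f i w)) \<in> mW s"
    by (rule mW_lin(1))
  then show "wft s i (basis_vec w) - opt_vec (word_f i w) \<in> mW s" by simp
  have "wet s i (basis_vec w) - wet s i (Fd i k v) \<in> mW s"
    by (rule wet_cong[OF i basis_vec_W[OF w] D(6) 1])
  moreover have "wet s i (Fd i k v) - opt_vec (word_e i w) \<in> mW s"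
  proof (cases k)
    case 0
    then have "word_e i w = None" using word_string_at(5)[OF str k(1)] k by simp
    then show ?thesis using M.et_Fdiv[OF hw k(1)] 0 mW_lin(4) by (simp add: opt_vec_def)
  next
    case (Suc l)
    then have "word_e i w = Some (c l)" using word_string_at(5)[OF str k(1)] k by simp
    then show ?thesis using M.et_Fdiv[OF hw k(1)] str'[of l] Suc k by (simp add: opt_vec_def)
  qed
  ultimately have "(wet s i (basis_vec w) - wet s i (Fd i k v)) + (wet s i (Fd i k v) - opt_vec (word_e i w)) \<in> mW s"
    by (rule mW_lin(1))
  then show "wet s i (basis_vec w) - opt_vec (word_e i w) \<in> mW s" by simp
qed

end

end

section \<open>Diagonal submodules\<close>

text \<open>An integrable module for the nodes in \<open>J\<close>, with the relations between different nodes that are used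
to generate submodules from highest weight vectors.\<close>

locale uq_module = vector_space scale
  for scale :: "Qq \<Rightarrow> 'v \<Rightarrow> 'v::ab_group_add" +
  fixes S :: "'v set" and E F K :: "nat \<Rightarrow> 'v \<Rightarrow> 'v" and J :: "nat set"
  assumes sl2_at: "i \<in> J \<Longrightarrow> sl2_module scale S (E i) (F i) (K i)"
    and K_F_at: "\<lbrakk>i \<in> J; j \<in> J; v \<in> S\<rbrakk> \<Longrightarrow> K i (F j v) = scale (qq powi (- cartan i j)) (F j (K i v))"
    and E_F_at: "\<lbrakk>i \<in> J; j \<in> J; i \<noteq> j; v \<in> S\<rbrakk> \<Longrightarrow> E i (F j v) = F j (E i v)"

lemma map_prod_pow:
  fixes f :: "'a \<Rightarrow> 'a" and g :: "'b \<Rightarrow> 'b"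
  shows "(map_prod f g ^^ n) d = ((f ^^ n) (fst d), (g ^^ n) (snd d))"
  by (induction n) simp_all

lemma funpow_zero_mono:
  fixes f :: "'a :: zero \<Rightarrow> 'a"
  assumes "f 0 = 0" "(f ^^ m) x = 0" "m \<le> n" shows "(f ^^ n) x = 0"
proof -
  have "(f ^^ k) 0 = 0" for k by (induction k) (simp_all add: assms(1))
  moreover obtain k where "n = k + m" using assms(3) by (metis add.commute le_iff_add)
  ultimately show ?thesis using assms(2) by (simp add: funpow_add)
qed

text \<open>The submodule \<open>D\<close> of the product of two modules that is generated by a pair of highest weight vectors
of equal weight. It plays the role of the graph of the isomorphism between the two generated
submodules.\<close>

locale uq_pair =
  M1: uq_module sc1 S1 E1 F1 K1 J + M2: uq_module sc2 S2 E2 F2 K2 J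
  for sc1 :: "Qq \<Rightarrow> 'v \<Rightarrow> 'v::ab_group_add" and S1 E1 F1 K1
    and sc2 :: "Qq \<Rightarrow> 'w \<Rightarrow> 'w::ab_group_add" and S2 E2 F2 K2 and J +
  fixes u1 :: 'v and u2 :: 'w and \<mu> :: "nat \<Rightarrow> int"
  assumes u_S: "u1 \<in> S1" "u2 \<in> S2"
    and u_E: "i \<in> J \<Longrightarrow> E1 i u1 = 0" "i \<in> J \<Longrightarrow> E2 i u2 = 0"
    and u_K: "i \<in> J \<Longrightarrow> K1 i u1 = sc1 (qq powi \<mu> i) u1" "i \<in> J \<Longrightarrow> K2 i u2 = sc2 (qq powi \<mu> i) u2"
begin

definition scp :: "Qq \<Rightarrow> 'v \<times> 'w \<Rightarrow> 'v \<times> 'w" where "scp c = map_prod (sc1 c) (sc2 c)"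
definition Ep :: "nat \<Rightarrow> 'v \<times> 'w \<Rightarrow> 'v \<times> 'w" where "Ep i = map_prod (E1 i) (E2 i)"
definition Fp :: "nat \<Rightarrow> 'v \<times> 'w \<Rightarrow> 'v \<times> 'w" where "Fp i = map_prod (F1 i) (F2 i)"
definition Kp :: "nat \<Rightarrow> 'v \<times> 'w \<Rightarrow> 'v \<times> 'w" where "Kp i = map_prod (K1 i) (K2 i)"

lemma fst_snd_op [simp]:
  "fst (scp c d) = sc1 c (fst d)" "snd (scp c d) = sc2 c (snd d)"
  "fst (Ep i d) = E1 i (fst d)" "snd (Ep i d) = E2 i (snd d)"
  "fst (Fp i d) = F1 i (fst d)" "snd (Fp i d) = F2 i (snd d)"
  "fst (Kp i d) = K1 i (fst d)" "snd (Kp i d) = K2 i (snd d)"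
  by (simp_all add: scp_def Ep_def Fp_def Kp_def map_prod_def split: prod.splits)

sublocale P: vector_space scp
  by standard (simp_all add: prod_eq_iff M1.scale_right_distrib M1.scale_left_distrib
      M2.scale_right_distrib M2.scale_left_distrib)

lemma linear_Ep: "i \<in> J \<Longrightarrow> Vector_Spaces.linear scp scp (Ep i)"
  and linear_Fp: "i \<in> J \<Longrightarrow> Vector_Spaces.linear scp scp (Fp i)"
  and linear_Kp: "i \<in> J \<Longrightarrow> Vector_Spaces.linear scp scp (Kp i)"
proof -
  assume i: "i \<in> J"
  interpret A: sl2_module sc1 S1 "E1 i" "F1 i" "K1 i" by (rule M1.sl2_at[OF i])
  interpret B: sl2_module sc2 S2 "E2 i" "F2 i" "K2 i" by (rule M2.sl2_at[OF i])
  show "Vector_Spaces.linear scp scp (Ep i)" "Vector_Spaces.linear scp scp (Fp i)"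
    "Vector_Spaces.linear scp scp (Kp i)"
    by (simp_all add: Vector_Spaces.linear_iff P.vector_space_axioms prod_eq_iff A.E_lin A.F_lin A.K_lin
        B.E_lin B.F_lin B.K_lin)
qed

lemmas Ep_lin = linear_map_simps[OF linear_Ep]
lemmas Fp_lin = linear_map_simps[OF linear_Fp]
lemmas Kp_lin = linear_map_simps[OF linear_Kp]

text \<open>Weight vectors of the submodule, generated by the operators \<open>F\<close> alone. The weight is recorded for all
nodes, as it is needed to compute the commutator of \<open>E\<close> and \<open>F\<close>.\<close>

inductive dw :: "(nat \<Rightarrow> int) \<Rightarrow> 'v \<times> 'w \<Rightarrow> bool" where
  base: "dw \<mu> (u1, u2)"
| zero: "dw \<nu> 0"
| add: "dw \<nu> d \<Longrightarrow> dw \<nu> d' \<Longrightarrow> dw \<nu> (d + d')"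
| scale: "dw \<nu> d \<Longrightarrow> dw \<nu> (scp c d)"
| F: "dw \<nu> d \<Longrightarrow> j \<in> J \<Longrightarrow> dw (\<lambda>i. \<nu> i - cartan i j) (Fp j d)"

lemma M1_subspace: "j \<in> J \<Longrightarrow> M1.subspace S1" and M2_subspace: "j \<in> J \<Longrightarrow> M2.subspace S2"
  using sl2_module.subspace_S[OF M1.sl2_at] sl2_module.subspace_S[OF M2.sl2_at] by auto

lemma dw_S: "dw \<nu> d \<Longrightarrow> j \<in> J \<Longrightarrow> fst d \<in> S1 \<and> snd d \<in> S2"
proof (induction rule: dw.induct)
  case (F \<nu> d k)
  then show ?case using sl2_module.F_closed[OF M1.sl2_at] sl2_module.F_closed[OF M2.sl2_at] by simp
qed (auto simp: u_S M1.subspace_0[OF M1_subspace] M2.subspace_0[OF M2_subspace]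
    M1.subspace_add[OF M1_subspace] M2.subspace_add[OF M2_subspace]
    M1.subspace_scale[OF M1_subspace] M2.subspace_scale[OF M2_subspace])

lemma dw_K: "dw \<nu> d \<Longrightarrow> i \<in> J \<Longrightarrow> Kp i d = scp (qq powi \<nu> i) d"
proof (induction rule: dw.induct)
  case (F \<nu> d j)
  note IH = F.IH[OF F.prems]
  have "Kp i (Fp j d) = scp (qq powi (- cartan i j)) (Fp j (Kp i d))"
    using M1.K_F_at[OF F.prems F.hyps(2)] M2.K_F_at[OF F.prems F.hyps(2)] dw_S[OF F.hyps(1,2)]
    by (simp add: prod_eq_iff)
  also have "\<dots> = scp (qq powi (\<nu> i - cartan i j)) (Fp j d)"
    using qq_powi_add[of "\<nu> i" "- cartan i j"] unfolding IH Fp_lin(2)[OF F.hyps(2)] P.scale_scale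
    by (simp add: mult.commute)
  finally show ?case .
next
  case base
  then show ?case by (simp add: prod_eq_iff u_K)
qed (simp_all add: Kp_lin P.scale_right_distrib mult.commute)

text \<open>As for Verma modules: \<open>E\<close> is moved to the right through the operators \<open>F\<close>, until it meets the highest
weight vectors. Closure under \<open>E\<close> therefore holds without \<open>E\<close> among the generators.\<close>

lemma dw_E: "dw \<nu> d \<Longrightarrow> i \<in> J \<Longrightarrow> dw (\<lambda>k. \<nu> k + cartan k i) (Ep i d)"
proof (induction rule: dw.induct)
  case base
  then have "Ep i (u1, u2) = 0" by (simp add: prod_eq_iff u_E)
  then show ?case by (simp add: dw.zero)
next
  case (F \<nu> d j)
  note IH = F.IH[OF F.prems] and S = dw_S[OF F.hyps(1,2)]
  have D1: "dw (\<lambda>k. \<nu> k + cartan k i - cartan k j) (Fp j (Ep i d))"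
    using dw.F[OF IH F.hyps(2)] by simp
  show ?case
  proof (cases "i = j")
    case False
    have "Ep i (Fp j d) = Fp j (Ep i d)"
      using M1.E_F_at[OF F.prems F.hyps(2) False] M2.E_F_at[OF F.prems F.hyps(2) False] S
      by (simp add: prod_eq_iff)
    then show ?thesis using D1 by (simp add: algebra_simps)
  next
    case True
    have K: "Kp i d = scp (qq powi \<nu> i) d" by (rule dw_K[OF F.hyps(1) F.prems])
    have "Ep i (Fp j d) = Fp j (Ep i d) + scp (qi (\<nu> i)) d"
      using sl2_module.E_F[OF M1.sl2_at[OF F.prems], of "fst d" "\<nu> i"]
        sl2_module.E_F[OF M2.sl2_at[OF F.prems], of "snd d" "\<nu> i"] S K True
      by (simp add: prod_eq_iff)
    moreover have "dw \<nu> (Fp j (Ep i d))" using D1 True by simp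
    ultimately show ?thesis using True F.hyps(1) by (simp add: dw.add dw.scale)
  qed
qed (auto simp: Ep_lin intro: dw.intros)

definition D :: "('v \<times> 'w) set" where "D = P.span {d. \<exists>\<nu>. dw \<nu> d}"

lemma subspace_D: "P.subspace D" by (simp add: D_def)

lemma dw_D: "dw \<nu> d \<Longrightarrow> d \<in> D" unfolding D_def by (rule P.span_base) blast

lemma D_induct [consumes 1, case_names weight add]:
  assumes "d \<in> D" "\<And>\<nu> d. dw \<nu> d \<Longrightarrow> R d" "\<And>d d'. R d \<Longrightarrow> R d' \<Longrightarrow> R (d + d')"
  shows "R d"
  using assms(1) unfolding D_def
proof (induction rule: P.span_induct_alt)
  case base
  then show ?case using assms(2) dw.zero by blast
next
  case (step c x y)
  then show ?case using assms(2,3) dw.scale by blast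
qed

lemma D_S: assumes "d \<in> D" "j \<in> J" shows "fst d \<in> S1 \<and> snd d \<in> S2"
  using assms(1)
proof (induction rule: D_induct)
  case (weight \<nu> d)
  then show ?case using dw_S assms(2) by blast
next
  case (add d d')
  then show ?case using assms(2)
    by (simp add: M1.subspace_add[OF M1_subspace] M2.subspace_add[OF M2_subspace])
qed

lemma D_E: assumes "d \<in> D" "i \<in> J" shows "Ep i d \<in> D"
  using assms(1)
proof (induction rule: D_induct)
  case (weight \<nu> d)
  then show ?case using dw_E dw_D assms(2) by blast
next
  case (add d d')
  then show ?case using assms(2) by (simp add: Ep_lin P.subspace_add[OF subspace_D])
qed

lemma D_F: assumes "d \<in> D" "i \<in> J" shows "Fp i d \<in> D"
  using assms(1)
proof (induction rule: D_induct)
  case (weight \<nu> d)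
  then show ?case using dw.F dw_D assms(2) by blast
next
  case (add d d')
  then show ?case using assms(2) by (simp add: Fp_lin P.subspace_add[OF subspace_D])
qed

lemma D_K: assumes "d \<in> D" "i \<in> J" shows "Kp i d \<in> D"
  using assms(1)
proof (induction rule: D_induct)
  case (weight \<nu> d)
  then show ?case using dw_K dw_D dw.scale assms(2) by metis
next
  case (add d d')
  then show ?case using assms(2) by (simp add: Kp_lin P.subspace_add[OF subspace_D])
qed

lemma D_sl2: assumes i: "i \<in> J" shows "sl2_module scp D (Ep i) (Fp i) (Kp i)"
proof (intro sl2_module.intro sl2_module_axioms.intro P.vector_space_axioms)
  interpret A: sl2_module sc1 S1 "E1 i" "F1 i" "K1 i" by (rule M1.sl2_at[OF i])
  interpret B: sl2_module sc2 S2 "E2 i" "F2 i" "K2 i" by (rule M2.sl2_at[OF i])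
  show "P.subspace D" by (rule subspace_D)
  show "Vector_Spaces.linear scp scp (Ep i)" "Vector_Spaces.linear scp scp (Fp i)"
    "Vector_Spaces.linear scp scp (Kp i)" by (rule linear_Ep[OF i] linear_Fp[OF i] linear_Kp[OF i])+
  show "Ep i v \<in> D" if "v \<in> D" for v using that i by (rule D_E)
  show "Fp i v \<in> D" if "v \<in> D" for v using that i by (rule D_F)
  show "Kp i (Ep i v) = scp (qq powi (n + 2)) (Ep i v)" if "v \<in> D" "Kp i v = scp (qq powi n) v" for v n
    using that D_S[OF that(1) i] A.K_E[of "fst v" n] B.K_E[of "snd v" n] by (simp add: prod_eq_iff)
  show "Kp i (Fp i v) = scp (qq powi (n - 2)) (Fp i v)" if "v \<in> D" "Kp i v = scp (qq powi n) v" for v n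
    using that D_S[OF that(1) i] A.K_F[of "fst v" n] B.K_F[of "snd v" n] by (simp add: prod_eq_iff)
  show "Ep i (Fp i v) = Fp i (Ep i v) + scp (qi n) v" if "v \<in> D" "Kp i v = scp (qq powi n) v" for v n
    using that D_S[OF that(1) i] A.E_F[of "fst v" n] B.E_F[of "snd v" n] by (simp add: prod_eq_iff)
  show "D \<subseteq> P.span {v \<in> D. \<exists>n. Kp i v = scp (qq powi n) v}"
  proof
    fix d assume "d \<in> D"
    then show "d \<in> P.span {v \<in> D. \<exists>n. Kp i v = scp (qq powi n) v}"
    proof (induction rule: D_induct)
      case (weight \<nu> d)
      then show ?case using dw_D dw_K[OF _ i] by (intro P.span_base) blast
    next
      case (add d d')
      then show ?case by (rule P.span_add)
    qed
  qed
  show "\<exists>n. (Ep i ^^ n) v = 0" if v: "v \<in> D" for v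
  proof -
    obtain m n where "(E1 i ^^ m) (fst v) = 0" "(E2 i ^^ n) (snd v) = 0"
      using D_S[OF v i] A.E_nilpotent B.E_nilpotent by blast
    then have "(E1 i ^^ (m + n)) (fst v) = 0" "(E2 i ^^ (m + n)) (snd v) = 0"
      using funpow_zero_mono[where f = "E1 i", OF A.E_lin(3)] funpow_zero_mono[where f = "E2 i", OF B.E_lin(3)] by simp_all
    then show ?thesis by (intro exI[of _ "m + n"]) (simp add: Ep_def map_prod_pow zero_prod_def)
  qed
  show "\<exists>n. (Fp i ^^ n) v = 0" if v: "v \<in> D" for v
  proof -
    obtain m n where "(F1 i ^^ m) (fst v) = 0" "(F2 i ^^ n) (snd v) = 0"
      using D_S[OF v i] A.F_nilpotent B.F_nilpotent by blast
    then have "(F1 i ^^ (m + n)) (fst v) = 0" "(F2 i ^^ (m + n)) (snd v) = 0"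
      using funpow_zero_mono[where f = "F1 i", OF A.F_lin(3)] funpow_zero_mono[where f = "F2 i", OF B.F_lin(3)] by simp_all
    then show ?thesis by (intro exI[of _ "m + n"]) (simp add: Fp_def map_prod_pow zero_prod_def)
  qed
qed

abbreviation ft1 where "ft1 i \<equiv> sl2_module.ft sc1 S1 (E1 i) (F1 i) (K1 i)"
abbreviation ft2 where "ft2 i \<equiv> sl2_module.ft sc2 S2 (E2 i) (F2 i) (K2 i)"
abbreviation et1 where "et1 i \<equiv> sl2_module.et sc1 S1 (E1 i) (F1 i) (K1 i)"
abbreviation et2 where "et2 i \<equiv> sl2_module.et sc2 S2 (E2 i) (F2 i) (K2 i)"

text \<open>The submodule is itself integrable, so its elements decompose into strings, and the components of
a string of pairs are strings of the same type in both modules.\<close>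

lemma D_tilde:
  assumes "d \<in> D" "i \<in> J"
  shows "(ft1 i (fst d), ft2 i (snd d)) \<in> D" "(et1 i (fst d), et2 i (snd d)) \<in> D"
proof -
  interpret A: sl2_module sc1 S1 "E1 i" "F1 i" "K1 i" by (rule M1.sl2_at[OF assms(2)])
  interpret B: sl2_module sc2 S2 "E2 i" "F2 i" "K2 i" by (rule M2.sl2_at[OF assms(2)])
  interpret C: sl2_module scp D "Ep i" "Fp i" "Kp i" by (rule D_sl2[OF assms(2)])
  have Fdiv: "C.Fdiv k v = (A.Fdiv k (fst v), B.Fdiv k (snd v))" for k v
  proof -
    have "(Fp i ^^ k) v = ((F1 i ^^ k) (fst v), (F2 i ^^ k) (snd v))"
      unfolding Fp_def by (rule map_prod_pow)
    then show ?thesis by (simp add: C.Fdiv_def A.Fdiv_def B.Fdiv_def prod_eq_iff)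
  qed
  have str: "fst z \<in> A.strings a \<and> snd z \<in> B.strings a" if z: "z \<in> C.strings a" for z a
  proof -
    obtain v where v: "C.hw (fst a) v" "z = C.Fdiv (snd a) v" using z unfolding C.strings_def by blast
    then have "A.hw (fst a) (fst v)" "B.hw (fst a) (snd v)"
      using D_S[of v i] assms(2) by (auto simp: A.hw_def B.hw_def C.hw_def prod_eq_iff)
    then show ?thesis unfolding v(2) Fdiv A.strings_def B.strings_def by auto
  qed
  obtain I z where I: "finite I" "I \<subseteq> C.string_index" "\<And>a. a \<in> I \<Longrightarrow> z a \<in> C.strings a" "d = sum z I"
    using C.string_decomposition[OF assms(1)] by blast
  have d: "fst d = (\<Sum>a\<in>I. fst (z a))" "snd d = (\<Sum>a\<in>I. snd (z a))"
    unfolding I(4) by (simp_all add: fst_sum snd_sum)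
  have "ft1 i (fst d) = (\<Sum>a\<in>I. A.f_map a (fst (z a)))" "et1 i (fst d) = (\<Sum>a\<in>I. A.e_map a (fst (z a)))"
    unfolding d A.ft_def A.et_def using I str
    by (intro A.string_map_sum A.linear_f_map A.linear_e_map; simp add: C.string_index_def A.string_index_def)+
  moreover have "ft2 i (snd d) = (\<Sum>a\<in>I. B.f_map a (snd (z a)))" "et2 i (snd d) = (\<Sum>a\<in>I. B.e_map a (snd (z a)))"
    unfolding d B.ft_def B.et_def using I str
    by (intro B.string_map_sum B.linear_f_map B.linear_e_map; simp add: C.string_index_def B.string_index_def)+
  ultimately have "(ft1 i (fst d), ft2 i (snd d)) = (\<Sum>a\<in>I. C.f_map a (z a))"
    "(et1 i (fst d), et2 i (snd d)) = (\<Sum>a\<in>I. C.e_map a (z a))"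
    by (simp_all add: prod_eq_iff fst_sum snd_sum A.f_map_def B.f_map_def C.f_map_def A.e_map_def B.e_map_def C.e_map_def)
  moreover have "(\<Sum>a\<in>I. C.f_map a (z a)) \<in> D" "(\<Sum>a\<in>I. C.e_map a (z a)) \<in> D"
    unfolding C.f_map_def C.e_map_def using C.strings_closed[OF I(3)] assms(2)
    by (intro P.subspace_sum[OF subspace_D] P.subspace_scale[OF subspace_D] D_F D_E; simp)+
  ultimately show "(ft1 i (fst d), ft2 i (snd d)) \<in> D" "(et1 i (fst d), et2 i (snd d)) \<in> D"
    by simp_all
qed

end

context letter_crystal
begin

lemma uq_module_W:
  assumes "J \<subseteq> E6_index" shows "uq_module ws (W s) Eop Fop Kop J"
proof (intro uq_module.intro uq_module_axioms.intro words.vector_space_axioms)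
  fix i j v assume i: "i \<in> J" and j: "j \<in> J" and v: "v \<in> W s"
  have ij: "i \<in> E6_index" "j \<in> E6_index" using assms i j by auto
  show "Kop i (Fop j v) = ws (qq powi (- cartan i j)) (Fop j (Kop i v))" by (rule Kop_Fop[OF ij])
  show "Eop i (Fop j v) = Fop j (Eop i v)" if "i \<noteq> j" using Eop_Fop[OF ij v] that by simp
next
  show "sl2_module ws (W s) (Eop i) (Fop i) (Kop i)" if "i \<in> J" for i
    using sl2 assms that by blast
qed

text \<open>Each term of the iterated coproduct applies \<open>E\<close> to one letter.\<close>

lemma Eop_highest_word:
  assumes "\<forall>a\<in>set w. el i a = None" shows "Eop i (basis_vec w) = 0"
proof -
  have "Ew i u (basis_vec w) = 0" for u
    using assms
  proof (induction u arbitrary: w)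
    case (Cons c u)
    have 1: "(case fl i c of None \<Rightarrow> 0 | Some b \<Rightarrow> qq powi (- ww i u) * basis_vec w (b # u)) = 0"
    proof (cases "fl i c")
      case (Some b)
      then have "el i b = Some c" by (simp add: fl_el)
      then have "w \<noteq> b # u" using Cons.prems by auto
      then show ?thesis using Some by (simp add: basis_vec_apply)
    qed simp
    have 2: "Ew i u (\<lambda>v. basis_vec w (c # v)) = 0"
    proof (cases w)
      case Nil
      then show ?thesis by (simp add: basis_vec_apply Ew_linear)
    next
      case (Cons a w')
      have "(\<lambda>v. basis_vec w (c # v)) = (if c = a then basis_vec w' else (\<lambda>_. 0))"
        using Cons by (auto simp: basis_vec_def)
      then show ?thesis using Cons.IH[of w'] Cons.prems Cons by (simp add: Ew_linear)
    qed
    show ?case unfolding Ew.simps 1 2 by simp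
  qed simp
  then show ?thesis by (simp add: Eop_def fun_eq_iff)
qed

lemma Kop_basis_vec: "Kop i (basis_vec w) = ws (qq powi (ww i w)) (basis_vec w)"
  unfolding Kop_eigen by (simp add: basis_vec_apply)

abbreviation word_pair where
  "word_pair s J u u' \<equiv> uq_pair ws (W s) Eop Fop Kop ws (W s) Eop Fop Kop J u u'"

text \<open>By contravariance \<open>F\<close> moves to the other argument as \<open>q\<^sup>-\<^sup>1 K E\<close>, in left and right components alike.
All pairings thereby reduce to the one of the generators.\<close>

lemma diagonal_isometry:
  assumes J: "J \<subseteq> E6_index" and "word_pair s J x y \<mu>" and "word_pair s J x' y' \<mu>'"
    and eq: "ip s x x' = ip s y y'"
    and d: "d \<in> uq_pair.D ws Fop ws Fop J x y \<mu>"
    and d': "d' \<in> uq_pair.D ws Fop ws Fop J x' y' \<mu>'"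
  shows "ip s (fst d) (fst d') = ip s (snd d) (snd d')"
proof -
  interpret A: uq_pair ws "W s" Eop Fop Kop ws "W s" Eop Fop Kop J x y \<mu> by fact
  interpret B: uq_pair ws "W s" Eop Fop Kop ws "W s" Eop Fop Kop J x' y' \<mu>' by fact
  have 1: "ip s (fst d) x' = ip s (snd d) y'" if "A.dw \<nu> d" for \<nu> d
    using that
  proof (induction rule: A.dw.induct)
    case base
    then show ?case by (simp add: eq)
  next
    case (F \<nu> d j)
    have j: "j \<in> E6_index" using F J by blast
    have "ip s (fst (A.Fp j d)) x' = 0" "ip s (snd (A.Fp j d)) y' = 0"
      using ip_F[OF j] B.u_E[OF F.hyps(2)] by (simp_all add: Kop_lin ip_linear_right)
    then show ?case by simp
  qed (simp_all only: fst_add snd_add fst_zero snd_zero A.fst_snd_op ip_linear)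
  have "ip s (fst d) (fst d') = ip s (snd d) (snd d')" if "A.dw \<nu> d" "B.dw \<nu>' d'" for \<nu> \<nu>' d d'
    using that(2,1)
  proof (induction arbitrary: \<nu> d rule: B.dw.induct)
    case base
    show ?case using 1[OF base.prems] by (simp only: fst_conv snd_conv)
  next
    case (F \<nu>' d' j \<nu> d)
    have j: "j \<in> E6_index" using F J by blast
    have E: "A.dw (\<lambda>k. \<nu> k + cartan k j) (A.Ep j d)" by (rule A.dw_E[OF F.prems F.hyps(2)])
    have K: "A.dw (\<lambda>k. \<nu> k + cartan k j) (A.Kp j (A.Ep j d))"
      unfolding A.dw_K[OF E F.hyps(2)] by (rule A.dw.scale[OF E])
    have "ip s (fst d) (fst (B.Fp j d')) = inverse qq * ip s (fst (A.Kp j (A.Ep j d))) (fst d')"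
      "ip s (snd d) (snd (B.Fp j d')) = inverse qq * ip s (snd (A.Kp j (A.Ep j d))) (snd d')"
      using ip_F[OF j, of s "fst d'" "fst d"] ip_F[OF j, of s "snd d'" "snd d"]
      by (simp_all add: ip_sym[of s "fst d"] ip_sym[of s "snd d"] ip_sym[of s "fst d'"] ip_sym[of s "snd d'"])
    then show ?case using F.IH[OF K] by simp
  qed (simp_all only: fst_add snd_add fst_zero snd_zero B.fst_snd_op ip_linear_right)
  note 2 = this
  from d show ?thesis
  proof (induction rule: A.D_induct)
    case (weight \<nu> d)
    from d' show ?case
    proof (induction rule: B.D_induct)
      case (weight \<nu>' d')
      then show ?case using 2 \<open>A.dw \<nu> d\<close> by blast
    qed (simp only: fst_add snd_add ip_linear_right)
  qed (simp only: fst_add snd_add ip_linear)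
qed

end

section \<open>Crystals generated by highest weight words\<close>

context letter_crystal
begin

text \<open>The list of colours is applied from its end, so that consing a colour applies one more operator.\<close>

primrec word_fs :: "nat list \<Rightarrow> 'a list \<Rightarrow> 'a list option" where
  "word_fs [] w = Some w"
| "word_fs (i # l) w = Option.bind (word_fs l w) (word_f i)"

primrec fvec :: "nat \<Rightarrow> nat list \<Rightarrow> ('a list \<Rightarrow> Qq) \<Rightarrow> 'a list \<Rightarrow> Qq" where
  "fvec s [] v = v"
| "fvec s (i # l) v = wft s i (fvec s l v)"

lemma word_f_weight:
  assumes "i \<in> E6_index" "j \<in> E6_index"
  shows "word_f i w = Some w' \<Longrightarrow> ww j w' = ww j w - cartan j i"
proof (induction w arbitrary: w')
  case (Cons a w)
  then show ?case using wl_step[OF assms] by (auto split: if_splits)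
qed simp

lemma word_fs_Words:
  assumes "w \<in> Words s" "set l \<subseteq> E6_index" "word_fs l w = Some w'" shows "w' \<in> Words s"
  using assms(2,3)
proof (induction l arbitrary: w')
  case (Cons i l)
  then obtain v where "word_fs l w = Some v" "word_f i v = Some w'" by (auto simp: bind_eq_Some_conv)
  then show ?case using Cons word_f_word_e(1)[of i v s w'] by auto
qed (use assms in simp)

lemma fvec_W:
  assumes "v \<in> W s" "set l \<subseteq> E6_index" shows "fvec s l v \<in> W s"
  using assms(2)
proof (induction l)
  case (Cons i l)
  then show ?case using sl2_module.ft_closed[OF sl2] by simp
qed (use assms in simp)

lemma opt_vec_simps: "opt_vec None = 0" "opt_vec (Some w) = basis_vec w"
  by (simp_all add: opt_vec_def)

lemma opt_vec_LW: "(\<And>w. x = Some w \<Longrightarrow> w \<in> Words s) \<Longrightarrow> opt_vec x \<in> LW s"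
  by (cases x) (simp_all only: opt_vec_simps LW_lin(4) basis_vec_LW)

lemma fvec_word:
  assumes "w \<in> Words s" "set l \<subseteq> E6_index"
  shows "fvec s l (basis_vec w) - opt_vec (word_fs l w) \<in> mW s"
  using assms(2)
proof (induction l)
  case Nil
  have "fvec s [] (basis_vec w) - opt_vec (word_fs [] w) = 0" by (simp only: fvec.simps word_fs.simps opt_vec_simps diff_self)
  then show ?case using mW_lin(4) by metis
next
  case (Cons i l)
  have i: "i \<in> E6_index" and l: "set l \<subseteq> E6_index" using Cons.prems by auto
  have W: "\<And>w'. word_fs l w = Some w' \<Longrightarrow> w' \<in> Words s" using word_fs_Words[OF assms(1) l] .
  have 1: "wft s i (fvec s l (basis_vec w)) - wft s i (opt_vec (word_fs l w)) \<in> mW s"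
    using Cons.IH[OF l] by (intro wft_cong[OF i] fvec_W basis_vec_W assms(1) l LW_W opt_vec_LW W)
  have 2: "wft s i (opt_vec (word_fs l w)) - opt_vec (word_fs (i # l) w) \<in> mW s"
  proof (cases "word_fs l w")
    case None
    then have N: "word_fs (i # l) w = None" by simp
    show ?thesis unfolding N None opt_vec_simps(1) using wft_mW[OF i mW_lin(4)] by (simp only: diff_zero)
  next
    case (Some v)
    then have N: "word_fs (i # l) w = word_f i v" by simp
    show ?thesis unfolding N Some opt_vec_simps(2) by (rule wft_wet_basis_vec(1)[OF i W[OF Some]])
  qed
  have "(wft s i (fvec s l (basis_vec w)) - wft s i (opt_vec (word_fs l w))) +
    (wft s i (opt_vec (word_fs l w)) - opt_vec (word_fs (i # l) w)) \<in> mW s" by (rule mW_lin(1)[OF 1 2])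
  then show ?case unfolding fvec.simps diff_add_eq_diff_diff_swap by (simp only: diff_add_cancel add_diff_eq)
qed

lemma opt_vec_inject:
  assumes "opt_vec x - opt_vec y \<in> mW s" shows "x = y"
proof -
  have m: "opt_vec x u - opt_vec y u \<in> m0" for u using assms by (simp add: mW_def)
  have n: "- 1 \<notin> m0" using m0_uminus[of "- 1"] one_notin_m0 by auto
  have z: "opt_vec None u = 0" for u by (simp only: opt_vec_simps zero_fun_apply)
  show ?thesis
  proof (cases x)
    case None
    show ?thesis
    proof (cases y)
      case (Some w)
      then show ?thesis using m[of w] n None by (simp add: opt_vec_simps basis_vec_apply)
    qed (simp add: None)
  next
    case (Some w)
    then show ?thesis using m[of w] one_notin_m0
      by (cases y) (auto simp: opt_vec_simps basis_vec_apply split: if_splits)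
  qed
qed

lemma mW_shift: "x - y \<in> mW s \<Longrightarrow> x' - y' \<in> mW s \<Longrightarrow> x - x' \<in> mW s \<longleftrightarrow> y - y' \<in> mW s"
proof -
  assume a: "x - y \<in> mW s" "x' - y' \<in> mW s"
  have "x - x' = (x - y) - (x' - y') + (y - y')" "y - y' = (x - x') - ((x - y) - (x' - y'))"
    by (simp_all only: algebra_simps)
  then show ?thesis using mW_lin(1)[OF mW_lin(3)[OF a]] mW_lin(3)[OF _ mW_lin(3)[OF a]] by metis
qed

lemma fvec_pair:
  assumes J: "J \<subseteq> E6_index" and p: "word_pair s J x y \<mu>" and l: "set l \<subseteq> J"
  shows "(fvec s l x, fvec s l y) \<in> uq_pair.D ws Fop ws Fop J x y \<mu>"
  using l
proof (induction l)
  interpret A: uq_pair ws "W s" Eop Fop Kop ws "W s" Eop Fop Kop J x y \<mu> by fact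
  {
    case Nil
    show ?case unfolding fvec.simps by (rule A.dw_D[OF A.dw.base])
  next
    case (Cons i l)
    have i: "i \<in> J" and l: "set l \<subseteq> J" using Cons.prems by auto
    from A.D_tilde(1)[OF Cons.IH[OF l] i] show ?case unfolding fvec.simps fst_conv snd_conv .
  }
qed

text \<open>Two paths end in the same word iff the difference of the corresponding vectors has norm in
\<^const>\<open>m0\<close>. By the diagonal isometry this norm does not change when \<open>w\<close>, \<open>w'\<close> are replaced by \<open>v\<close>,
\<open>v'\<close>, provided the pairing of the two highest weight words stays the same.\<close>

theorem word_fs_transport:
  assumes J: "J \<subseteq> E6_index"
    and W: "w \<in> Words s" "v \<in> Words s" "w' \<in> Words s" "v' \<in> Words s"
    and hi: "\<And>a j. a \<in> set w \<union> set v \<union> set w' \<union> set v' \<Longrightarrow> j \<in> J \<Longrightarrow> el j a = None"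
    and wt: "\<And>j. j \<in> J \<Longrightarrow> ww j w = ww j v" "\<And>j. j \<in> J \<Longrightarrow> ww j w' = ww j v'"
    and eq: "w = w' \<longleftrightarrow> v = v'"
    and l: "set l \<subseteq> J" "set l' \<subseteq> J"
  shows "word_fs l w = word_fs l' w' \<longleftrightarrow> word_fs l v = word_fs l' v'"
    and "word_fs l w = None \<longleftrightarrow> word_fs l v = None"
proof -
  have pair: "word_pair s J (basis_vec x) (basis_vec y) (\<lambda>j. ww j x)"
    if "x \<in> Words s" "y \<in> Words s" "\<And>a j. a \<in> set x \<union> set y \<Longrightarrow> j \<in> J \<Longrightarrow> el j a = None"
      "\<And>j. j \<in> J \<Longrightarrow> ww j x = ww j y" for x y
  proof (intro uq_pair.intro uq_pair_axioms.intro uq_module_W J basis_vec_W that(1,2))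
    fix i assume "i \<in> J"
    then show "Eop i (basis_vec x) = 0" "Eop i (basis_vec y) = 0"
      using that(3) by (intro Eop_highest_word; simp)+
    show "Kop i (basis_vec x) = ws (qq powi ww i x) (basis_vec x)" by (rule Kop_basis_vec)
    show "Kop i (basis_vec y) = ws (qq powi ww i x) (basis_vec y)"
      unfolding that(4)[OF \<open>i \<in> J\<close>] by (rule Kop_basis_vec)
  qed
  have p: "word_pair s J (basis_vec w) (basis_vec v) (\<lambda>j. ww j w)"
    by (rule pair) (use W hi wt in auto)
  have p': "word_pair s J (basis_vec w') (basis_vec v') (\<lambda>j. ww j w')"
    by (rule pair) (use W hi wt in auto)
  let ?D = "uq_pair.D ws Fop ws Fop J (basis_vec w) (basis_vec v) (\<lambda>j. ww j w)"
  let ?D' = "uq_pair.D ws Fop ws Fop J (basis_vec w') (basis_vec v') (\<lambda>j. ww j w')"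
  let ?x = "fvec s l (basis_vec w)" and ?y = "fvec s l (basis_vec v)"
  let ?x' = "fvec s l' (basis_vec w')" and ?y' = "fvec s l' (basis_vec v')"
  have d: "(?x, ?y) \<in> ?D" by (rule fvec_pair[OF J p l(1)])
  have d': "(?x', ?y') \<in> ?D'" by (rule fvec_pair[OF J p' l(2)])
  \<comment> \<open>The hypothesis on the four words gives equal pairings of the generators.\<close>
  have b: "ip s (basis_vec x) (basis_vec y) = (if x = y then 1 else 0)" if "y \<in> Words s" for x y
    by (simp add: ip_basis_vec[OF that] basis_vec_apply)
  have 1: "ip s ?x ?x = ip s ?y ?y"
    using diagonal_isometry[OF J p p _ d d] W by (simp add: b)
  have 2: "ip s ?x' ?x' = ip s ?y' ?y'"
    using diagonal_isometry[OF J p' p' _ d' d'] W by (simp add: b)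
  have 3: "ip s ?x ?x' = ip s ?y ?y'"
    using diagonal_isometry[OF J p p' _ d d'] W eq by (simp add: b)
  have lE: "set l \<subseteq> E6_index" "set l' \<subseteq> E6_index" using l J by auto
  have WW: "?x \<in> W s" "?y \<in> W s" "?x' \<in> W s" "?y' \<in> W s"
    using W lE by (auto intro: fvec_W basis_vec_W)
  have "ip s (?x - ?x') (?x - ?x') = ip s (?y - ?y') (?y - ?y')"
    unfolding ip_diff ip_linear_right(4) using 1 2 3 ip_sym[of s ?x' ?x] ip_sym[of s ?y' ?y] by simp
  then have "?x - ?x' \<in> mW s \<longleftrightarrow> ?y - ?y' \<in> mW s"
    using mW_iff[of "?x - ?x'" s] mW_iff[of "?y - ?y'" s] WW words.subspace_diff[OF subspace_W] by metis
  moreover have "?x - ?x' \<in> mW s \<longleftrightarrow> opt_vec (word_fs l w) - opt_vec (word_fs l' w') \<in> mW s"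
    "?y - ?y' \<in> mW s \<longleftrightarrow> opt_vec (word_fs l v) - opt_vec (word_fs l' v') \<in> mW s"
    using W lE by (intro mW_shift fvec_word; simp)+
  moreover have "opt_vec x - opt_vec y \<in> mW s \<longleftrightarrow> x = y" for x y
    using opt_vec_inject mW_lin(4) by (metis diff_self)
  ultimately show "word_fs l w = word_fs l' w' \<longleftrightarrow> word_fs l v = word_fs l' v'" by simp
  have none: "fvec s l (basis_vec x) \<in> mW s \<longleftrightarrow> word_fs l x = None" if "x \<in> Words s" for x
  proof -
    have "fvec s l (basis_vec x) - 0 \<in> mW s \<longleftrightarrow> opt_vec (word_fs l x) - opt_vec None \<in> mW s"
      using that lE mW_lin(4) unfolding opt_vec_simps(1) by (intro mW_shift fvec_word) simp_all
    then show ?thesis using opt_vec_inject[of "word_fs l x" None] mW_lin(4) by (metis diff_self diff_zero)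
  qed
  show "word_fs l w = None \<longleftrightarrow> word_fs l v = None"
    using none[OF W(1)] none[OF W(2)] mW_iff[OF WW(1)] mW_iff[OF WW(2)] 1 by metis
qed

end

section \<open>The crystal base of the irreducible module in terms of words\<close>

lemma E6_index_cases: "i \<in> E6_index \<longleftrightarrow> i = 1 \<or> i = 2 \<or> i = 3 \<or> i = 4 \<or> i = 5 \<or> i = 6"
  by (auto simp: E6_index_def)

text \<open>Twice the pairing with the half sum of the positive coroots; the coefficients are twice the row sums
of the inverse Cartan matrix, so that every simple root has height 2.\<close>

definition rho_height :: "(nat \<Rightarrow> int) \<Rightarrow> int" where
  "rho_height \<nu> = 16 * \<nu> 1 + 22 * \<nu> 2 + 30 * \<nu> 3 + 42 * \<nu> 4 + 30 * \<nu> 5 + 16 * \<nu> 6"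

lemma rho_height_step: "j \<in> E6_index \<Longrightarrow> rho_height (\<lambda>i. \<nu> i - cartan i j) = rho_height \<nu> - 2"
  unfolding E6_index_cases by (auto simp: rho_height_def cartan_def aff_edges_def doubleton_eq_iff)

lemma rho_height_cong: "(\<And>i. i \<in> E6_index \<Longrightarrow> \<nu> i = \<nu>' i) \<Longrightarrow> rho_height \<nu> = rho_height \<nu>'"
  by (simp add: rho_height_def E6_index_cases)

context Uq_E6_module
begin

lemma inv_K_eigen:
  assumes "i \<in> E6_index" "K i v = (qq powi n) *s v" shows "inv (K i) v = (qq powi (- n)) *s v"
proof (rule inv_f_eq)
  show "inj (K i)" using bij_K[OF assms(1)] by (rule bij_is_inj)
  have "qq powi (- n) * qq powi n = 1" by (simp flip: qq_powi_add)
  then show "K i ((qq powi (- n)) *s v) = v"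
    using linear_map_simps(2)[OF linear_K[OF assms(1)]] assms(2) by simp
qed

lemma sl2_module_V:
  assumes int: integrable and i: "i \<in> E6_index"
  shows "sl2_module (*s) UNIV (E i) (F i) (K i)"
proof (intro sl2_module.intro sl2_module_axioms.intro vector_space_axioms linear_E linear_F linear_K i)
  fix v n assume K: "K i v = (qq powi n) *s v"
  show "K i (E i v) = (qq powi (n + 2)) *s E i v"
    unfolding K_E[OF i i] K linear_map_simps(2)[OF linear_E[OF i]] by (simp add: qq_powi_add mult.commute)
  show "K i (F i v) = (qq powi (n - 2)) *s F i v"
    unfolding K_F[OF i i] K linear_map_simps(2)[OF linear_F[OF i]]
    using qq_powi_add[of n "-2"] by (simp add: mult.commute)
  have "(1 / (qq - inverse qq)) *s (K i v - inv (K i) v) = qi n *s v"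
    unfolding inv_K_eigen[OF i K] K by (simp add: qi_def divide_inverse mult.commute flip: scale_left_diff_distrib)
  then show "E i (F i v) = F i (E i v) + qi n *s v"
    using E_F[OF i i, of v] by (simp add: algebra_simps)
next
  have "(\<Union>\<nu>. weight_space \<nu>) \<subseteq> {v \<in> UNIV. \<exists>n. K i v = (qq powi n) *s v}"
    using i by (auto simp: weight_space_def)
  then show "UNIV \<subseteq> span {v \<in> UNIV. \<exists>n. K i v = (qq powi n) *s v}"
    using int span_mono unfolding integrable_def by blast
  show "\<exists>n. (E i ^^ n) v = 0" "\<exists>n. (F i ^^ n) v = 0" for v
    using int i unfolding integrable_def by blast+
qed simp_all

lemma uq_module_V: assumes integrable shows "uq_module (*s) UNIV E F K E6_index"
proof (intro uq_module.intro uq_module_axioms.intro vector_space_axioms sl2_module_V assms)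
  fix i j v assume i: "i \<in> E6_index" and j: "j \<in> E6_index"
  show "K i (F j v) = (qq powi (- cartan i j)) *s F j (K i v)" by (rule K_F[OF i j])
  show "E i (F j v) = F j (E i v)" if "i \<noteq> j" using E_F[OF i j, of v] that by simp
qed

lemma tilde_eq:
  assumes int: integrable and i: "i \<in> E6_index"
  shows "f_tilde i = sl2_module.ft (*s) UNIV (E i) (F i) (K i)"
    and "e_tilde i = sl2_module.et (*s) UNIV (E i) (F i) (K i)"
proof -
  interpret M: sl2_module "(*s)" UNIV "E i" "F i" "K i" by (rule sl2_module_V[OF int i])
  have F: "F_div i = M.Fdiv" by (intro ext) (simp add: F_div_def M.Fdiv_def)
  show "f_tilde i = M.ft" unfolding f_tilde_def F by (rule M.ft_unique[OF refl])
  show "e_tilde i = M.et" unfolding e_tilde_def F by (rule M.et_unique[OF refl])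
qed

lemma A_span_scale: assumes "x \<in> A_span Y" "c \<in> A0" shows "c *s x \<in> A_span Y"
proof -
  obtain S d where S: "x = (\<Sum>y\<in>S. d y *s y)" "finite S" "S \<subseteq> Y" "d ` S \<subseteq> A0"
    using assms(1) unfolding A_span_def by blast
  have "c *s x = (\<Sum>y\<in>S. (c * d y) *s y)" unfolding S(1) scale_sum_right by simp
  moreover have "(\<lambda>y. c * d y) ` S \<subseteq> A0" using S(4) assms(2) by (auto intro: A0_mult)
  ultimately show ?thesis unfolding A_span_def using S(2,3)
    by (intro CollectI exI[of _ S] exI[of _ "\<lambda>y. c * d y"]) simp
qed

lemma A_span_add: assumes "x \<in> A_span Y" "y \<in> A_span Y" shows "x + y \<in> A_span Y"
proof -
  obtain S c where S: "x = (\<Sum>z\<in>S. c z *s z)" "finite S" "S \<subseteq> Y" "c ` S \<subseteq> A0"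
    using assms(1) unfolding A_span_def by blast
  obtain T d where T: "y = (\<Sum>z\<in>T. d z *s z)" "finite T" "T \<subseteq> Y" "d ` T \<subseteq> A0"
    using assms(2) unfolding A_span_def by blast
  define g where "g z = (if z \<in> S then c z else 0) + (if z \<in> T then d z else 0)" for z
  have "(\<Sum>z\<in>S \<union> T. g z *s z) = x + y"
    unfolding g_def scale_left_distrib sum.distrib S(1) T(1)
    using sum_extend_by_zero[of "S \<union> T" S "\<lambda>z a. a *s z" c] sum_extend_by_zero[of "S \<union> T" T "\<lambda>z a. a *s z" d] S(2) T(2)
    by simp
  moreover have "g ` (S \<union> T) \<subseteq> A0" using S(4) T(4) by (auto simp: g_def image_subset_iff intro!: A0_add)
  ultimately show ?thesis unfolding A_span_def using S(2,3) T(2,3)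
    by (intro CollectI exI[of _ "S \<union> T"] exI[of _ g]) auto
qed

lemma A_span_diff: "x \<in> A_span Y \<Longrightarrow> y \<in> A_span Y \<Longrightarrow> x - y \<in> A_span Y"
  using A_span_add[of x Y "(-1) *s y"] A_span_scale[of y Y "-1"] A0_uminus[of 1] by simp

lemma A_span_zero: "0 \<in> A_span Y"
  unfolding A_span_def by (intro CollectI exI[of _ "{}"]) simp

definition q_multiples :: "'v set \<Rightarrow> 'v set" where
  "q_multiples M = (\<lambda>v. qq *s v) ` M"

context
  fixes Y M assumes M: "M = A_span Y"
begin

lemma q_multiples_closed:
  "x \<in> q_multiples M \<Longrightarrow> y \<in> q_multiples M \<Longrightarrow> x + y \<in> q_multiples M"
  "x \<in> q_multiples M \<Longrightarrow> y \<in> q_multiples M \<Longrightarrow> x - y \<in> q_multiples M"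
  "0 \<in> q_multiples M"
proof -
  show "x + y \<in> q_multiples M" "x - y \<in> q_multiples M" if xy: "x \<in> q_multiples M" "y \<in> q_multiples M"
  proof -
    obtain a b where "a \<in> M" "b \<in> M" "x = qq *s a" "y = qq *s b" using xy by (auto simp: q_multiples_def)
    then show "x + y \<in> q_multiples M" "x - y \<in> q_multiples M"
      using A_span_add[of a Y b] A_span_diff[of a Y b] M
      by (auto simp: q_multiples_def simp flip: scale_right_distrib scale_right_diff_distrib)
  qed
  show "0 \<in> q_multiples M" unfolding q_multiples_def M using A_span_zero by (intro image_eqI[of _ _ 0]) simp_all
qed

lemma coset_q_multiples: "coset M v = (\<lambda>x. v + x) ` q_multiples M"
  by (auto simp: coset_def q_multiples_def)

lemma coset_self: "v \<in> coset M v"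
  using q_multiples_closed(3) by (force simp: coset_q_multiples)

lemma mem_coset: "w \<in> coset M v \<longleftrightarrow> w - v \<in> q_multiples M"
  by (auto simp: coset_q_multiples intro!: image_eqI[of _ _ "w - v"])

lemma coset_eq_iff: "coset M v = coset M w \<longleftrightarrow> v - w \<in> q_multiples M"
proof
  assume "coset M v = coset M w"
  then show "v - w \<in> q_multiples M" using coset_self[of v] mem_coset by simp
next
  assume vw: "v - w \<in> q_multiples M"
  have "x - v \<in> q_multiples M \<longleftrightarrow> x - w \<in> q_multiples M" for x
  proof
    assume "x - v \<in> q_multiples M"
    from q_multiples_closed(1)[OF this vw] show "x - w \<in> q_multiples M" by simp
  next
    assume "x - w \<in> q_multiples M"
    from q_multiples_closed(2)[OF this vw] show "x - v \<in> q_multiples M" by simp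
  qed
  then show "coset M v = coset M w" by (auto simp: mem_coset)
qed

lemma induced_coset:
  assumes T: "Vector_Spaces.linear (*s) (*s) T" and TM: "T ` M \<subseteq> M"
  shows "induced M T (coset M v) = coset M (T v)"
proof -
  have "coset M (T x) = coset M (T v)" if x: "x \<in> coset M v" for x
  proof -
    obtain a where "a \<in> M" "x - v = qq *s a" using x unfolding mem_coset q_multiples_def by blast
    then have "T x - T v = qq *s T a" "T a \<in> M"
      using TM linear_map_simps(2,4)[OF T] by (metis, blast)
    then show ?thesis unfolding coset_eq_iff q_multiples_def by auto
  qed
  then show ?thesis using coset_self[of v] unfolding induced_def by blast
qed

end

end

text \<open>The highest weight word \<open>uw\<close> generates a copy of the irreducible module among the words.\<close>

locale word_model = highest_weight_crystal_base scale E F K \<mu> u L B + letter_crystal X fl el wl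
  for scale :: "Qq \<Rightarrow> 'v \<Rightarrow> 'v::ab_group_add" (infixr \<open>*s\<close> 75)
    and E F K :: "nat \<Rightarrow> 'v \<Rightarrow> 'v" and \<mu> u L B
    and X :: "'a set" and fl el :: "nat \<Rightarrow> 'a \<Rightarrow> 'a option" and wl :: "nat \<Rightarrow> 'a \<Rightarrow> int" +
  fixes s :: nat and uw :: "'a list"
  assumes uw_Words: "uw \<in> Words s"
    and uw_highest: "a \<in> set uw \<Longrightarrow> i \<in> E6_index \<Longrightarrow> el i a = None"
    and uw_weight: "i \<in> E6_index \<Longrightarrow> ww i uw = \<mu> i"
begin

lemma integrable_module: integrable
  using is_crystal_base by (simp add: crystal_base_def)

lemma base_f_e:
  assumes "i \<in> E6_index" "b \<in> B" "b' \<in> B"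
  shows "induced L (f_tilde i) b = b' \<longleftrightarrow> induced L (e_tilde i) b' = b"
proof -
  have "\<forall>i\<in>E6_index. \<forall>b\<in>B. \<forall>b'\<in>B. induced L (f_tilde i) b = b' \<longleftrightarrow> induced L (e_tilde i) b' = b"
    using is_crystal_base unfolding crystal_base_def by (elim conjE)
  then show ?thesis using assms by simp
qed

lemma base_e:
  assumes "i \<in> E6_index" "b \<in> B" shows "induced L (e_tilde i) b \<in> insert (coset L 0) B"
proof -
  have "\<forall>i\<in>E6_index. \<forall>b\<in>B. induced L (e_tilde i) b \<in> insert (coset L 0) B \<and> induced L (f_tilde i) b \<in> insert (coset L 0) B"
    using is_crystal_base unfolding crystal_base_def by (elim conjE)
  then show ?thesis using assms by simp
qed

lemma base_weight: assumes "b \<in> B" shows "\<exists>\<nu>. b \<inter> weight_space \<nu> \<noteq> {}"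
proof -
  have "\<forall>b\<in>B. \<exists>\<nu>. b \<inter> weight_space \<nu> \<noteq> {}"
    using is_crystal_base unfolding crystal_base_def by (elim conjE)
  then show ?thesis using assms by simp
qed

lemma u_facts: "u \<noteq> 0" "i \<in> E6_index \<Longrightarrow> E i u = 0" "i \<in> E6_index \<Longrightarrow> K i u = (qq powi \<mu> i) *s u"
  using highest_weight by (auto simp: highest_weight_vector_def weight_space_def)

lemma pair_axioms: "uq_pair (*s) UNIV E F K ws (W s) Eop Fop Kop E6_index u (basis_vec uw) \<mu>"
proof (intro uq_pair.intro uq_pair_axioms.intro uq_module_V integrable_module uq_module_W order_refl)
  fix i assume i: "i \<in> E6_index"
  show "Eop i (basis_vec uw) = 0" using uw_highest i by (intro Eop_highest_word) blast
  show "Kop i (basis_vec uw) = ws (qq powi \<mu> i) (basis_vec uw)"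
    unfolding uw_weight[OF i, symmetric] by (rule Kop_basis_vec)
qed (simp_all only: u_facts basis_vec_W uw_Words UNIV_I)

interpretation P: uq_pair "(*s)" UNIV E F K ws "W s" Eop Fop Kop E6_index u "basis_vec uw" \<mu>
  by (rule pair_axioms)

text \<open>Applying \<open>F\<close> lowers the height, so the part of weight \<open>\<mu>\<close> is the line through the generator, and by
contravariance every \<open>F d\<close> is orthogonal to the highest weight word.\<close>

lemma dw_top:
  "P.dw \<nu> d \<Longrightarrow> d = 0 \<or> (\<nu> = \<mu> \<and> (\<exists>c. d = P.scp c (u, basis_vec uw))) \<or>
     (rho_height \<nu> < rho_height \<mu> \<and> ip s (snd d) (basis_vec uw) = 0)"
proof (induction rule: P.dw.induct)
  case base
  have "(u, basis_vec uw) = P.scp 1 (u, basis_vec uw)" by (simp only: P.P.scale_one)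
  then show ?case by blast
next
  case (add \<nu> d d')
  have ip: "ip s (snd (d + d')) (basis_vec uw) = ip s (snd d) (basis_vec uw) + ip s (snd d') (basis_vec uw)"
    by (simp only: snd_add ip_add)
  consider "d = 0" | "d' = 0"
    | c c' where "\<nu> = \<mu>" "d = P.scp c (u, basis_vec uw)" "d' = P.scp c' (u, basis_vec uw)"
    | "rho_height \<nu> < rho_height \<mu>" "ip s (snd d) (basis_vec uw) = 0" "ip s (snd d') (basis_vec uw) = 0"
    using add.IH by fastforce
  then show ?case
  proof cases
    case 3
    then have "d + d' = P.scp (c + c') (u, basis_vec uw)" by (simp only: P.P.scale_left_distrib)
    then show ?thesis using 3(1) by blast
  next
    case 1
    then show ?thesis using add.IH(2) by (simp only: add_0_left)
  next
    case 2
    then show ?thesis using add.IH(1) by (simp only: add_0_right)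
  next
    case 4
    then have "ip s (snd (d + d')) (basis_vec uw) = 0" unfolding ip by simp
    then show ?thesis using 4(1) by blast
  qed
next
  case (scale \<nu> d c)
  consider "d = 0" | c' where "\<nu> = \<mu>" "d = P.scp c' (u, basis_vec uw)"
    | "rho_height \<nu> < rho_height \<mu>" "ip s (snd d) (basis_vec uw) = 0"
    using scale.IH by blast
  then show ?case
  proof cases
    case 1
    then show ?thesis by (simp only: P.P.scale_zero_right) simp
  next
    case 2
    then have "P.scp c d = P.scp (c * c') (u, basis_vec uw)" by (simp only: P.P.scale_scale)
    then show ?thesis using 2 by blast
  next
    case 3
    then have "ip s (snd (P.scp c d)) (basis_vec uw) = 0" by (simp only: P.fst_snd_op ip_scale mult_zero_right)
    then show ?thesis using 3 by blast
  qed
next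
  case (F \<nu> d j)
  have "ip s (snd (P.Fp j d)) (basis_vec uw) = 0"
    using ip_F[OF F.hyps(2), of s "snd d" "basis_vec uw"] P.u_E(2)[OF F.hyps(2)]
    by (simp only: P.fst_snd_op Kop_lin ip_linear_right mult_zero_right)
  moreover have "rho_height \<nu> \<le> rho_height \<mu> \<or> d = 0" using F.IH by auto
  ultimately show ?case using rho_height_step[OF F.hyps(2), of \<nu>] P.Fp_lin(3)[OF F.hyps(2)] by auto
qed simp

text \<open>The component of weight \<open>\<mu>\<close> of \<open>(0, b)\<close> is a multiple of the generator with vanishing left entry,
hence zero. All other components are orthogonal to the highest weight word.\<close>

lemma D_zero_top:
  assumes "(0, b) \<in> P.D" shows "ip s b (basis_vec uw) = 0"
proof -
  have sub: "P.P.subspace {d. P.dw \<nu> d}" for \<nu>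
    unfolding P.P.subspace_def using P.dw.zero P.dw.add P.dw.scale by simp
  have "{d. \<exists>\<nu>. P.dw \<nu> d} = (\<Union>\<nu>\<in>UNIV. {d. P.dw \<nu> d})" by blast
  then have "(0, b) \<in> P.P.span (\<Union>\<nu>\<in>UNIV. {d. P.dw \<nu> d})" using assms unfolding P.D_def by simp
  from P.P.span_Union_subspaces[OF sub this] obtain A z where
    A: "finite A" "\<And>\<nu>. \<nu> \<in> A \<Longrightarrow> P.dw \<nu> (z \<nu>)" "(0, b) = sum z A" by blast
  define A' where "A' = {\<nu> \<in> A. z \<nu> \<noteq> 0}"
  have A': "finite A'" "sum z A' = (0, b)"
    unfolding A(3) A'_def using A(1) by (auto intro!: sum.mono_neutral_left)
  have low: "rho_height \<nu> < rho_height \<mu> \<and> ip s (snd (z \<nu>)) (basis_vec uw) = 0" if "\<nu> \<in> A'" "\<nu> \<noteq> \<mu>" for \<nu>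
    using dw_top[OF A(2), of \<nu>] that by (auto simp: A'_def)
  have "\<mu> \<notin> A'"
  proof
    assume mu: "\<mu> \<in> A'"
    \<comment> \<open>The left entries of the other components belong to different weights.\<close>
    have "fst (z \<mu>) = 0"
    proof (rule separated_eigenvector_zero[where B = "A' - {\<mu>}" and I = E6_index and H = K
          and c = "\<lambda>i \<nu>. qq powi (\<nu> i)" and z = "\<lambda>\<nu>. fst (z \<nu>)"])
      show "finite (A' - {\<mu>})" using A'(1) by simp
      show "Vector_Spaces.linear (*s) (*s) (K i)" if "i \<in> E6_index" for i by (rule linear_K[OF that])
      show "K i (fst (z b)) = (qq powi b i) *s fst (z b)" if "i \<in> E6_index" "b \<in> insert \<mu> (A' - {\<mu>})" for i b
      proof -
        have "P.Kp i (z b) = P.scp (qq powi b i) (z b)"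
          using that mu by (intro P.dw_K A(2)) (auto simp: A'_def)
        from arg_cong[OF this, of fst] show ?thesis by (simp only: P.fst_snd_op)
      qed
      show "\<exists>i\<in>E6_index. qq powi \<mu> i \<noteq> qq powi b i" if b: "b \<in> A' - {\<mu>}" for b
      proof (rule ccontr)
        assume "\<not> ?thesis"
        then have "rho_height \<mu> = rho_height b" by (intro rho_height_cong) (auto simp: qq_powi_inject)
        then show False using low[of b] b by auto
      qed
      have "(\<Sum>\<nu>\<in>insert \<mu> (A' - {\<mu>}). fst (z \<nu>)) = fst (sum z A')"
        using mu by (simp add: insert_absorb fst_sum)
      then show "(\<Sum>\<nu>\<in>insert \<mu> (A' - {\<mu>}). fst (z \<nu>)) = 0" unfolding A'(2) by simp
    qed simp
    moreover obtain c where c: "z \<mu> = P.scp c (u, basis_vec uw)"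
      using dw_top[OF A(2), of \<mu>] mu by (auto simp: A'_def)
    ultimately have "c = 0" using u_facts(1) by (simp add: P.scp_def)
    then have "z \<mu> = 0" unfolding c by (simp only: P.P.scale_zero_left)
    then show False using mu by (simp add: A'_def)
  qed
  then have "ip s (snd (z \<nu>)) (basis_vec uw) = 0" if "\<nu> \<in> A'" for \<nu> using low that by blast
  moreover have "b = (\<Sum>\<nu>\<in>A'. snd (z \<nu>))" using arg_cong[OF A'(2), of snd] by (simp add: snd_sum)
  ultimately show ?thesis by (simp add: ip_sum)
qed

text \<open>The elements \<open>b\<close> with \<open>(0, b) \<in> D\<close> form a submodule, which is orthogonal to the highest weight word.
By contravariance it is orthogonal to all right components of \<open>D\<close>, in particular to itself, so the
definite form annihilates it.\<close>

lemma D_zero: assumes "(0, b) \<in> P.D" shows "b = 0"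
proof -
  have "\<forall>b. (0, b) \<in> P.D \<longrightarrow> ip s (snd d) b = 0" if "P.dw \<nu> d" for \<nu> d
    using that
  proof (induction rule: P.dw.induct)
    case base
    show ?case using D_zero_top by (simp only: snd_conv ip_sym[of s "basis_vec uw"]) blast
  next
    case (F \<nu> d j)
    show ?case
    proof (intro allI impI)
      fix b assume b: "(0, b) \<in> P.D"
      have "P.Kp j (P.Ep j (0, b)) \<in> P.D" by (intro P.D_K P.D_E b F.hyps(2))
      moreover have "P.Kp j (P.Ep j (0, b)) = (0, Kop j (Eop j b))"
        using linear_map_simps(3)[OF linear_E[OF F.hyps(2)]] linear_map_simps(3)[OF linear_K[OF F.hyps(2)]]
        by (simp only: prod_eq_iff P.fst_snd_op fst_conv snd_conv)
      ultimately have "ip s (snd d) (Kop j (Eop j b)) = 0" using F.IH by metis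
      then show "ip s (snd (P.Fp j d)) b = 0"
        by (simp only: P.fst_snd_op ip_F[OF F.hyps(2)] mult_zero_right)
    qed
  qed (simp_all only: snd_add snd_zero P.fst_snd_op ip_linear, simp_all)
  note 1 = this
  have "ip s (snd d) b = 0" if "d \<in> P.D" for d
    using that
  proof (induction rule: P.D_induct)
    case (weight \<nu> d)
    then show ?case using 1 assms by blast
  next
    case (add d d')
    then show ?case by (simp only: snd_add ip_add add_0_right)
  qed
  from this[OF assms] have "ip s b b = 0" by simp
  moreover have "b \<in> W s" using P.D_S[OF assms, of 1] by (simp add: E6_index_def)
  ultimately show ?thesis by (intro ip_definite)
qed

text \<open>The left components form a submodule that contains \<open>u\<close>, and irreducibility leaves only the whole module.\<close>

lemma D_total: "\<exists>b. (a, b) \<in> P.D"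
proof -
  define T where "T = fst ` P.D"
  have sub: "subspace T"
    unfolding T_def subspace_def
  proof safe
    show "0 \<in> fst ` P.D" using P.P.subspace_0[OF P.subspace_D] by force
    show "fst d + fst d' \<in> fst ` P.D" if "d \<in> P.D" "d' \<in> P.D" for d d'
      using P.P.subspace_add[OF P.subspace_D that] by (metis fst_add image_eqI)
    show "c *s fst d \<in> fst ` P.D" if "d \<in> P.D" for c d
      using P.P.subspace_scale[OF P.subspace_D that, of c] by (metis P.fst_snd_op(1) image_eqI)
  qed
  have inv: "inv (K i) (fst d) \<in> T" if i: "i \<in> E6_index" and d: "d \<in> P.D" for i d
    using d
  proof (induction rule: P.D_induct)
    case (weight \<nu> d)
    have "K i (fst d) = (qq powi \<nu> i) *s fst d"
      using arg_cong[OF P.dw_K[OF weight i], of fst] by (simp only: P.fst_snd_op)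
    then have "inv (K i) (fst d) = (qq powi (- \<nu> i)) *s fst d" by (rule inv_K_eigen[OF i])
    moreover have "fst d \<in> T" using P.dw_D[OF weight] by (simp add: T_def)
    ultimately show ?case using subspace_scale[OF sub] by simp
  next
    case (add d d')
    have "inv (K i) (fst d + fst d') = inv (K i) (fst d) + inv (K i) (fst d')"
    proof (rule inv_f_eq)
      show "inj (K i)" using bij_K[OF i] by (rule bij_is_inj)
      show "K i (inv (K i) (fst d) + inv (K i) (fst d')) = fst d + fst d'"
        using linear_map_simps(1)[OF linear_K[OF i]] bij_K[OF i] by (simp add: bij_def surj_f_inv_f)
    qed
    then show ?case using subspace_add[OF sub add] by simp
  qed
  have "E i ` T \<subseteq> T \<and> F i ` T \<subseteq> T \<and> K i ` T \<subseteq> T \<and> inv (K i) ` T \<subseteq> T" if i: "i \<in> E6_index" for i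
  proof (intro conjI subsetI)
    show "x \<in> T" if "x \<in> inv (K i) ` T" for x using that inv[OF i] by (auto simp: T_def)
    fix x
    show "x \<in> T" if "x \<in> E i ` T"
      using that unfolding T_def image_image by (rule imageE) (simp only: P.fst_snd_op(3)[symmetric] imageI P.D_E i)
    show "x \<in> T" if "x \<in> F i ` T"
      using that unfolding T_def image_image by (rule imageE) (simp only: P.fst_snd_op(5)[symmetric] imageI P.D_F i)
    show "x \<in> T" if "x \<in> K i ` T"
      using that unfolding T_def image_image by (rule imageE) (simp only: P.fst_snd_op(7)[symmetric] imageI P.D_K i)
  qed
  then have "T = {0} \<or> T = UNIV" using irreducible sub unfolding irreducible_module_def by blast
  moreover have "u \<in> T" using P.dw_D[OF P.dw.base] unfolding T_def by force
  ultimately have "T = UNIV" using u_facts(1) by blast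
  then have "a \<in> fst ` P.D" unfolding T_def by simp
  then show ?thesis by (metis imageE prod.collapse)
qed

text \<open>The submodule \<open>D\<close> is total and single-valued, hence the graph of a map from the irreducible module to
the words. This map commutes with the action and with Kashiwara's operators.\<close>

definition psi :: "'v \<Rightarrow> 'a list \<Rightarrow> Qq" where
  "psi a = (THE b. (a, b) \<in> P.D)"

lemma psi_eq: assumes "(a, b) \<in> P.D" shows "psi a = b"
  unfolding psi_def
proof (rule the_equality[where P = "\<lambda>b. (a, b) \<in> P.D"])
  show "b' = b" if "(a, b') \<in> P.D" for b'
  proof -
    have "(a, b') - (a, b) \<in> P.D" by (rule P.P.subspace_diff[OF P.subspace_D that assms])
    moreover have "(a, b') - (a, b) = (0, b' - b)" by (simp only: prod_eq_iff fst_diff snd_diff fst_conv snd_conv) simp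
    ultimately show ?thesis using D_zero[of "b' - b"] by simp
  qed
qed (rule assms)

lemma psi_D: "(a, psi a) \<in> P.D"
proof -
  obtain b where b: "(a, b) \<in> P.D" using D_total by blast
  show ?thesis unfolding psi_eq[OF b] by (rule b)
qed

lemma psi_add: "psi (a + b) = psi a + psi b"
  by (rule psi_eq[OF P.P.subspace_add[OF P.subspace_D psi_D[of a] psi_D[of b], unfolded add_Pair]])

lemma psi_scale: "psi (c *s a) = ws c (psi a)"
  by (rule psi_eq[OF P.P.subspace_scale[OF P.subspace_D psi_D[of a], of c, unfolded P.scp_def map_prod_simp]])

lemma psi_diff: "psi (a - b) = psi a - psi b"
  by (rule psi_eq[OF P.P.subspace_diff[OF P.subspace_D psi_D[of a] psi_D[of b], unfolded diff_Pair]])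

lemma psi_W: "psi a \<in> W s" using P.D_S[OF psi_D, of 1 a] by (simp add: E6_index_def)

lemma psi_K: assumes i: "i \<in> E6_index" shows "psi (K i a) = Kop i (psi a)"
  by (rule psi_eq[OF P.D_K[OF psi_D i, of a, unfolded P.Kp_def map_prod_simp]])

lemma psi_tilde:
  assumes i: "i \<in> E6_index"
  shows "psi (f_tilde i a) = wft s i (psi a)" "psi (e_tilde i a) = wet s i (psi a)"
  unfolding tilde_eq[OF integrable_module i]
  by (rule psi_eq[OF P.D_tilde(1)[OF psi_D i, of a, unfolded fst_conv snd_conv]]
      psi_eq[OF P.D_tilde(2)[OF psi_D i, of a, unfolded fst_conv snd_conv]])+

primrec vf :: "nat list \<Rightarrow> 'v" where
  "vf [] = u"
| "vf (i # l) = f_tilde i (vf l)"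

lemma f_strings_vf: "f_strings u = vf ` {l. set l \<subseteq> E6_index}"
proof
  show "f_strings u \<subseteq> vf ` {l. set l \<subseteq> E6_index}"
  proof
    fix v assume "v \<in> f_strings u"
    then show "v \<in> vf ` {l. set l \<subseteq> E6_index}"
    proof induction
      case start
      show ?case by (rule image_eqI[of _ _ "[]"]) simp_all
    next
      case (step v i)
      then obtain l where "v = vf l" "set l \<subseteq> E6_index" by auto
      then show ?case using step by (intro image_eqI[of _ _ "i # l"]) simp_all
    qed
  qed
  have "vf l \<in> f_strings u" if "set l \<subseteq> E6_index" for l
    using that by (induction l) (auto intro: f_strings.intros)
  then show "vf ` {l. set l \<subseteq> E6_index} \<subseteq> f_strings u" by auto
qed

lemma psi_vf: "set l \<subseteq> E6_index \<Longrightarrow> psi (vf l) - opt_vec (word_fs l uw) \<in> mW s"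
proof -
  assume l: "set l \<subseteq> E6_index"
  then have "psi (vf l) = fvec s l (basis_vec uw)"
  proof (induction l)
    case Nil
    show ?case unfolding vf.simps fvec.simps by (rule psi_eq[OF P.dw_D[OF P.dw.base]])
  next
    case (Cons i l)
    then have i: "i \<in> E6_index" and IH: "psi (vf l) = fvec s l (basis_vec uw)" by auto
    show ?case unfolding vf.simps fvec.simps psi_tilde[OF i] IH ..
  qed
  then show ?thesis using fvec_word[OF uw_Words l] by simp
qed

lemma psi_vf_mW: assumes "set l \<subseteq> E6_index" shows "psi (vf l) \<in> mW s \<longleftrightarrow> word_fs l uw = None"
proof
  assume "psi (vf l) \<in> mW s"
  from mW_lin(3)[OF this psi_vf[OF assms]] have "opt_vec (word_fs l uw) - opt_vec None \<in> mW s"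
    unfolding opt_vec_simps(1) by (simp only: diff_diff_eq2 add_diff_cancel_left' diff_zero)
  then show "word_fs l uw = None" by (rule opt_vec_inject)
next
  assume "word_fs l uw = None"
  then show "psi (vf l) \<in> mW s" using psi_vf[OF assms] by (simp only: opt_vec_simps diff_zero)
qed

lemma psi_L: assumes "v \<in> L" shows "psi v \<in> LW s"
proof -
  obtain Y c where Y: "v = (\<Sum>y\<in>Y. c y *s y)" "finite Y" "Y \<subseteq> f_strings u" "c ` Y \<subseteq> A0"
    using assms unfolding L_def A_span_def by blast
  have "psi y \<in> LW s" if y: "y \<in> f_strings u" for y
  proof -
    obtain l where l: "set l \<subseteq> E6_index" "y = vf l" using y f_strings_vf by auto
    have "opt_vec (word_fs l uw) \<in> LW s" using word_fs_Words[OF uw_Words l(1)] by (rule opt_vec_LW)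
    from LW_lin(1)[OF mW_LW[OF psi_vf[OF l(1)]] this] show ?thesis unfolding l(2) by (simp only: diff_add_cancel)
  qed
  moreover have "psi (\<Sum>y\<in>Y. c y *s y) = (\<Sum>y\<in>Y. ws (c y) (psi y))"
    using Y(2)
  proof induction
    case empty
    have "psi 0 = 0" using psi_diff[of 0 0] by (simp only: diff_self)
    then show ?case by (simp only: sum.empty)
  next
    case (insert y Y)
    show ?case unfolding sum.insert[OF insert.hyps] psi_add psi_scale insert.IH ..
  qed
  ultimately show ?thesis unfolding Y(1) using Y(3,4) by (simp only:) (intro LW_sum LW_lin(2); blast)
qed

lemma psi_qL: "v \<in> q_multiples L \<Longrightarrow> psi v \<in> mW s"
  unfolding q_multiples_def mW_qq using psi_L psi_scale by blast

lemma tilde_linear: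
  assumes "i \<in> E6_index"
  shows "Vector_Spaces.linear (*s) (*s) (f_tilde i)" "Vector_Spaces.linear (*s) (*s) (e_tilde i)"
  unfolding tilde_eq[OF integrable_module assms]
  using sl2_module.linear_ft[OF sl2_module_V[OF integrable_module assms]] sl2_module.linear_et[OF sl2_module_V[OF integrable_module assms]] by blast+

lemma tilde_L: assumes "i \<in> E6_index" shows "f_tilde i ` L \<subseteq> L" "e_tilde i ` L \<subseteq> L"
  using is_crystal_base assms by (auto simp: crystal_base_def crystal_lattice_def)

lemma tilde_qL:
  assumes "i \<in> E6_index" "v \<in> q_multiples L"
  shows "f_tilde i v \<in> q_multiples L" "e_tilde i v \<in> q_multiples L"
proof -
  obtain w where "w \<in> L" "v = qq *s w" using assms(2) by (auto simp: q_multiples_def)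
  then show "f_tilde i v \<in> q_multiples L" "e_tilde i v \<in> q_multiples L"
    using linear_map_simps(2)[OF tilde_linear(1)[OF assms(1)]] linear_map_simps(2)[OF tilde_linear(2)[OF assms(1)]]
      tilde_L[OF assms(1)] by (auto simp: q_multiples_def)
qed

lemmas coset_eq = coset_eq_iff[OF L_def]
lemmas qL_closed = q_multiples_closed[OF L_def]

lemma induced_tilde:
  assumes "i \<in> E6_index"
  shows "induced L (f_tilde i) (coset L v) = coset L (f_tilde i v)"
    "induced L (e_tilde i) (coset L v) = coset L (e_tilde i v)"
  by (rule induced_coset[OF L_def tilde_linear(1)[OF assms] tilde_L(1)[OF assms]]
      induced_coset[OF L_def tilde_linear(2)[OF assms] tilde_L(2)[OF assms]])+

lemma coset_zero: "coset L v = coset L 0 \<longleftrightarrow> v \<in> q_multiples L"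
  unfolding coset_eq by simp

lemma mem_B: "b \<in> B \<longleftrightarrow> (\<exists>l. set l \<subseteq> E6_index \<and> vf l \<notin> q_multiples L \<and> b = coset L (vf l))"
  unfolding B_def f_strings_vf using coset_zero by auto

lemma mem_B_I: "set l \<subseteq> E6_index \<Longrightarrow> vf l \<notin> q_multiples L \<Longrightarrow> coset L (vf l) \<in> B"
  unfolding mem_B by (intro exI[of _ l]) simp

text \<open>In a crystal base \<open>e\<close> undoes \<open>f\<close>; the statement expresses this for representatives.\<close>

lemma e_f_inverse:
  assumes i: "i \<in> E6_index" and l: "set l \<subseteq> E6_index" and nz: "vf (i # l) \<notin> q_multiples L"
  shows "vf l \<notin> q_multiples L" "e_tilde i (vf (i # l)) - vf l \<in> q_multiples L"
proof -
  show 1: "vf l \<notin> q_multiples L" using tilde_qL(1)[OF i] nz by auto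
  have b: "coset L (vf l) \<in> B" using 1 l mem_B by blast
  have "set (i # l) \<subseteq> E6_index" using i l by simp
  then have b': "coset L (vf (i # l)) \<in> B" using nz mem_B by blast
  have "induced L (f_tilde i) (coset L (vf l)) = coset L (vf (i # l))"
    unfolding induced_tilde[OF i] by simp
  then have "induced L (e_tilde i) (coset L (vf (i # l))) = coset L (vf l)"
    using base_f_e[OF i b b'] by simp
  then show "e_tilde i (vf (i # l)) - vf l \<in> q_multiples L"
    unfolding induced_tilde[OF i] coset_eq .
qed

text \<open>Membership of \<open>v\<close> in \<open>q L\<close> passes to \<open>psi v\<close>. For the converse, which is not evident for an arbitrary
\<open>v \<in> L\<close>, the operator \<open>e\<close> leads back along the path: if \<open>psi (f v)\<close> vanishes modulo \<open>q\<close>, then so does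
\<open>psi (e (f v))\<close>, which is congruent to \<open>psi v\<close>.\<close>

lemma word_fs_None_iff:
  assumes "set l \<subseteq> E6_index" shows "word_fs l uw = None \<longleftrightarrow> vf l \<in> q_multiples L"
proof
  show "word_fs l uw = None" if "vf l \<in> q_multiples L" using psi_qL[OF that] psi_vf_mW[OF assms] by simp
  have "vf l \<notin> q_multiples L \<Longrightarrow> word_fs l uw \<noteq> None"
    using assms
  proof (induction l)
    case (Cons i l)
    have i: "i \<in> E6_index" and l: "set l \<subseteq> E6_index" using Cons.prems by auto
    note inv = e_f_inverse[OF i l Cons.prems(1)]
    have "word_fs l uw \<noteq> None" by (rule Cons.IH[OF inv(1) l])
    then have n: "psi (vf l) \<notin> mW s" using psi_vf_mW[OF l] by simp
    show ?case
    proof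
      assume "word_fs (i # l) uw = None"
      then have "psi (vf (i # l)) \<in> mW s" using psi_vf_mW[OF Cons.prems(2)] by simp
      then have "psi (e_tilde i (vf (i # l))) \<in> mW s" unfolding psi_tilde[OF i] by (rule wet_mW[OF i])
      from mW_lin(3)[OF this psi_qL[OF inv(2)]] have "psi (vf l) \<in> mW s"
        unfolding psi_diff by (simp only: diff_diff_eq2 add_diff_cancel_left')
      then show False using n by simp
    qed
  qed simp
  then show "vf l \<in> q_multiples L" if "word_fs l uw = None" using that by blast
qed

lemma word_fs_rho_height: "set l \<subseteq> E6_index \<Longrightarrow> word_fs l w = Some w' \<Longrightarrow> rho_height (\<lambda>i. ww i w') = rho_height (\<lambda>i. ww i w) - 2 * int (length l)"
proof (induction l arbitrary: w')
  case (Cons i l)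
  then obtain v where v: "word_fs l w = Some v" "word_f i v = Some w'" by (auto simp: bind_eq_Some_conv)
  have i: "i \<in> E6_index" using Cons.prems by simp
  have "rho_height (\<lambda>j. ww j w') = rho_height (\<lambda>j. ww j v - cartan j i)"
    using word_f_weight[OF i _ v(2)] by (intro rho_height_cong)
  then show ?case using Cons.IH[OF _ v(1)] Cons.prems rho_height_step[OF i] by simp
qed simp

lemma psi_e_tilde:
  assumes i: "i \<in> E6_index" and w: "w \<in> Words s" and v: "psi v - basis_vec w \<in> mW s"
  shows "psi (e_tilde i v) - opt_vec (word_e i w) \<in> mW s"
proof -
  have "wet s i (psi v) - wet s i (basis_vec w) \<in> mW s"
    by (rule wet_cong[OF i psi_W basis_vec_W[OF w] v])
  from mW_lin(1)[OF this wft_wet_basis_vec(2)[OF i w]]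
  show ?thesis unfolding psi_tilde[OF i] by (simp only: diff_add_cancel add_diff_eq)
qed

text \<open>Two paths to the same word are compared by stepping back along the first: \<open>e\<^sub>i\<close> takes the class at the
end of the second path to a class whose word is the last but one on the first path. The induction
hypothesis identifies this class, and \<open>f\<^sub>i\<close> restores both ends.\<close>

lemma word_fs_inject:
  assumes "set l \<subseteq> E6_index" "set l' \<subseteq> E6_index" "word_fs l uw = Some w" "word_fs l' uw = Some w"
  shows "vf l - vf l' \<in> q_multiples L"
  using assms
proof (induction l arbitrary: l' w)
  case Nil
  then have "w = uw" by simp
  then have "l' = []" using word_fs_rho_height[OF Nil.prems(2,4)] by simp
  then show ?case using qL_closed(3) by simp
next
  case (Cons i l)
  have i: "i \<in> E6_index" and l: "set l \<subseteq> E6_index" using Cons.prems by auto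
  obtain v where v: "word_fs l uw = Some v" "word_f i v = Some w"
    using Cons.prems(3) by (auto simp: bind_eq_Some_conv)
  have vW: "v \<in> Words s" "w \<in> Words s"
    using word_fs_Words[OF uw_Words l v(1)] word_fs_Words[OF uw_Words Cons.prems(2,4)] by auto
  have ew: "word_e i w = Some v" using word_f_word_e(1)[OF i vW(1) v(2)] by simp
  have nz: "vf l' \<notin> q_multiples L" using word_fs_None_iff[OF Cons.prems(2)] Cons.prems(4) by simp
  have b: "coset L (vf l') \<in> B" using nz Cons.prems(2) mem_B by blast
  have pw: "psi (vf l') - basis_vec w \<in> mW s" using psi_vf[OF Cons.prems(2)] unfolding Cons.prems(4) opt_vec_simps(2) .
  have pe: "psi (e_tilde i (vf l')) - basis_vec v \<in> mW s"
    using psi_e_tilde[OF i vW(2) pw] unfolding ew opt_vec_simps(2) .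
  have "induced L (e_tilde i) (coset L (vf l')) \<in> insert (coset L 0) B"
    by (rule base_e[OF i b])
  moreover have "e_tilde i (vf l') \<notin> q_multiples L"
  proof
    assume "e_tilde i (vf l') \<in> q_multiples L"
    from mW_lin(3)[OF psi_qL[OF this] pe] have "basis_vec v \<in> mW s"
      by (simp only: diff_diff_eq2 add_diff_cancel_left')
    then show False using basis_vec_mW[OF vW(1)] by simp
  qed
  ultimately have b2: "coset L (e_tilde i (vf l')) \<in> B"
    unfolding induced_tilde[OF i] using coset_zero by blast
  then obtain l2 where l2: "set l2 \<subseteq> E6_index" "coset L (e_tilde i (vf l')) = coset L (vf l2)"
    using mem_B by blast
  have q: "e_tilde i (vf l') - vf l2 \<in> q_multiples L" using l2(2) unfolding coset_eq .
  have "opt_vec (word_fs l2 uw) - opt_vec (Some v) \<in> mW s"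
  proof -
    have "(psi (e_tilde i (vf l')) - basis_vec v) - psi (e_tilde i (vf l') - vf l2) - (psi (vf l2) - opt_vec (word_fs l2 uw)) \<in> mW s"
      by (intro mW_lin(3) pe psi_qL q psi_vf l2(1))
    then show ?thesis unfolding psi_diff opt_vec_simps(2) by (simp only: algebra_simps) (simp add: algebra_simps)
  qed
  then have "word_fs l2 uw = Some v" by (rule opt_vec_inject)
  from Cons.IH[OF l l2(1) v(1) this] have d: "vf l - vf l2 \<in> q_multiples L" .
  have "induced L (f_tilde i) (coset L (vf l2)) = coset L (vf l')"
    using base_f_e[OF i b2 b] unfolding induced_tilde(2)[OF i] l2(2) by simp
  then have 1: "f_tilde i (vf l2) - vf l' \<in> q_multiples L" unfolding induced_tilde[OF i] coset_eq .
  have 2: "vf (i # l) - f_tilde i (vf l2) \<in> q_multiples L"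
    using tilde_qL(1)[OF i d] linear_map_simps(4)[OF tilde_linear(1)[OF i]] by simp
  from qL_closed(1)[OF 2 1] show ?case by simp
qed

definition component :: "'a list set" where
  "component = {w. \<exists>l. set l \<subseteq> E6_index \<and> word_fs l uw = Some w}"

definition word_of :: "'v set \<Rightarrow> 'a list" where
  "word_of b = (THE w. \<exists>l. set l \<subseteq> E6_index \<and> b = coset L (vf l) \<and> word_fs l uw = Some w)"

lemma word_of_eq:
  assumes "set l \<subseteq> E6_index" "word_fs l uw = Some w" shows "word_of (coset L (vf l)) = w"
  unfolding word_of_def
proof (rule the_equality)
  show "\<exists>l'. set l' \<subseteq> E6_index \<and> coset L (vf l) = coset L (vf l') \<and> word_fs l' uw = Some w"
    using assms by blast
  fix w' assume "\<exists>l'. set l' \<subseteq> E6_index \<and> coset L (vf l) = coset L (vf l') \<and> word_fs l' uw = Some w'"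
  then obtain l' where l': "set l' \<subseteq> E6_index" "vf l - vf l' \<in> q_multiples L" "word_fs l' uw = Some w'"
    unfolding coset_eq by blast
  have "psi (vf l - vf l') - (psi (vf l) - opt_vec (word_fs l uw)) + (psi (vf l') - opt_vec (word_fs l' uw)) \<in> mW s"
    by (intro mW_lin(1,3) psi_qL l' psi_vf assms)
  then have "opt_vec (word_fs l uw) - opt_vec (word_fs l' uw) \<in> mW s"
    unfolding psi_diff by (simp add: algebra_simps)
  then show "w' = w" using opt_vec_inject assms(2) l'(3) by fastforce
qed

lemma B_cases:
  assumes "b \<in> B"
  obtains l w where "set l \<subseteq> E6_index" "b = coset L (vf l)" "word_fs l uw = Some w" "word_of b = w"
    "vf l \<notin> q_multiples L" "w \<in> Words s"
proof -
  obtain l where l: "set l \<subseteq> E6_index" "vf l \<notin> q_multiples L" "b = coset L (vf l)"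
    using assms mem_B by blast
  then obtain w where "word_fs l uw = Some w" using word_fs_None_iff[OF l(1)] by auto
  then show ?thesis using that l word_of_eq word_fs_Words[OF uw_Words l(1)] by blast
qed

lemma word_of_bij: "bij_betw word_of B component"
  unfolding bij_betw_def
proof
  show "inj_on word_of B"
  proof (rule inj_onI)
    fix b b' assume "b \<in> B" "b' \<in> B" and eq: "word_of b = word_of b'"
    obtain l w where l: "set l \<subseteq> E6_index" "b = coset L (vf l)" "word_fs l uw = Some w" "word_of b = w"
      using B_cases[OF \<open>b \<in> B\<close>] by metis
    obtain l' w' where l': "set l' \<subseteq> E6_index" "b' = coset L (vf l')" "word_fs l' uw = Some w'" "word_of b' = w'"
      using B_cases[OF \<open>b' \<in> B\<close>] by metis
    show "b = b'" unfolding l(2) l'(2) coset_eq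
      using word_fs_inject[OF l(1) l'(1) l(3)] l'(3) eq l(4) l'(4) by simp
  qed
  show "word_of ` B = component"
  proof safe
    fix b assume "b \<in> B"
    then show "word_of b \<in> component" by (rule B_cases) (auto simp: component_def)
  next
    fix w assume "w \<in> component"
    then obtain l where l: "set l \<subseteq> E6_index" "word_fs l uw = Some w" by (auto simp: component_def)
    then have "coset L (vf l) \<in> B" using mem_B_I[OF l(1)] word_fs_None_iff[OF l(1)] by simp
    then show "w \<in> word_of ` B" using word_of_eq[OF l] by force
  qed
qed

lemma word_of_f:
  assumes i: "i \<in> E6_index" and b: "b \<in> B"
  shows "f_op (crystal_of L B) i b \<in> insert None (Some ` B)"
    and "map_option word_of (f_op (crystal_of L B) i b) = word_f i (word_of b)"
proof -
  obtain l w where l: "set l \<subseteq> E6_index" "b = coset L (vf l)" "word_fs l uw = Some w" "word_of b = w"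
    using B_cases[OF b] by metis
  have il: "set (i # l) \<subseteq> E6_index" using i l by simp
  have f: "f_op (crystal_of L B) i b = (if vf (i # l) \<in> q_multiples L then None else Some (coset L (vf (i # l))))"
    unfolding l(2) by (simp add: crystal_of_def class_option_def induced_tilde[OF i] coset_zero)
  have wf: "word_fs (i # l) uw = word_f i w" using l(3) by simp
  show "f_op (crystal_of L B) i b \<in> insert None (Some ` B)"
    unfolding f using mem_B_I[OF il] by simp
  show "map_option word_of (f_op (crystal_of L B) i b) = word_f i (word_of b)"
  proof (cases "vf (i # l) \<in> q_multiples L")
    case True
    then show ?thesis unfolding f l(4) wf[symmetric] using word_fs_None_iff[OF il] by simp
  next
    case False
    then obtain w' where "word_fs (i # l) uw = Some w'" using word_fs_None_iff[OF il] by auto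
    then show ?thesis unfolding f l(4) wf[symmetric] using False word_of_eq[OF il] by simp
  qed
qed

lemma word_of_e:
  assumes i: "i \<in> E6_index" and b: "b \<in> B"
  shows "e_op (crystal_of L B) i b \<in> insert None (Some ` B)"
    and "map_option word_of (e_op (crystal_of L B) i b) = word_e i (word_of b)"
proof -
  obtain l w where l: "set l \<subseteq> E6_index" "b = coset L (vf l)" "word_fs l uw = Some w" "word_of b = w" "w \<in> Words s"
    using B_cases[OF b] by metis
  have e: "e_op (crystal_of L B) i b = (if e_tilde i (vf l) \<in> q_multiples L then None else Some (induced L (e_tilde i) b))"
    unfolding l(2) by (simp add: crystal_of_def class_option_def induced_tilde[OF i] coset_zero)
  have mem: "induced L (e_tilde i) b \<in> insert (coset L 0) B"
    by (rule base_e[OF i b])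
  then have mem': "induced L (e_tilde i) b \<in> B" if "e_tilde i (vf l) \<notin> q_multiples L"
    using that unfolding l(2) induced_tilde[OF i] using coset_zero by auto
  show "e_op (crystal_of L B) i b \<in> insert None (Some ` B)"
    unfolding e using mem' by simp
  show "map_option word_of (e_op (crystal_of L B) i b) = word_e i (word_of b)"
  proof (cases "e_tilde i (vf l) \<in> q_multiples L")
    case True
    have "psi (vf l) - basis_vec w \<in> mW s" using psi_vf[OF l(1)] unfolding l(3) opt_vec_simps(2) .
    from mW_lin(3)[OF psi_qL[OF True] psi_e_tilde[OF i l(5) this]] have "opt_vec (word_e i w) - opt_vec None \<in> mW s"
      unfolding opt_vec_simps(1) by (simp only: diff_diff_eq2 add_diff_cancel_left' diff_zero)
    then have "word_e i w = None" by (rule opt_vec_inject)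
    then show ?thesis unfolding e l(4) using True by simp
  next
    case False
    let ?b = "induced L (e_tilde i) b"
    have b': "?b \<in> B" by (rule mem'[OF False])
    have "induced L (f_tilde i) ?b = b"
      using base_f_e[OF i b' b] by simp
    moreover have "b \<noteq> coset L 0" using b by (auto simp: B_def)
    ultimately have "f_op (crystal_of L B) i ?b = Some b"
      by (simp add: crystal_of_def class_option_def)
    then have "word_f i (word_of ?b) = Some w" using word_of_f(2)[OF i b'] l(4) by simp
    moreover have "word_of ?b \<in> Words s" using B_cases[OF b'] by metis
    ultimately have "word_e i w = Some (word_of ?b)" using word_f_word_e(1)[OF i] by blast
    then show ?thesis unfolding e l(4) using False by simp
  qed
qed

text \<open>The coefficient of \<open>psi v\<close> at the word of \<open>v\<close> is congruent to one, hence nonzero, so the weight of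
\<open>v\<close> is the weight of this word.\<close>

lemma word_of_weight:
  assumes i: "i \<in> E6_index" and b: "b \<in> B"
  shows "wt (crystal_of L B) i b = ww i (word_of b)"
proof -
  obtain l w where l: "set l \<subseteq> E6_index" "b = coset L (vf l)" "word_fs l uw = Some w" "word_of b = w" "w \<in> Words s"
    using B_cases[OF b] by metis
  have unique: "\<nu> i = ww i w" if v: "v \<in> b" "v \<in> weight_space \<nu>" for v \<nu>
  proof -
    have "v - vf l \<in> q_multiples L" using v(1) unfolding l(2) mem_coset[OF L_def] .
    from mW_lin(1)[OF psi_qL[OF this] psi_vf[OF l(1)]] have "psi v - basis_vec w \<in> mW s"
      unfolding psi_diff l(3) opt_vec_simps(2) by (simp only: diff_add_cancel add_diff_eq)
    then have "(psi v - basis_vec w) w \<in> m0" by (simp add: mW_def)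
    then have nz: "psi v w \<noteq> 0" using one_notin_m0 m0_uminus[of "-1"] by (auto simp: basis_vec_apply)
    have "K i v = (qq powi \<nu> i) *s v" using v(2) i by (simp add: weight_space_def)
    then have "Kop i (psi v) = ws (qq powi \<nu> i) (psi v)" using psi_K[OF i] psi_scale by metis
    then show ?thesis unfolding Kop_eigen using nz by auto
  qed
  obtain \<nu> where "b \<inter> weight_space \<nu> \<noteq> {}" using base_weight[OF b] by blast
  then have "class_weight i b = ww i w"
    unfolding class_weight_def using unique by (intro the_equality) blast+
  then show ?thesis using l(4) by (simp add: crystal_of_def)
qed

end

section \<open>Standard words\<close>

text \<open>Letters are ordered by their depths \<open>dp\<close>, the multiplicities of the simple roots that have been
subtracted from the highest weight \<open>lam\<close>.\<close>

locale graded_letters = letter_crystal X fl el wl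
  for X :: "'a set" and fl el :: "nat \<Rightarrow> 'a \<Rightarrow> 'a option" and wl :: "nat \<Rightarrow> 'a \<Rightarrow> int" +
  fixes dp :: "nat \<Rightarrow> 'a \<Rightarrow> int" and lam :: "nat \<Rightarrow> int"
  assumes dp_fl: "\<lbrakk>i \<in> E6_index; j \<in> E6_index; fl i a = Some b\<rbrakk> \<Longrightarrow> dp j b = dp j a + (if j = i then 1 else 0)"
    and dp_nonneg: "\<lbrakk>a \<in> X; j \<in> E6_index\<rbrakk> \<Longrightarrow> 0 \<le> dp j a"
    and wl_dp: "\<lbrakk>a \<in> X; i \<in> E6_index\<rbrakk> \<Longrightarrow> wl i a = lam i - (\<Sum>j\<in>E6_index. cartan i j * dp j a)"
    and dp_inj: "\<lbrakk>a \<in> X; b \<in> X; \<And>j. j \<in> E6_index \<Longrightarrow> dp j a = dp j b\<rbrakk> \<Longrightarrow> a = b"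
begin

definition geq :: "'a \<Rightarrow> 'a \<Rightarrow> bool" where
  "geq a b \<longleftrightarrow> (\<forall>j\<in>E6_index. dp j b \<le> dp j a)"

lemma geq_refl: "geq a a" by (simp add: geq_def)

lemma geq_trans: "geq a b \<Longrightarrow> geq b c \<Longrightarrow> geq a c"
  by (force simp: geq_def)

lemma geq_antisym: "a \<in> X \<Longrightarrow> b \<in> X \<Longrightarrow> geq a b \<Longrightarrow> geq b a \<Longrightarrow> a = b"
  by (rule dp_inj) (auto simp: geq_def intro: antisym)

lemma transp_geq: "transp geq"
  using geq_trans by (auto intro: transpI)

text \<open>Off-diagonal Cartan integers are not positive. If the \<open>i\<close>-th depths agreed, the larger depths of
\<open>a\<close> at the neighbours of \<open>i\<close> would give \<open>a\<close> the larger weight.\<close>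

lemma lifting:
  assumes "a \<in> X" "b \<in> X" "geq a b" "i \<in> E6_index" "wl i a < wl i b"
  shows "dp i b < dp i a"
proof (rule ccontr)
  assume "\<not> ?thesis"
  then have e: "dp i a = dp i b" using assms(3,4) by (force simp: geq_def)
  have "wl i b - wl i a = (\<Sum>j\<in>E6_index. cartan i j * dp j a) - (\<Sum>j\<in>E6_index. cartan i j * dp j b)"
    using wl_dp assms by simp
  also have "\<dots> = (\<Sum>j\<in>E6_index. cartan i j * (dp j a - dp j b))"
    by (simp add: sum_subtractf right_diff_distrib)
  also have "\<dots> \<le> 0"
  proof (rule sum_nonpos)
    fix j assume j: "j \<in> E6_index"
    have d: "0 \<le> dp j a - dp j b" using assms(3) j by (simp add: geq_def)
    show "cartan i j * (dp j a - dp j b) \<le> 0"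
    proof (cases "i = j")
      case False
      then have "cartan i j \<le> 0" by (simp add: cartan_def)
      then show ?thesis using d by (rule mult_nonpos_nonneg)
    qed (use e in simp)
  qed
  finally show False using assms(5) by simp
qed

lemma el_facts:
  assumes "i \<in> E6_index" "el i a = Some b"
  shows "fl i b = Some a" "\<And>j. j \<in> E6_index \<Longrightarrow> dp j b = dp j a - (if j = i then 1 else 0)" "a \<in> X \<longleftrightarrow> b \<in> X"
proof -
  show f: "fl i b = Some a" using assms by (simp add: fl_el)
  show "dp j b = dp j a - (if j = i then 1 else 0)" if "j \<in> E6_index" for j
    using dp_fl[OF assms(1) that f] by simp
  show "a \<in> X \<longleftrightarrow> b \<in> X" using fl_X[OF assms(1) f] by simp
qed

text \<open>The leftmost letter is the deepest one.\<close>

definition standard :: "nat \<Rightarrow> 'a list set" where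
  "standard s = {w \<in> Words s. sorted_wrt geq w}"

lemma standard_Words: "w \<in> standard s \<Longrightarrow> w \<in> Words s" by (simp add: standard_def)

text \<open>The operator could break the order only by deepening a letter \<open>c\<close> behind a letter \<open>a\<close>. The
signature rule then excludes an outgoing arrow at \<open>a\<close>, so \<open>a\<close> has smaller weight than \<open>c\<close> and is
strictly deeper by the lifting property.\<close>

lemma word_f_sorted:
  assumes i: "i \<in> E6_index"
  shows "set w \<subseteq> X \<Longrightarrow> successively geq w \<Longrightarrow> word_f i w = Some w' \<Longrightarrow> successively geq w'"
proof (induction w arbitrary: w')
  case (Cons a w)
  have a: "a \<in> X" and w: "set w \<subseteq> X" "successively geq w" using Cons.prems by (auto simp: successively_Cons)
  show ?case
  proof (cases "fl i a \<noteq> None \<and> word_eps i w = 0")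
    case True
    then obtain b where b: "fl i a = Some b" "w' = b # w" using Cons.prems(3) by auto
    have "geq b a" using dp_fl[OF i _ b(1)] by (simp add: geq_def)
    then show ?thesis using Cons.prems(2) b(2) geq_trans by (auto simp: successively_Cons)
  next
    case False
    then obtain w1 where w1: "word_f i w = Some w1" "w' = a # w1" using Cons.prems(3) by (auto split: if_splits)
    have IH: "successively geq w1" by (rule Cons.IH[OF w w1(1)])
    obtain c v where cv: "w = c # v" using w1(1) by (cases w) auto
    have ac: "geq a c" and c: "c \<in> X" using Cons.prems(1,2) cv by auto
    have "geq a (hd w1)"
    proof (cases "fl i c \<noteq> None \<and> word_eps i v = 0")
      case True
      then obtain d where d: "fl i c = Some d" "w1 = d # v" using w1(1) cv by auto
      \<comment> \<open>The arrow at \<open>c\<close> is applied, so all incoming arrows of \<open>w\<close> are cancelled, and an outgoing arrow at \<open>a\<close> would have priority.\<close>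
      have "word_eps i w = 0" using True cv by auto
      then have "fl i a = None" using False by simp
      then have "wl i a < wl i c"
        using fl_wl[OF i a] fl_wl[OF i c] wl_bound[OF i a] d(1) by auto
      then have "dp i c < dp i a" by (rule lifting[OF a c ac i])
      then show ?thesis using ac dp_fl[OF i _ d(1)] d(2) by (auto simp: geq_def)
    next
      case False
      then obtain v1 where "w1 = c # v1" using w1(1) cv by (auto split: if_splits)
      then show ?thesis using ac by simp
    qed
    then show ?thesis using IH w1(2) by (auto simp: successively_Cons)
  qed
qed simp

lemma word_e_sorted:
  assumes i: "i \<in> E6_index"
  shows "set w \<subseteq> X \<Longrightarrow> successively geq w \<Longrightarrow> word_e i w = Some w' \<Longrightarrow> successively geq w'"
proof (induction w arbitrary: w')
  case (Cons a w)
  have a: "a \<in> X" and w: "set w \<subseteq> X" "successively geq w" using Cons.prems by (auto simp: successively_Cons)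
  show ?case
  proof (cases "word_eps i w = 0")
    case True
    then obtain b where b: "el i a = Some b" "w' = b # w" using Cons.prems(3) by auto
    show ?thesis
    proof (cases w)
      case (Cons c v)
      have ac: "geq a c" and c: "c \<in> X" using Cons.prems(1,2) Cons by auto
      have "el i c = None"
      proof (cases "fl i c = None")
        case True
        then show ?thesis using \<open>word_eps i w = 0\<close> Cons by (auto split: if_splits)
      next
        case False
        then show ?thesis using fl_wl[OF i c] el_wl[OF i c] by auto
      qed
      then have "wl i a < wl i c" using b(1) el_wl[OF i a] el_wl[OF i c] wl_bound[OF i c] by auto
      then have "dp i c < dp i a" by (rule lifting[OF a c ac i])
      then have "geq b c" using ac el_facts(2)[OF i b(1)] by (auto simp: geq_def)
      then show ?thesis using w(2) b(2) Cons by simp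
    qed (simp add: b(2))
  next
    case False
    then obtain w1 where w1: "word_e i w = Some w1" "w' = a # w1" using Cons.prems(3) by (auto split: if_splits)
    have IH: "successively geq w1" by (rule Cons.IH[OF w w1(1)])
    obtain c v where cv: "w = c # v" using w1(1) by (cases w) auto
    have ac: "geq a c" using Cons.prems(2) cv by auto
    have "geq a (hd w1)"
    proof (cases "word_eps i v = 0")
      case True
      then obtain d where d: "el i c = Some d" "w1 = d # v" using w1(1) cv by auto
      have "geq c d" using el_facts(2)[OF i d(1)] by (simp add: geq_def)
      then show ?thesis using ac geq_trans d(2) by auto
    next
      case False
      then obtain v1 where "w1 = c # v1" using w1(1) cv by (auto split: if_splits)
      then show ?thesis using ac by simp
    qed
    then show ?thesis using IH w1(2) by (auto simp: successively_Cons)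
  qed
qed simp

lemma standard_closed:
  assumes "i \<in> E6_index" "w \<in> standard s"
  shows "word_f i w = Some w' \<Longrightarrow> w' \<in> standard s" "word_e i w = Some w' \<Longrightarrow> w' \<in> standard s"
proof -
  have w: "w \<in> Words s" "set w \<subseteq> X" "successively geq w"
    using assms(2) by (auto simp: standard_def Words_def successively_conv_sorted_wrt[OF transp_geq])
  show "w' \<in> standard s" if "word_f i w = Some w'"
    using word_f_word_e(1)[OF assms(1) w(1) that] word_f_sorted[OF assms(1) w(2,3) that]
    by (simp add: standard_def successively_conv_sorted_wrt[OF transp_geq])
  show "w' \<in> standard s" if "word_e i w = Some w'"
    using word_f_word_e(2)[OF assms(1) w(1) that] word_e_sorted[OF assms(1) w(2,3) that]
    by (simp add: standard_def successively_conv_sorted_wrt[OF transp_geq])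
qed

lemma word_fs_standard:
  assumes "w \<in> standard s" "set l \<subseteq> E6_index" "word_fs l w = Some w'" shows "w' \<in> standard s"
  using assms(2,3)
proof (induction l arbitrary: w')
  case (Cons i l)
  then obtain v where "word_fs l w = Some v" "word_f i v = Some w'" by (auto simp: bind_eq_Some_conv)
  then show ?case using Cons standard_closed(1) by auto
qed (use assms in simp)

definition highest_letters :: "nat set \<Rightarrow> 'a set" where
  "highest_letters J = {a \<in> X. \<forall>j\<in>J. el j a = None}"

lemma word_eps_zero: "(\<And>a. a \<in> set w \<Longrightarrow> el j a = None) \<Longrightarrow> word_eps j w = 0"
  by (induction w) auto

text \<open>A word can be highest although some letter is not, because an outgoing arrow at an earlier letter
cancels an incoming one at a later letter. Here this does not happen: an earlier letter with an
outgoing arrow of colour \<open>j\<close> has depth 0 at \<open>j\<close>, and so have all later letters, which therefore have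
no incoming arrow of this colour.\<close>

lemma standard_highest:
  assumes J: "J \<subseteq> E6_index"
    and top: "\<And>a j. a \<in> highest_letters J \<Longrightarrow> j \<in> J \<Longrightarrow> wl j a = 1 \<Longrightarrow> dp j a = 0"
    and w: "w \<in> standard s"
  shows "(\<forall>j\<in>J. word_e j w = None) \<longleftrightarrow> set w \<subseteq> highest_letters J"
proof -
  have W: "w \<in> Words s" "set w \<subseteq> X" "sorted_wrt geq w" using w by (auto simp: standard_def Words_def)
  have "(\<forall>j\<in>J. word_e j w = None) \<longleftrightarrow> (\<forall>j\<in>J. word_eps j w = 0)"
    using word_f_word_e(3)[OF _ W(1)] J by blast
  also have "\<dots> \<longleftrightarrow> set w \<subseteq> highest_letters J"
  proof
    show "\<forall>j\<in>J. word_eps j w = 0" if "set w \<subseteq> highest_letters J"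
      using that by (auto simp: highest_letters_def intro!: word_eps_zero)
    have "set w \<subseteq> X \<Longrightarrow> sorted_wrt geq w \<Longrightarrow> \<forall>j\<in>J. word_eps j w = 0 \<Longrightarrow> set w \<subseteq> highest_letters J"
    proof (induction w)
      case (Cons a w)
      have a: "a \<in> X" using Cons.prems by simp
      have "el j a = None" if j: "j \<in> J" for j
      \<comment> \<open>An outgoing arrow at \<open>a\<close> and an incoming one exclude each other.\<close>
      proof (cases "fl j a = None")
        case True
        then show ?thesis using Cons.prems(3) j by (force split: if_splits)
      next
        case False
        then show ?thesis using fl_wl[of j a] el_wl[of j a] a j J by auto
      qed
      then have ha: "a \<in> highest_letters J" using a by (simp add: highest_letters_def)
      have "word_eps j w = 0" if j: "j \<in> J" for j
      proof (cases "fl j a = None")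
        case True
        then show ?thesis using Cons.prems(3) j \<open>\<And>j. j \<in> J \<Longrightarrow> el j a = None\<close>[OF j] by (metis word_eps.simps(2))
      next
        case False
        have jE: "j \<in> E6_index" using j J by auto
        have "wl j a = 1" using False fl_wl[OF jE a] by simp
        then have d0: "dp j a = 0" by (rule top[OF ha j])
        have "el j c = None" if c: "c \<in> set w" for c
        proof (rule ccontr)
          assume "el j c \<noteq> None"
          then obtain b where b: "el j c = Some b" by auto
          have cX: "c \<in> X" using c Cons.prems(1) by auto
          have "geq a c" using Cons.prems(2) c by simp
          then have "dp j c \<le> 0" using d0 jE by (force simp: geq_def)
          then have "dp j b < 0" using el_facts(2)[OF jE b jE] by simp
          moreover have "b \<in> X" using el_facts(3)[OF jE b] cX by simp
          ultimately show False using dp_nonneg[OF _ jE, of b] by simp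
        qed
        then show ?thesis by (rule word_eps_zero)
      qed
      then show ?case using Cons ha by simp
    qed simp
    then show "set w \<subseteq> highest_letters J" if "\<forall>j\<in>J. word_eps j w = 0" using W that by blast
  qed
  finally show ?thesis .
qed

definition depth :: "'a list \<Rightarrow> int" where
  "depth w = (\<Sum>a\<leftarrow>w. \<Sum>j\<in>E6_index. dp j a)"

lemma finite_E6: "finite E6_index" by (simp add: E6_index_def)

lemma word_f_depth:
  assumes i: "i \<in> E6_index" shows "word_f i w = Some w' \<Longrightarrow> depth w' = depth w + 1"
proof (induction w arbitrary: w')
  case (Cons a w)
  show ?case
  proof (cases "fl i a \<noteq> None \<and> word_eps i w = 0")
    case True
    then obtain b where b: "fl i a = Some b" "w' = b # w" using Cons.prems by auto
    have "(\<Sum>j\<in>E6_index. dp j b) = (\<Sum>j\<in>E6_index. dp j a + (if j = i then 1 else 0))"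
      using dp_fl[OF i _ b(1)] by (intro sum.cong) auto
    also have "\<dots> = (\<Sum>j\<in>E6_index. dp j a) + 1" using i finite_E6 by (simp add: sum.distrib)
    finally show ?thesis using b(2) by (simp add: depth_def)
  next
    case False
    then obtain w1 where w1: "word_f i w = Some w1" "w' = a # w1" using Cons.prems by (auto split: if_splits)
    then show ?thesis using Cons.IH[OF w1(1)] by (simp add: depth_def)
  qed
qed simp

lemma depth_nonneg: "w \<in> Words s \<Longrightarrow> 0 \<le> depth w"
  unfolding depth_def Words_def by (auto intro!: sum_list_nonneg sum_nonneg dp_nonneg)

lemma word_e_depth:
  assumes "i \<in> E6_index" "w \<in> Words s" "word_e i w = Some w'" shows "depth w = depth w' + 1"
  using word_f_word_e(2)[OF assms] word_f_depth[OF assms(1)] by blast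

text \<open>Every operator \<open>e\<close> decreases the depth, so a highest word is reached after finitely many steps.\<close>

lemma climb:
  assumes J: "J \<subseteq> E6_index" and w: "w \<in> standard s"
  shows "\<exists>l x. set l \<subseteq> J \<and> x \<in> standard s \<and> word_fs l x = Some w \<and> (\<forall>j\<in>J. word_e j x = None)"
  using w
proof (induction "nat (depth w)" arbitrary: w rule: less_induct)
  case less
  show ?case
  proof (cases "\<forall>j\<in>J. word_e j w = None")
    case True
    then show ?thesis using less.prems by (intro exI[of _ "[]"] exI[of _ w]) simp
  next
    case False
    then obtain j v where jv: "j \<in> J" "word_e j w = Some v" by auto
    have j: "j \<in> E6_index" using jv J by auto
    have W: "w \<in> Words s" by (rule standard_Words[OF less.prems])
    have v: "v \<in> standard s" using standard_closed(2)[OF j less.prems jv(2)] .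
    have "depth w = depth v + 1" by (rule word_e_depth[OF j W jv(2)])
    then have "nat (depth v) < nat (depth w)" using depth_nonneg[OF standard_Words[OF v]] by simp
    from less.hyps[OF this v] obtain l x where l: "set l \<subseteq> J" "x \<in> standard s" "word_fs l x = Some v"
      "\<forall>j\<in>J. word_e j x = None" by blast
    have "word_fs (j # l) x = Some w" using l(3) word_f_word_e(2)[OF j W jv(2)] by simp
    then show ?thesis using l jv(1) by (intro exI[of _ "j # l"] exI[of _ x]) simp
  qed
qed

lemma word_fs_weight:
  assumes "set l \<subseteq> E6_index" "i \<in> E6_index" "word_fs l w = Some w'"
  shows "ww i w' = ww i w - (\<Sum>j\<leftarrow>l. cartan i j)"
  using assms(1,3)
proof (induction l arbitrary: w')
  case (Cons j l)
  then obtain v where v: "word_fs l w = Some v" "word_f j v = Some w'" by (auto simp: bind_eq_Some_conv)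
  then show ?case using Cons word_f_weight[OF _ assms(2) v(2)] by auto
qed simp

lemma sorted_unique:
  "set w \<subseteq> X \<Longrightarrow> sorted_wrt geq w \<Longrightarrow> sorted_wrt geq w' \<Longrightarrow> mset w = mset w' \<Longrightarrow> w = w'"
proof (induction w arbitrary: w')
  case (Cons a w)
  obtain b v where bv: "w' = b # v" using Cons.prems(4) by (cases w') auto
  have sets: "set (a # w) = set w'" using Cons.prems(4) by (rule mset_eq_setD)
  have "b \<in> set (a # w)" unfolding sets bv by simp
  then have "geq a b" using Cons.prems(2) geq_refl by auto
  moreover have "a \<in> set w'" unfolding sets[symmetric] by simp
  then have "geq b a" using Cons.prems(3) bv geq_refl by auto
  ultimately have "a = b" using Cons.prems(1) sets bv by (intro geq_antisym) auto
  then show ?case using Cons bv by auto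
qed simp

end

section \<open>The twisted isomorphism on words\<close>

context letter_crystal
begin

definition awl :: "nat \<Rightarrow> 'a \<Rightarrow> int" where
  "awl i a = (if i = 0 then - (wl 1 a + wl 6 a + 2 * (wl 2 a + wl 3 a + wl 5 a) + 3 * wl 4 a) else wl i a)"

definition aww :: "nat \<Rightarrow> 'a list \<Rightarrow> int" where
  "aww i w = (if i = 0 then - (ww 1 w + ww 6 w + 2 * (ww 2 w + ww 3 w + ww 5 w) + 3 * ww 4 w) else ww i w)"

lemma aww_sum: "aww i w = (\<Sum>a\<leftarrow>w. awl i a)"
  by (induction w) (auto simp: aww_def awl_def)

end

definition J_left :: "nat set" where "J_left = {1..5}"
definition J_right :: "nat set" where "J_right = {2..6}"

lemma J_left_cases: "i \<in> J_left \<longleftrightarrow> i = 1 \<or> i = 2 \<or> i = 3 \<or> i = 4 \<or> i = 5"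
  and J_right_cases: "i \<in> J_right \<longleftrightarrow> i = 2 \<or> i = 3 \<or> i = 4 \<or> i = 5 \<or> i = 6"
  by (auto simp: J_left_def J_right_def)

lemma J_E6: "J_left \<subseteq> E6_index" "J_right \<subseteq> E6_index"
  by (auto simp: J_left_def J_right_def E6_index_def)

lemma pdot_J: "pdot ` J_left = J_right" "i \<in> J_left \<Longrightarrow> pdot i \<in> J_right" "i \<in> J_left \<Longrightarrow> pdot i \<in> E6_index"
proof -
  show 1: "pdot ` J_left = J_right"
  proof -
    have J: "J_left = {1, 2, 3, 4, 5}" "J_right = {2, 3, 4, 5, 6}" by (auto simp: J_left_cases J_right_cases)
    have p: "pdot 1 = 6" "pdot 2 = 3" "pdot 3 = 5" "pdot 4 = 4" "pdot 5 = 2" by (simp_all add: pdot_def)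
    show ?thesis unfolding J image_insert image_empty p by auto
  qed
  show "i \<in> J_left \<Longrightarrow> pdot i \<in> J_right" using 1 by blast
  then show "i \<in> J_left \<Longrightarrow> pdot i \<in> E6_index" using J_E6 by blast
qed

lemma list_preimage: "set y \<subseteq> f ` A \<Longrightarrow> \<exists>z. y = map f z \<and> set z \<subseteq> A"
proof (induction y)
  case (Cons b y)
  then obtain a z where "b = f a" "a \<in> A" "y = map f z" "set z \<subseteq> A" by auto
  then show ?case by (intro exI[of _ "a # z"]) simp
qed simp

text \<open>The map \<open>p1\<close> is the action of the diagram automorphism on the weights of the letters. It reverses the
order of the highest weight letters of the two subdiagrams of type \<open>D\<^sub>5\<close>. The conditions
\<open>left_top\<close> and \<open>right_top\<close> are those of \<open>standard_highest\<close>, and \<open>right_letters\<close> says that two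
coordinates of the weight tell the three highest weight letters apart.\<close>

locale twisted_letters = graded_letters X fl el wl dp lam
  for X :: "'a set" and fl el :: "nat \<Rightarrow> 'a \<Rightarrow> 'a option" and wl :: "nat \<Rightarrow> 'a \<Rightarrow> int" and dp lam +
  fixes p1 :: "'a \<Rightarrow> 'a"
  assumes p1_bij: "bij_betw p1 X X"
    and p1_fl: "\<lbrakk>i \<in> J_left; a \<in> X\<rbrakk> \<Longrightarrow> fl (pdot i) (p1 a) = map_option p1 (fl i a)"
    and p1_el: "\<lbrakk>i \<in> J_left; a \<in> X\<rbrakk> \<Longrightarrow> el (pdot i) (p1 a) = map_option p1 (el i a)"
    and p1_awl: "\<lbrakk>i \<in> aff_index; a \<in> X\<rbrakk> \<Longrightarrow> awl (pdot i) (p1 a) = awl i a"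
    and p1_reverse: "\<lbrakk>a \<in> highest_letters J_left; b \<in> highest_letters J_left\<rbrakk> \<Longrightarrow> geq a b \<longleftrightarrow> geq (p1 b) (p1 a)"
    and left_top: "\<lbrakk>a \<in> highest_letters J_left; j \<in> J_left; wl j a = 1\<rbrakk> \<Longrightarrow> dp j a = 0"
    and right_top: "\<lbrakk>a \<in> highest_letters J_right; j \<in> J_right; wl j a = 1\<rbrakk> \<Longrightarrow> dp j a = 0"
    and right_letters: "\<exists>a b c i j. i \<in> E6_index \<and> j \<in> E6_index \<and> b \<noteq> c \<and> a \<noteq> b \<and> a \<noteq> c \<and> highest_letters J_right = {a, b, c} \<and>
      (\<forall>d\<in>{a, b, c}. wl i d = (if d = b then 1 else 0) \<and> wl j d = (if d = c then 1 else 0))"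
begin

lemma p1_X: "a \<in> X \<Longrightarrow> p1 a \<in> X" using p1_bij by (auto simp: bij_betw_def)

lemma highest_letters_X: "highest_letters J \<subseteq> X" by (auto simp: highest_letters_def)

lemma p1_highest: "p1 ` highest_letters J_left = highest_letters J_right"
proof -
  have "p1 a \<in> highest_letters J_right \<longleftrightarrow> a \<in> highest_letters J_left" if "a \<in> X" for a
    using that p1_X p1_el unfolding highest_letters_def pdot_J(1)[symmetric] by auto
  note iff = this
  have X: "p1 ` X = X" using p1_bij by (simp add: bij_betw_def)
  show ?thesis
  proof
    show "p1 ` highest_letters J_left \<subseteq> highest_letters J_right"
      using iff highest_letters_X by blast
    show "highest_letters J_right \<subseteq> p1 ` highest_letters J_left"
    proof
      fix b assume b: "b \<in> highest_letters J_right"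
      then have "b \<in> p1 ` X" using X highest_letters_X by blast
      then obtain a where "a \<in> X" "b = p1 a" by blast
      then show "b \<in> p1 ` highest_letters J_left" using iff b by blast
    qed
  qed
qed

lemma map_p1_word_f:
  assumes i: "i \<in> J_left" and "set w \<subseteq> X"
  shows "word_eps (pdot i) (map p1 w) = word_eps i w"
    and "word_f (pdot i) (map p1 w) = map_option (map p1) (word_f i w)"
  using assms(2) by (induction w) (auto simp: p1_fl[OF i] p1_el[OF i] option.map_comp comp_def)

lemma map_p1_word_fs:
  assumes "set l \<subseteq> J_left" "w \<in> Words s"
  shows "word_fs (map pdot l) (map p1 w) = map_option (map p1) (word_fs l w)"
  using assms(1)
proof (induction l)
  case (Cons i l)
  have l: "set l \<subseteq> E6_index" using Cons.prems J_E6 by auto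
  show ?case
  proof (cases "word_fs l w")
    case (Some v)
    then have "set v \<subseteq> X" using word_fs_Words[OF assms(2) l Some] by (simp add: Words_def)
    then show ?thesis using Cons Some map_p1_word_f(2)[of i v] by simp
  qed (use Cons in simp)
qed simp

lemma map_p1_aww: "set w \<subseteq> X \<Longrightarrow> i \<in> aff_index \<Longrightarrow> aww (pdot i) (map p1 w) = aww i w"
  unfolding aww_sum by (induction w) (auto simp: p1_awl)

definition left_highest :: "nat \<Rightarrow> 'a list set" where
  "left_highest s = {x \<in> standard s. set x \<subseteq> highest_letters J_left}"
definition right_highest :: "nat \<Rightarrow> 'a list set" where
  "right_highest s = {x \<in> standard s. set x \<subseteq> highest_letters J_right}"

text \<open>The twist of letters turns a chain of highest weight letters upside down, so a word has to be reversed
to remain standard.\<close>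

lemma reversal: "bij_betw (\<lambda>x. map p1 (rev x)) (left_highest s) (right_highest s)"
proof -
  have inj: "inj_on p1 X" using p1_bij by (simp add: bij_betw_def)
  have sorted: "sorted_wrt geq (map p1 (rev x)) \<longleftrightarrow> sorted_wrt geq x" if x: "set x \<subseteq> highest_letters J_left" for x
  proof -
    have "sorted_wrt geq (map p1 (rev x)) \<longleftrightarrow> sorted_wrt (\<lambda>a b. geq (p1 b) (p1 a)) x"
      by (simp add: sorted_wrt_map sorted_wrt_rev)
    also have "\<dots> \<longleftrightarrow> sorted_wrt geq x"
      using x
    proof (induction x)
      case (Cons a x)
      then have "(\<forall>b\<in>set x. geq (p1 b) (p1 a)) \<longleftrightarrow> (\<forall>b\<in>set x. geq a b)"
        using p1_reverse[of a] by (intro ball_cong) auto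
      then show ?case using Cons by simp
    qed simp
    finally show ?thesis .
  qed
  have "map p1 (rev x) \<in> right_highest s" if "x \<in> left_highest s" for x
  proof -
    have "set x \<subseteq> highest_letters J_left" using that by (simp add: left_highest_def)
    then have "set (map p1 (rev x)) \<subseteq> highest_letters J_right" unfolding p1_highest[symmetric] by auto
    moreover from this have "set (map p1 (rev x)) \<subseteq> X" using highest_letters_X by blast
    ultimately show ?thesis using that sorted[of x]
      by (simp add: left_highest_def right_highest_def standard_def Words_def)
  qed
  moreover have "\<exists>x\<in>left_highest s. y = map p1 (rev x)" if y: "y \<in> right_highest s" for y
  proof -
    have "set y \<subseteq> p1 ` highest_letters J_left" using y p1_highest by (simp add: right_highest_def)
    from list_preimage[OF this] obtain z where z: "y = map p1 z" "set z \<subseteq> highest_letters J_left"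
      by blast
    have "rev z \<in> left_highest s"
      using y z sorted[of "rev z"] subset_trans[OF z(2) highest_letters_X[of J_left]]
      by (simp add: left_highest_def right_highest_def standard_def Words_def)
    then show ?thesis using z(1) by (intro bexI[of _ "rev z"]) simp
  qed
  moreover have "inj_on (\<lambda>x. map p1 (rev x)) (left_highest s)"
  proof (rule inj_onI)
    fix x y assume "x \<in> left_highest s" "y \<in> left_highest s" "map p1 (rev x) = map p1 (rev y)"
    moreover from this have "inj_on p1 (set (rev x) \<union> set (rev y))"
      using highest_letters_X[of J_left] by (intro inj_on_subset[OF inj]) (auto simp: left_highest_def)
    ultimately have "rev x = rev y" using map_inj_on by blast
    then show "x = y" by simp
  qed
  ultimately show ?thesis unfolding bij_betw_def by blast
qed

text \<open>Two coordinates of the weight count the occurrences of two of the three letters, and the length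
gives the number of occurrences of the third. A standard word is determined by these numbers.\<close>

lemma right_highest_unique:
  assumes "x \<in> right_highest s" "y \<in> right_highest s" "\<And>i. i \<in> E6_index \<Longrightarrow> ww i x = ww i y"
  shows "x = y"
proof -
  obtain a b c i j where abc: "i \<in> E6_index" "j \<in> E6_index" "b \<noteq> c" "a \<noteq> b" "a \<noteq> c" "highest_letters J_right = {a, b, c}"
    "\<forall>d\<in>{a, b, c}. wl i d = (if d = b then 1 else 0) \<and> wl j d = (if d = c then 1 else 0)"
    using right_letters by blast
  have cnt: "int (count (mset z) b) = ww i z \<and> int (count (mset z) c) = ww j z \<and>
      count (mset z) a + count (mset z) b + count (mset z) c = length z" if "set z \<subseteq> {a, b, c}" for z
    using that
  proof (induction z)
    case (Cons d z)
    then have "d = a \<or> d = b \<or> d = c" by auto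
    then show ?case using Cons abc(3,4,5,7) by auto
  qed simp
  have sets: "set x \<subseteq> {a, b, c}" "set y \<subseteq> {a, b, c}" and len: "length x = s" "length y = s"
    using assms(1,2) abc(6) by (auto simp: right_highest_def standard_def Words_def)
  have "count (mset x) d = count (mset y) d" for d
  proof (cases "d \<in> {a, b, c}")
    case True
    then show ?thesis using cnt[OF sets(1)] cnt[OF sets(2)] assms(3)[OF abc(1)] assms(3)[OF abc(2)] len by auto
  next
    case False
    then have "d \<notin> set x" "d \<notin> set y" using sets by auto
    then have "count (mset x) d = 0" "count (mset y) d = 0" by (simp_all add: count_eq_zero_iff)
    then show ?thesis by (simp only:)
  qed
  then have "mset x = mset y" by (rule multiset_eqI)
  then show ?thesis using assms(1,2)
    by (intro sorted_unique) (auto simp: right_highest_def standard_def Words_def)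
qed

lemma left_highest_iff: "x \<in> left_highest s \<longleftrightarrow> x \<in> standard s \<and> (\<forall>j\<in>J_left. word_e j x = None)"
proof -
  have "x \<in> standard s \<Longrightarrow> (\<forall>j\<in>J_left. word_e j x = None) \<longleftrightarrow> set x \<subseteq> highest_letters J_left"
    by (rule standard_highest[OF J_E6(1) left_top])
  then show ?thesis unfolding left_highest_def by blast
qed

lemma right_highest_iff: "x \<in> right_highest s \<longleftrightarrow> x \<in> standard s \<and> (\<forall>j\<in>J_right. word_e j x = None)"
proof -
  have "x \<in> standard s \<Longrightarrow> (\<forall>j\<in>J_right. word_e j x = None) \<longleftrightarrow> set x \<subseteq> highest_letters J_right"
    by (rule standard_highest[OF J_E6(2) right_top])
  then show ?thesis unfolding right_highest_def by blast
qed

text \<open>A standard word is written as \<open>f\<^sub>l x\<close> with \<open>x\<close> left highest, the path \<open>l\<close> is followed from the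
reversed word, and the result is twisted letter by letter. The intermediate word \<open>u\<close> is in general not
standard, but its image is.\<close>

definition promote :: "'a list \<Rightarrow> 'a list" where
  "promote w = (THE v. \<exists>s x l u. x \<in> left_highest s \<and> set l \<subseteq> J_left \<and> word_fs l x = Some w \<and>
     word_fs l (rev x) = Some u \<and> v = map p1 u)"

lemma left_highest_Words: "x \<in> left_highest s \<Longrightarrow> x \<in> Words s" "x \<in> left_highest s \<Longrightarrow> rev x \<in> Words s"
  by (auto simp: left_highest_def standard_def Words_def)

lemma ww_rev: "ww i (rev x) = ww i x"
  unfolding ww_def rev_map[symmetric] by (rule sum_list_rev)

text \<open>A left highest word and its reversal have the same weight, so they generate isomorphic components
for the nodes 1 to 5.\<close>

lemma transport:
  assumes "x \<in> left_highest s" "y \<in> left_highest s" "set l \<subseteq> J_left" "set l' \<subseteq> J_left"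
  shows "word_fs l x = word_fs l' y \<longleftrightarrow> word_fs l (rev x) = word_fs l' (rev y)"
    and "word_fs l x = None \<longleftrightarrow> word_fs l (rev x) = None"
proof -
  have hi: "\<And>a j. a \<in> set x \<union> set (rev x) \<union> set y \<union> set (rev y) \<Longrightarrow> j \<in> J_left \<Longrightarrow> el j a = None"
    using assms(1,2) by (auto simp: left_highest_def highest_letters_def)
  have eq: "x = y \<longleftrightarrow> rev x = rev y" by simp
  note tr = word_fs_transport[OF J_E6(1) left_highest_Words[OF assms(1)] left_highest_Words[OF assms(2)] hi
      ww_rev[symmetric] ww_rev[symmetric] eq assms(3,4)]
  show "word_fs l x = word_fs l' y \<longleftrightarrow> word_fs l (rev x) = word_fs l' (rev y)" by (rule tr(1))
  show "word_fs l x = None \<longleftrightarrow> word_fs l (rev x) = None" by (rule tr(2))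
qed

lemma promote_eq:
  assumes x: "x \<in> left_highest s" and l: "set l \<subseteq> J_left" "word_fs l x = Some w" "word_fs l (rev x) = Some u"
  shows "promote w = map p1 u"
  unfolding promote_def
proof (rule the_equality)
  show "\<exists>s x l u'. x \<in> left_highest s \<and> set l \<subseteq> J_left \<and> word_fs l x = Some w \<and>
     word_fs l (rev x) = Some u' \<and> map p1 u = map p1 u'" using assms by blast
  fix v assume "\<exists>s x l u. x \<in> left_highest s \<and> set l \<subseteq> J_left \<and> word_fs l x = Some w \<and>
     word_fs l (rev x) = Some u \<and> v = map p1 u"
  then obtain s' x' l' u' where x': "x' \<in> left_highest s'" "set l' \<subseteq> J_left" "word_fs l' x' = Some w"
     "word_fs l' (rev x') = Some u'" "v = map p1 u'" by blast
  have "w \<in> Words s" "w \<in> Words s'"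
    using word_fs_Words[OF left_highest_Words(1)[OF x] _ l(2)] word_fs_Words[OF left_highest_Words(1)[OF x'(1)] _ x'(3)]
      l(1) x'(2) J_E6(1) by blast+
  \<comment> \<open>The word itself determines the length, and by transport the result does not depend on the path.\<close>
  then have "s' = s" by (simp add: Words_def)
  then have "word_fs l' (rev x') = word_fs l (rev x)"
    using transport(1)[OF x'(1)[unfolded \<open>s' = s\<close>] x x'(2) l(1)] x'(3) l(2) by simp
  then show "v = map p1 u" using x'(4,5) l(3) by simp
qed

lemma promote_cases:
  assumes "w \<in> standard s"
  shows "\<exists>x l u. x \<in> left_highest s \<and> set l \<subseteq> J_left \<and> word_fs l x = Some w \<and> word_fs l (rev x) = Some u \<and>
    u \<in> Words s \<and> promote w = map p1 u"
proof -
  obtain l x where l: "set l \<subseteq> J_left" "x \<in> standard s" "word_fs l x = Some w" "\<forall>j\<in>J_left. word_e j x = None"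
    using climb[OF J_E6(1) assms] by blast
  have x: "x \<in> left_highest s" using l left_highest_iff by blast
  obtain u where u: "word_fs l (rev x) = Some u" using transport(2)[OF x x l(1) l(1)] l(3) by auto
  have "u \<in> Words s" using word_fs_Words[OF left_highest_Words(2)[OF x] _ u] l(1) J_E6(1) by blast
  then show ?thesis using x l u promote_eq[OF x l(1,3) u] by blast
qed

text \<open>The image is reached from the right highest word \<open>map p1 (rev x)\<close> by the twisted path, and standard
words are closed under all operators.\<close>

lemma promote_standard: assumes "w \<in> standard s" shows "promote w \<in> standard s"
proof -
  obtain x l u where x: "x \<in> left_highest s" "set l \<subseteq> J_left" "word_fs l x = Some w" "word_fs l (rev x) = Some u"
    "promote w = map p1 u" using promote_cases[OF assms] by blast
  have "word_fs (map pdot l) (map p1 (rev x)) = Some (promote w)"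
    using map_p1_word_fs[OF x(2) left_highest_Words(2)[OF x(1)]] x(4,5) by simp
  moreover have "map p1 (rev x) \<in> standard s"
    using reversal[of s] x(1) by (auto simp: bij_betw_def right_highest_def)
  moreover have "set (map pdot l) \<subseteq> E6_index" using x(2) pdot_J(3) by auto
  ultimately show ?thesis using word_fs_standard by blast
qed

lemma promote_weight:
  assumes "w \<in> standard s" "i \<in> aff_index" shows "aww (pdot i) (promote w) = aww i w"
proof -
  obtain x l u where x: "x \<in> left_highest s" "set l \<subseteq> J_left" "word_fs l x = Some w" "word_fs l (rev x) = Some u"
    "u \<in> Words s" "promote w = map p1 u" using promote_cases[OF assms(1)] by blast
  have l: "set l \<subseteq> E6_index" using x(2) J_E6 by blast
  have "ww j u = ww j w" if "j \<in> E6_index" for j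
    using word_fs_weight[OF l that x(3)] word_fs_weight[OF l that x(4)] ww_rev by simp
  then have "aww i u = aww i w" using assms(2) by (simp add: aww_def aff_index_def E6_index_def)
  moreover have "aww (pdot i) (promote w) = aww i u"
    unfolding x(6) using x(5) by (intro map_p1_aww assms(2)) (simp add: Words_def)
  ultimately show ?thesis by simp
qed

lemma promote_f:
  assumes w: "w \<in> standard s" and i: "i \<in> J_left"
  shows "word_f (pdot i) (promote w) = map_option promote (word_f i w)"
proof -
  obtain x l u where x: "x \<in> left_highest s" "set l \<subseteq> J_left" "word_fs l x = Some w" "word_fs l (rev x) = Some u"
    "u \<in> Words s" "promote w = map p1 u" using promote_cases[OF w] by blast
  have il: "set (i # l) \<subseteq> J_left" using i x(2) by simp
  have f: "word_f (pdot i) (promote w) = map_option (map p1) (word_f i u)"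
    unfolding x(6) using x(5) by (intro map_p1_word_f(2) i) (simp add: Words_def)
  have 1: "word_fs (i # l) x = word_f i w" "word_fs (i # l) (rev x) = word_f i u" using x by simp_all
  show ?thesis
  proof (cases "word_f i w")
    case None
    then show ?thesis using transport(2)[OF x(1) x(1) il il] f 1 by simp
  next
    case (Some v)
    then obtain v' where v': "word_f i u = Some v'" using transport(2)[OF x(1) x(1) il il] 1 by auto
    have "promote v = map p1 v'" using promote_eq[OF x(1) il] 1 Some v' by simp
    then show ?thesis using f Some v' by simp
  qed
qed

lemma promote_bij: "bij_betw promote (standard s) (standard s)"
  unfolding bij_betw_def
proof
  show "inj_on promote (standard s)"
  proof (rule inj_onI)
    fix w w' assume "w \<in> standard s" "w' \<in> standard s" and eq: "promote w = promote w'"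
    obtain x l u where x: "x \<in> left_highest s" "set l \<subseteq> J_left" "word_fs l x = Some w" "word_fs l (rev x) = Some u"
      "u \<in> Words s" "promote w = map p1 u" using promote_cases[OF \<open>w \<in> standard s\<close>] by blast
    obtain x' l' u' where x': "x' \<in> left_highest s" "set l' \<subseteq> J_left" "word_fs l' x' = Some w'" "word_fs l' (rev x') = Some u'"
      "u' \<in> Words s" "promote w' = map p1 u'" using promote_cases[OF \<open>w' \<in> standard s\<close>] by blast
    have "inj_on p1 X" using p1_bij by (simp add: bij_betw_def)
    moreover have "set u \<union> set u' \<subseteq> X" using x(5) x'(5) by (simp add: Words_def)
    ultimately have inj: "inj_on p1 (set u \<union> set u')" by (rule inj_on_subset)
    have "map p1 u = map p1 u'" using eq x(6) x'(6) by simp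
    then have "u = u'" using inj by (rule map_inj_on)
    then show "w = w'" using transport(1)[OF x(1) x'(1) x(2) x'(2)] x(3,4) x'(3,4) by simp
  qed
  show "promote ` standard s = standard s"
  proof
    show "promote ` standard s \<subseteq> standard s" using promote_standard by blast
    show "standard s \<subseteq> promote ` standard s"
    proof
      fix v assume v: "v \<in> standard s"
      obtain l' y where l': "set l' \<subseteq> J_right" "y \<in> standard s" "word_fs l' y = Some v" "\<forall>j\<in>J_right. word_e j y = None"
        using climb[OF J_E6(2) v] by blast
      have "y \<in> right_highest s" using l' right_highest_iff by blast
      then obtain x where x: "x \<in> left_highest s" "y = map p1 (rev x)"
        using reversal[of s] by (auto simp: bij_betw_def)
      have "set l' \<subseteq> pdot ` J_left" using l'(1) pdot_J(1) by simp
      from list_preimage[OF this] obtain l where l: "l' = map pdot l" "set l \<subseteq> J_left"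
        by blast
      have "map_option (map p1) (word_fs l (rev x)) = Some v"
        using map_p1_word_fs[OF l(2) left_highest_Words(2)[OF x(1)]] l'(3) l(1) x(2) by simp
      then obtain u where u: "word_fs l (rev x) = Some u" "v = map p1 u" by auto
      then obtain w where w: "word_fs l x = Some w" using transport(2)[OF x(1) x(1) l(2) l(2)] by auto
      have "w \<in> standard s"
        using x(1) l(2) J_E6 by (intro word_fs_standard[OF _ _ w]) (auto simp: left_highest_def)
      moreover have "promote w = v" using promote_eq[OF x(1) l(2) w u(1)] u(2) by simp
      ultimately show "v \<in> promote ` standard s" by blast
    qed
  qed
qed

lemma promote_e:
  assumes w: "w \<in> standard s" and i: "i \<in> J_left"
  shows "word_e (pdot i) (promote w) = map_option promote (word_e i w)"
proof -
  have iE: "i \<in> E6_index" "pdot i \<in> E6_index" using i J_E6 pdot_J(3) by auto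
  have W: "w \<in> Words s" "promote w \<in> Words s" using w promote_standard standard_Words by auto
  show ?thesis
  proof (cases "word_e i w")
    case (Some v)
    then have v: "word_f i v = Some w" "v \<in> standard s"
      using word_f_word_e(2)[OF iE(1) W(1)] standard_closed(2)[OF iE(1) w] by auto
    then have "word_f (pdot i) (promote v) = Some (promote w)" using promote_f[OF v(2) i] by simp
    then show ?thesis using word_f_word_e(1)[OF iE(2) standard_Words[OF promote_standard[OF v(2)]]] Some by simp
  next
    case None
    have "word_e (pdot i) (promote w) = None"
    proof (rule ccontr)
      assume "word_e (pdot i) (promote w) \<noteq> None"
      then obtain v where v: "word_e (pdot i) (promote w) = Some v" by auto
      have "v \<in> standard s" using standard_closed(2)[OF iE(2) promote_standard[OF w] v] .
      then obtain w' where w': "w' \<in> standard s" "v = promote w'" using promote_bij[of s] by (auto simp: bij_betw_def)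
      have "word_f (pdot i) v = Some (promote w)" using word_f_word_e(2)[OF iE(2) W(2) v] by simp
      then have "map_option promote (word_f i w') = Some (promote w)" using promote_f[OF w'(1) i] w'(2) by simp
      then obtain w'' where w'': "word_f i w' = Some w''" "promote w'' = promote w" by auto
      have "w'' = w" using promote_bij[of s] standard_closed(1)[OF iE(1) w'(1) w''(1)] w w''(2)
        by (auto simp: bij_betw_def inj_on_def)
      then have "word_e i w = Some w'" using word_f_word_e(1)[OF iE(1) standard_Words[OF w'(1)]] w''(1) by simp
      then show False using None by simp
    qed
    then show ?thesis using None by simp
  qed
qed

end

section \<open>From words to the crystal\<close>

context graded_letters
begin

text \<open>From every standard word one climbs to a standard word that is highest for all nodes, and the only
such word repeats the highest letter.\<close>

lemma standard_component:
  assumes top: "highest_letters E6_index = {t}" and zero: "\<And>j. j \<in> E6_index \<Longrightarrow> dp j t = 0"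
  shows "replicate s t \<in> standard s"
    and "standard s = {w. \<exists>l. set l \<subseteq> E6_index \<and> word_fs l (replicate s t) = Some w}"
proof -
  have "t \<in> X" using top by (auto simp: highest_letters_def)
  moreover have "sorted_wrt geq (replicate s t)" by (induction s) (auto simp: geq_refl)
  ultimately show mem: "replicate s t \<in> standard s" by (auto simp: standard_def Words_def)
  show "standard s = {w. \<exists>l. set l \<subseteq> E6_index \<and> word_fs l (replicate s t) = Some w}"
  proof (intro equalityI subsetI)
    fix w assume "w \<in> standard s"
    from climb[OF order_refl this] obtain l x where l: "set l \<subseteq> E6_index" "x \<in> standard s"
      "word_fs l x = Some w" "\<forall>j\<in>E6_index. word_e j x = None" by blast
    have "dp j a = 0" if "a \<in> highest_letters E6_index" "j \<in> E6_index" for a j using that zero top by simp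
    then have "set x \<subseteq> {t}" using standard_highest[OF order_refl _ l(2)] l(4) unfolding top by blast
    then have "x = replicate s t" using l(2)
      by (intro replicate_eqI) (auto simp: standard_def Words_def)
    then show "w \<in> {w. \<exists>l. set l \<subseteq> E6_index \<and> word_fs l (replicate s t) = Some w}" using l by blast
  next
    fix w assume "w \<in> {w. \<exists>l. set l \<subseteq> E6_index \<and> word_fs l (replicate s t) = Some w}"
    then show "w \<in> standard s" using word_fs_standard[OF mem] by blast
  qed
qed

end

lemma pdot_nonzero: "i \<in> E6_index \<Longrightarrow> pdot i \<noteq> 0 \<longleftrightarrow> i \<in> J_left"
  unfolding E6_index_cases J_left_cases by (auto simp: pdot_def)

context twisted_letters
begin

text \<open>Existence is \<^const>\<open>promote\<close>. For uniqueness, a twisted isomorphism maps left highest elements to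
right highest ones, whose weight is prescribed and determines them. All other elements are of the form
\<open>f\<^sub>j b\<close> with \<open>b\<close> of smaller depth, and their images follow by induction.\<close>

theorem unique_twisted_isomorphism:
  fixes C :: "'c crystal"
  assumes Phi: "bij_betw \<Phi> (nodes C) (standard s)"
    and f: "\<And>i b. i \<in> E6_index \<Longrightarrow> b \<in> nodes C \<Longrightarrow> f_op C i b \<in> nodes0 C"
      "\<And>i b. i \<in> E6_index \<Longrightarrow> b \<in> nodes C \<Longrightarrow> map_option \<Phi> (f_op C i b) = word_f i (\<Phi> b)"
    and e: "\<And>i b. i \<in> E6_index \<Longrightarrow> b \<in> nodes C \<Longrightarrow> e_op C i b \<in> nodes0 C"
      "\<And>i b. i \<in> E6_index \<Longrightarrow> b \<in> nodes C \<Longrightarrow> map_option \<Phi> (e_op C i b) = word_e i (\<Phi> b)"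
    and wt: "\<And>i b. i \<in> E6_index \<Longrightarrow> b \<in> nodes C \<Longrightarrow> wt C i b = ww i (\<Phi> b)"
  shows "\<exists>!p. p \<in> extensional (nodes0 C) \<and> twisted_isomorphism pdot C C p \<and>
     (\<forall>b\<in>nodes C. \<forall>i\<in>aff_index. aff_wt C (pdot i) (the (p (Some b))) = aff_wt C i b)"
proof -
  let ?N = "nodes C"
  have inj: "inj_on \<Phi> ?N" and Phi_std: "\<And>b. b \<in> ?N \<Longrightarrow> \<Phi> b \<in> standard s"
    using Phi by (auto simp: bij_betw_def)
  have Some_nodes0: "Some b \<in> nodes0 C \<longleftrightarrow> b \<in> ?N" for b by (auto simp: nodes0_def)
  have inj0: "x = y" if "x \<in> nodes0 C" "y \<in> nodes0 C" "map_option \<Phi> x = map_option \<Phi> y" for x y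
    using that inj by (cases x; cases y) (auto simp: Some_nodes0 inj_on_def)
  have aff: "aff_wt C i b = aww i (\<Phi> b)" if "i \<in> aff_index" "b \<in> ?N" for i b
    using wt[OF _ that(2)] that(1) by (simp add: aff_wt_def aww_def aff_index_def E6_index_def)
  have pdot_aff: "pdot i \<in> aff_index" if "i \<in> aff_index" for i
    using pdot_diagram_automorphism(1) that by (auto simp: bij_betw_def)
  show ?thesis
  proof (rule ex_ex1I)
    define g where "g b = the_inv_into ?N \<Phi> (promote (\<Phi> b))" for b
    have Phi_g: "\<Phi> (g b) = promote (\<Phi> b)" if "b \<in> ?N" for b
      using f_the_inv_into_f_bij_betw[OF Phi] promote_standard[OF Phi_std[OF that]] by (simp add: g_def)
    have "bij_betw (the_inv_into ?N \<Phi> \<circ> (promote \<circ> \<Phi>)) ?N ?N"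
      using Phi promote_bij bij_betw_the_inv_into[OF Phi] by (blast intro: bij_betw_trans)
    then have g_bij: "bij_betw g ?N ?N" by (simp add: g_def comp_def cong: bij_betw_cong)
    then have g_N: "\<And>b. b \<in> ?N \<Longrightarrow> g b \<in> ?N" by (auto simp: bij_betw_def)
    define p where "p = restrict (map_option g) (nodes0 C)"
    have p: "p x = map_option g x" if "x \<in> nodes0 C" for x using that by (simp add: p_def)
    have pS: "p (Some b) = Some (g b)" if "b \<in> ?N" for b using p[of "Some b"] that by (simp add: Some_nodes0)
    have Phi_p: "map_option \<Phi> (p x) = map_option promote (map_option \<Phi> x)" if "x \<in> nodes0 C" for x
      using p[OF that] that Phi_g by (cases x) (auto simp: Some_nodes0)
    have p_nodes0: "p x \<in> nodes0 C" if "x \<in> nodes0 C" for x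
      using p[OF that] that g_N by (cases x) (auto simp: Some_nodes0 nodes0_def)
    have "bij_betw (map_option g) (nodes0 C) (nodes0 C)"
      unfolding bij_betw_def
    proof
      show "inj_on (map_option g) (nodes0 C)"
        using g_bij by (auto simp: bij_betw_def inj_on_def nodes0_def)
      have "map_option g ` nodes0 C = insert None (Some ` (g ` ?N))"
        by (simp add: nodes0_def image_image)
      then show "map_option g ` nodes0 C = nodes0 C"
        using g_bij by (simp add: bij_betw_def nodes0_def)
    qed
    then have bij: "bij_betw p (nodes0 C) (nodes0 C)" using p by (simp cong: bij_betw_cong)
    have none: "p x = None \<longleftrightarrow> x = None" if "x \<in> nodes0 C" for x using p[OF that] by simp
    have comm: "p (f0 C i (Some b)) = f0 C (pdot i) (p (Some b)) \<and> p (e0 C i (Some b)) = e0 C (pdot i) (p (Some b))"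
      if i: "i \<in> J_left" and b: "b \<in> ?N" for i b
    proof -
      have iE: "i \<in> E6_index" "pdot i \<in> E6_index" using i J_E6 pdot_J(3) by auto
      have "p (f_op C i b) = f_op C (pdot i) (g b)"
        by (intro inj0 p_nodes0 f(1) iE b g_N)
          (simp add: Phi_p f iE b g_N Phi_g promote_f[OF Phi_std[OF b] i])
      moreover have "p (e_op C i b) = e_op C (pdot i) (g b)"
        by (intro inj0 p_nodes0 e(1) iE b g_N)
          (simp add: Phi_p e iE b g_N Phi_g promote_e[OF Phi_std[OF b] i])
      ultimately show ?thesis by (simp add: f0_def e0_def pS[OF b])
    qed
    have "twisted_isomorphism pdot C C p"
      unfolding twisted_isomorphism_def
      by (intro conjI ballI impI bij none) (use comm pdot_nonzero in auto)
    moreover have "aff_wt C (pdot i) (the (p (Some b))) = aff_wt C i b" if "b \<in> ?N" "i \<in> aff_index" for b i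
      using that aff[OF pdot_aff g_N] aff Phi_g promote_weight[OF Phi_std] by (simp add: pS)
    moreover have "p \<in> extensional (nodes0 C)" by (simp add: p_def)
    ultimately show "\<exists>p. p \<in> extensional (nodes0 C) \<and> twisted_isomorphism pdot C C p \<and>
      (\<forall>b\<in>?N. \<forall>i\<in>aff_index. aff_wt C (pdot i) (the (p (Some b))) = aff_wt C i b)" by blast
  next
    fix p p' assume p: "p \<in> extensional (nodes0 C) \<and> twisted_isomorphism pdot C C p \<and>
        (\<forall>b\<in>?N. \<forall>i\<in>aff_index. aff_wt C (pdot i) (the (p (Some b))) = aff_wt C i b)"
      and p': "p' \<in> extensional (nodes0 C) \<and> twisted_isomorphism pdot C C p' \<and>
        (\<forall>b\<in>?N. \<forall>i\<in>aff_index. aff_wt C (pdot i) (the (p' (Some b))) = aff_wt C i b)"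
    have comm: "q (f_op C i b) = f0 C (pdot i) (q (Some b))" "q (e_op C i b) = e0 C (pdot i) (q (Some b))"
      if "twisted_isomorphism pdot C C q" "i \<in> J_left" "b \<in> ?N" for q i b
      using that J_E6(1) pdot_nonzero[of i] by (auto simp: twisted_isomorphism_def f0_def e0_def)
    have highest: "\<exists>c\<in>?N. q (Some b) = Some c \<and> \<Phi> c \<in> right_highest s \<and> (\<forall>i\<in>aff_index. aww (pdot i) (\<Phi> c) = aww i (\<Phi> b))"
      if q: "twisted_isomorphism pdot C C q" "\<forall>b\<in>?N. \<forall>i\<in>aff_index. aff_wt C (pdot i) (the (q (Some b))) = aff_wt C i b"
        and b: "b \<in> ?N" "\<forall>j\<in>J_left. word_e j (\<Phi> b) = None" for q b
    proof -
      have n0: "Some b \<in> nodes0 C" "None \<in> nodes0 C" using b(1) by (auto simp: nodes0_def)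
      have "q (Some b) \<in> nodes0 C" "q (Some b) \<noteq> None" and qN: "q None = None"
        using q(1) n0 unfolding twisted_isomorphism_def bij_betw_def by auto
      then obtain c where c: "c \<in> ?N" "q (Some b) = Some c" by (auto simp: nodes0_def)
      have "word_e k (\<Phi> c) = None" if k: "k \<in> J_right" for k
      proof -
        obtain j where j: "j \<in> J_left" "k = pdot j" using k pdot_J(1) by blast
        have "j \<in> E6_index" "k \<in> E6_index" using j(1) k J_E6 by auto
        have "e_op C j b = None" using e(2)[OF \<open>j \<in> E6_index\<close> b(1)] b(2) j(1) by simp
        then have "e_op C k c = None" using comm(2)[OF q(1) j(1) b(1)] qN c(2) j(2) by (simp add: e0_def)
        then show ?thesis using e(2)[OF \<open>k \<in> E6_index\<close> c(1)] by simp
      qed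
      then have "\<Phi> c \<in> right_highest s" using right_highest_iff Phi_std[OF c(1)] by blast
      moreover have "aww (pdot i) (\<Phi> c) = aww i (\<Phi> b)" if i: "i \<in> aff_index" for i
        using q(2) b(1) c i aff[OF i b(1)] aff[OF pdot_aff[OF i] c(1)] by force
      ultimately show ?thesis using c by blast
    qed
    have eq: "p (Some b) = p' (Some b)" if "b \<in> ?N" for b
      using that
    proof (induction "nat (depth (\<Phi> b))" arbitrary: b rule: less_induct)
      case less
      show ?case
      proof (cases "\<forall>j\<in>J_left. word_e j (\<Phi> b) = None")
        case True
        obtain c where c: "c \<in> ?N" "p (Some b) = Some c" "\<Phi> c \<in> right_highest s"
          "\<forall>i\<in>aff_index. aww (pdot i) (\<Phi> c) = aww i (\<Phi> b)"
          using highest[OF _ _ less.prems True, of p] p by blast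
        obtain c' where c': "c' \<in> ?N" "p' (Some b) = Some c'" "\<Phi> c' \<in> right_highest s"
          "\<forall>i\<in>aff_index. aww (pdot i) (\<Phi> c') = aww i (\<Phi> b)"
          using highest[OF _ _ less.prems True, of p'] p' by blast
        have "ww k (\<Phi> c) = ww k (\<Phi> c')" if k: "k \<in> E6_index" for k
        proof -
          have "k \<in> aff_index" using k by (auto simp: aff_index_def E6_index_def)
          then have "k \<in> pdot ` aff_index" using pdot_diagram_automorphism(1) by (simp add: bij_betw_def)
          then obtain i where i: "i \<in> aff_index" "k = pdot i" by blast
          have "k \<noteq> 0" using k by (auto simp: E6_index_def)
          moreover have "aww k (\<Phi> c) = aww k (\<Phi> c')" using c(4) c'(4) i by simp
          ultimately show ?thesis by (simp add: aww_def)
        qed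
        then have "\<Phi> c = \<Phi> c'" using right_highest_unique[OF c(3) c'(3)] by blast
        then have "c = c'" using inj c(1) c'(1) by (auto simp: inj_on_def)
        then show ?thesis using c(2) c'(2) by simp
      next
        case False
        then obtain j v where j: "j \<in> J_left" "word_e j (\<Phi> b) = Some v" by auto
        have jE: "j \<in> E6_index" using j(1) J_E6 by auto
        have "map_option \<Phi> (e_op C j b) = Some v" using e(2)[OF jE less.prems] j(2) by simp
        then obtain b1 where b1: "e_op C j b = Some b1" "v = \<Phi> b1" by auto
        have b1N: "b1 \<in> ?N" using e(1)[OF jE less.prems] b1(1) by (simp add: Some_nodes0)
        have W: "\<Phi> b \<in> Words s" using Phi_std[OF less.prems] by (rule standard_Words)
        have "map_option \<Phi> (f_op C j b1) = Some (\<Phi> b)"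
          using f(2)[OF jE b1N] word_f_word_e(2)[OF jE W j(2)] b1(2) by simp
        then have fb: "f_op C j b1 = Some b"
          using inj0[OF f(1)[OF jE b1N], of "Some b"] less.prems by (simp add: Some_nodes0)
        have "depth (\<Phi> b) = depth (\<Phi> b1) + 1" using word_e_depth[OF jE W j(2)] b1(2) by simp
        then have "nat (depth (\<Phi> b1)) < nat (depth (\<Phi> b))"
          using depth_nonneg[OF standard_Words[OF Phi_std[OF b1N]]] by simp
        then have "p (Some b1) = p' (Some b1)" by (rule less.hyps[OF _ b1N])
        then show ?thesis
          using comm(1)[OF _ j(1) b1N, of p] comm(1)[OF _ j(1) b1N, of p'] p p' unfolding fb by simp
      qed
    qed
    have "p None = None" "p' None = None"
      using p p' by (auto simp: twisted_isomorphism_def nodes0_def)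
    then have "p x = p' x" if "x \<in> nodes0 C" for x
      using eq that by (auto simp: nodes0_def)
    then show "p = p'" using p p' by (intro extensionalityI[of p "nodes0 C"]) auto
  qed
qed

end

section \<open>The two minuscule representations of dimension 27\<close>

text \<open>The weights of the representation with highest weight \<open>\<Lambda>\<^sub>1\<close>, each given by the multiplicities of
\<open>\<alpha>\<^sub>1, ..., \<alpha>\<^sub>6\<close> in its difference to \<open>\<Lambda>\<^sub>1\<close>. The reflection of the diagram, which
exchanges 1 with 6 and 3 with 5, yields those for \<open>\<Lambda>\<^sub>6\<close>.\<close>

definition letters1 :: "int list list" where
  "letters1 = [[0,0,0,0,0,0], [1,0,0,0,0,0], [1,0,1,0,0,0], [1,0,1,1,0,0],
    [1,1,1,1,0,0], [1,0,1,1,1,0], [1,1,1,1,1,0], [1,0,1,1,1,1],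
    [1,1,1,2,1,0], [1,1,1,1,1,1], [1,1,2,2,1,0], [1,1,1,2,1,1],
    [2,1,2,2,1,0], [1,1,2,2,1,1], [1,1,1,2,2,1], [2,1,2,2,1,1],
    [1,1,2,2,2,1], [2,1,2,2,2,1], [1,1,2,3,2,1], [2,1,2,3,2,1],
    [1,2,2,3,2,1], [2,2,2,3,2,1], [2,1,3,3,2,1], [2,2,3,3,2,1],
    [2,2,3,4,2,1], [2,2,3,4,3,1], [2,2,3,4,3,2]]"

definition letters :: "nat \<Rightarrow> int list list" where
  "letters r = (if r = 1 then letters1 else map (\<lambda>d. [d ! 5, d ! 1, d ! 4, d ! 3, d ! 2, d ! 0]) letters1)"

definition inc :: "int \<Rightarrow> nat \<Rightarrow> int list \<Rightarrow> int list" where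
  "inc e i d = d[i - 1 := d ! (i - 1) + e]"

definition letter_depth :: "nat \<Rightarrow> int list \<Rightarrow> int" where
  "letter_depth j d = d ! (j - 1)"

definition letter_wt :: "nat \<Rightarrow> nat \<Rightarrow> int list \<Rightarrow> int" where
  "letter_wt r i d = Lambda r i - (\<Sum>j\<in>E6_index. cartan i j * letter_depth j d)"

definition letter_f :: "nat \<Rightarrow> nat \<Rightarrow> int list \<Rightarrow> int list option" where
  "letter_f r i d = (if i \<in> E6_index \<and> length d = 6 \<and> letter_wt r i d = 1 then Some (inc 1 i d) else None)"

definition letter_e :: "nat \<Rightarrow> nat \<Rightarrow> int list \<Rightarrow> int list option" where
  "letter_e r i d = (if i \<in> E6_index \<and> length d = 6 \<and> letter_wt r i d = -1 then Some (inc (-1) i d) else None)"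

text \<open>The automorphism acts linearly on level-zero weights. It permutes the simple roots, except that
\<open>\<alpha>\<^sub>6\<close> goes to \<open>\<alpha>\<^sub>0 = - (\<alpha>\<^sub>1 + 2 \<alpha>\<^sub>2 + 2 \<alpha>\<^sub>3 + 3 \<alpha>\<^sub>4 + 2 \<alpha>\<^sub>5 + \<alpha>\<^sub>6)\<close>. The constant vector is
the depth of the image of the highest weight: this image is \<open>\<Lambda>\<^sub>6 - \<Lambda>\<^sub>1\<close> for \<open>r = 1\<close> and the
lowest weight \<open>- \<Lambda>\<^sub>1\<close> for \<open>r = 6\<close>.\<close>

definition letter_twist :: "nat \<Rightarrow> int list \<Rightarrow> int list" where
  "letter_twist r d = map2 (\<lambda>x y. x + y) (if r = 1 then [2,1,2,2,1,0] else [2,2,3,4,3,2])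
     [- (d ! 5), d ! 4 - 2 * d ! 5, d ! 1 - 2 * d ! 5, d ! 3 - 3 * d ! 5, d ! 2 - 2 * d ! 5, d ! 0 - d ! 5]"

text \<open>The weight with the Cartan integers of \<open>E\<^sub>6\<close> inserted, in a form suited to evaluation.\<close>

definition letter_wt_eval :: "nat \<Rightarrow> nat \<Rightarrow> int list \<Rightarrow> int" where
  "letter_wt_eval r i d = (if i = r then 1 else 0) +
    (if i = 1 then d ! 2 - 2 * d ! 0
     else if i = 2 then d ! 3 - 2 * d ! 1
     else if i = 3 then d ! 0 + d ! 3 - 2 * d ! 2
     else if i = 4 then d ! 1 + d ! 2 + d ! 4 - 2 * d ! 3
     else if i = 5 then d ! 3 + d ! 5 - 2 * d ! 4
     else d ! 4 - 2 * d ! 5)"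

definition letter_awt_eval :: "nat \<Rightarrow> nat \<Rightarrow> int list \<Rightarrow> int" where
  "letter_awt_eval r i d = (if i = 0 then - (letter_wt_eval r 1 d + letter_wt_eval r 6 d + 2 * (letter_wt_eval r 2 d + letter_wt_eval r 3 d + letter_wt_eval r 5 d) + 3 * letter_wt_eval r 4 d) else letter_wt_eval r i d)"

lemma E6_index_set: "E6_index = {1, 2, 3, 4, 5, 6}"
  by (auto simp: E6_index_def)

lemma letter_wt_eval_eq: "i \<in> E6_index \<Longrightarrow> letter_wt r i d = letter_wt_eval r i d"
  unfolding letter_wt_def letter_depth_def E6_index_set
  by (auto simp: letter_wt_eval_def Lambda_def cartan_def aff_edges_def doubleton_eq_iff)

definition highest_list :: "nat \<Rightarrow> nat list \<Rightarrow> int list list" where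
  "highest_list r J = filter (\<lambda>a. list_all (\<lambda>j. letter_wt_eval r j a \<noteq> -1) J) (letters r)"

text \<open>Finite conditions on the table of letters, from which the hypotheses on letters follow.\<close>

definition check_closed :: "nat \<Rightarrow> bool" where
  "check_closed r \<longleftrightarrow> list_all (\<lambda>a. length a = 6 \<and> list_all (\<lambda>i. letter_wt_eval r i a \<ge> -1 \<and> letter_wt_eval r i a \<le> 1 \<and> 0 \<le> a ! (i - 1)
     \<and> (letter_wt_eval r i a = 1 \<longrightarrow> inc 1 i a \<in> set (letters r))
     \<and> (letter_wt_eval r i a = -1 \<longrightarrow> inc (-1) i a \<in> set (letters r))) [1,2,3,4,5,6]) (letters r)"

definition check_twist :: "nat \<Rightarrow> bool" where
  "check_twist r \<longleftrightarrow> distinct (map (letter_twist r) (letters r)) \<and> list_all (\<lambda>a. letter_twist r a \<in> set (letters r)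
     \<and> list_all (\<lambda>i. letter_awt_eval r (pdot i) (letter_twist r a) = letter_awt_eval r i a) [0,1,2,3,4,5,6]
     \<and> list_all (\<lambda>i. letter_twist r (inc 1 i a) = inc 1 (pdot i) (letter_twist r a)
         \<and> letter_twist r (inc (-1) i a) = inc (-1) (pdot i) (letter_twist r a)) [1,2,3,4,5]) (letters r)"

lemma letters_closed: "check_closed 1" "check_closed 6"
  by code_simp+

lemma letters_twist: "check_twist 1" "check_twist 6"
  by code_simp+

text \<open>As a representation of either \<open>D\<^sub>5\<close>, the 27 letters decompose into a trivial, a half-spin and a vector
representation, of dimensions 1, 16 and 10.\<close>

lemma highest_lists:
  "highest_list 1 [1,2,3,4,5] = [[0,0,0,0,0,0], [1,0,1,1,1,1], [2,2,3,4,3,2]]"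
  "highest_list 1 [2,3,4,5,6] = [[0,0,0,0,0,0], [1,0,0,0,0,0], [2,1,2,2,1,0]]"
  "highest_list 6 [1,2,3,4,5] = [[0,0,0,0,0,0], [0,0,0,0,0,1], [0,1,1,2,2,2]]"
  "highest_list 6 [2,3,4,5,6] = [[0,0,0,0,0,0], [1,0,1,1,1,1], [2,2,3,4,3,2]]"
  "highest_list 1 [1,2,3,4,5,6] = [[0,0,0,0,0,0]]"
  "highest_list 6 [1,2,3,4,5,6] = [[0,0,0,0,0,0]]"
  by code_simp+

lemma inc_length [simp]: "length (inc e i d) = length d"
  by (simp add: inc_def)

lemma letter_depth_inc:
  assumes "i \<in> E6_index" "j \<in> E6_index" "length d = 6"
  shows "letter_depth j (inc e i d) = letter_depth j d + (if j = i then e else 0)"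
  using assms by (auto simp: letter_depth_def inc_def nth_list_update E6_index_def)

lemma letter_wt_inc:
  assumes "i \<in> E6_index" "length d = 6"
  shows "letter_wt r j (inc e i d) = letter_wt r j d - cartan j i * e"
proof -
  have "(\<Sum>k\<in>E6_index. cartan j k * letter_depth k (inc e i d)) =
     (\<Sum>k\<in>E6_index. cartan j k * letter_depth k d + (if k = i then cartan j i * e else 0))"
    using letter_depth_inc[OF assms(1) _ assms(2)] by (intro sum.cong) (auto simp: distrib_left)
  also have "\<dots> = (\<Sum>k\<in>E6_index. cartan j k * letter_depth k d) + cartan j i * e"
    using assms(1) by (simp add: sum.distrib E6_index_def)
  finally show ?thesis by (simp add: letter_wt_def)
qed

lemma inc_inverse: "length d = 6 \<Longrightarrow> i \<in> E6_index \<Longrightarrow> inc e i (inc (- e) i d) = d"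
  by (auto simp: inc_def E6_index_def)

lemma inc_commute: "i \<in> E6_index \<Longrightarrow> j \<in> E6_index \<Longrightarrow> i \<noteq> j \<Longrightarrow> inc e i (inc e' j d) = inc e' j (inc e i d)"
  by (auto simp: inc_def E6_index_def list_update_swap nth_list_update)

lemma letter_f_e: "letter_f r i a = Some b \<longleftrightarrow> letter_e r i b = Some a"
proof
  assume "letter_f r i a = Some b"
  then have a: "i \<in> E6_index" "length a = 6" "letter_wt r i a = 1" "b = inc 1 i a"
    by (auto simp: letter_f_def split: if_splits)
  then show "letter_e r i b = Some a"
    using inc_inverse[OF a(2,1), of "-1"] by (simp add: letter_e_def letter_wt_inc)
next
  assume "letter_e r i b = Some a"
  then have b: "i \<in> E6_index" "length b = 6" "letter_wt r i b = -1" "a = inc (-1) i b"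
    by (auto simp: letter_e_def split: if_splits)
  then show "letter_f r i a = Some b"
    using inc_inverse[OF b(2,1), of 1] by (simp add: letter_f_def letter_wt_inc)
qed

lemma letters_closedD:
  assumes r: "r \<in> {1, 6}" and a: "a \<in> set (letters r)"
  shows "length a = 6"
    and "i \<in> E6_index \<Longrightarrow> letter_wt r i a \<in> {-1, 0, 1}"
    and "i \<in> E6_index \<Longrightarrow> 0 \<le> letter_depth i a"
    and "i \<in> E6_index \<Longrightarrow> letter_wt r i a = 1 \<Longrightarrow> inc 1 i a \<in> set (letters r)"
    and "i \<in> E6_index \<Longrightarrow> letter_wt r i a = -1 \<Longrightarrow> inc (-1) i a \<in> set (letters r)"
proof -
  have "check_closed r" using r letters_closed by auto
  then have *: "length a = 6 \<and> (\<forall>i\<in>set [1,2,3,4,5,6]. letter_wt_eval r i a \<ge> -1 \<and> letter_wt_eval r i a \<le> 1 \<and> 0 \<le> a ! (i - 1)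
     \<and> (letter_wt_eval r i a = 1 \<longrightarrow> inc 1 i a \<in> set (letters r)) \<and> (letter_wt_eval r i a = -1 \<longrightarrow> inc (-1) i a \<in> set (letters r)))"
    using a unfolding check_closed_def list_all_iff by blast
  then show "length a = 6" by blast
  assume i: "i \<in> E6_index"
  then have "i \<in> set [1,2,3,4,5,6]" by (simp add: E6_index_set)
  with * have **: "letter_wt_eval r i a \<ge> -1 \<and> letter_wt_eval r i a \<le> 1 \<and> 0 \<le> a ! (i - 1)
     \<and> (letter_wt_eval r i a = 1 \<longrightarrow> inc 1 i a \<in> set (letters r)) \<and> (letter_wt_eval r i a = -1 \<longrightarrow> inc (-1) i a \<in> set (letters r))" by blast
  then show "letter_wt r i a \<in> {-1, 0, 1}" "0 \<le> letter_depth i a"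
    unfolding letter_wt_eval_eq[OF i] letter_depth_def by auto
  show "inc 1 i a \<in> set (letters r)" if "letter_wt r i a = 1" using ** that letter_wt_eval_eq[OF i] by simp
  show "inc (-1) i a \<in> set (letters r)" if "letter_wt r i a = -1" using ** that letter_wt_eval_eq[OF i] by simp
qed

lemma graded_letters_27:
  assumes r: "r \<in> {1, 6}"
  shows "graded_letters (set (letters r)) (letter_f r) (letter_e r) (letter_wt r) letter_depth (Lambda r)"
proof (intro graded_letters.intro letter_crystal.intro graded_letters_axioms.intro)
  note D = letters_closedD[OF r]
  show "finite (set (letters r))" by simp
  show "letter_f r i a = Some b \<longleftrightarrow> letter_e r i b = Some a" for i a b by (rule letter_f_e)
  show "a \<in> set (letters r) \<longleftrightarrow> b \<in> set (letters r)" if i: "i \<in> E6_index" and f: "letter_f r i a = Some b" for i a b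
  proof
    assume a: "a \<in> set (letters r)"
    then show "b \<in> set (letters r)" using f D(4)[OF a i] by (auto simp: letter_f_def split: if_splits)
  next
    assume b: "b \<in> set (letters r)"
    have "letter_e r i b = Some a" using f letter_f_e by simp
    then show "a \<in> set (letters r)" using D(5)[OF b i] by (auto simp: letter_e_def split: if_splits)
  qed
  show "letter_f r i a \<noteq> None \<longleftrightarrow> letter_wt r i a = 1" "letter_e r i a \<noteq> None \<longleftrightarrow> letter_wt r i a = -1"
    "letter_wt r i a \<in> {-1, 0, 1}" if "i \<in> E6_index" "a \<in> set (letters r)" for i a
    using that D(1,2) by (simp_all add: letter_f_def letter_e_def)
  show "letter_wt r j b = letter_wt r j a - cartan j i" if "letter_f r i a = Some b" for i j a b
    using that letter_wt_inc[of i a r j 1] by (auto simp: letter_f_def split: if_splits)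
  show "Option.bind (letter_f r i a) (letter_e r j) = Option.bind (letter_e r j a) (letter_f r i)"
    if ij: "i \<in> E6_index" "j \<in> E6_index" "i \<noteq> j" and a: "a \<in> set (letters r)" for i j a
  proof -
    have c: "cartan j i = 0 \<or> cartan j i = -1" using ij(3) by (simp add: cartan_def)
    have w: "letter_wt r j (inc 1 i a) = letter_wt r j a - cartan j i"
      "letter_wt r i (inc (-1) j a) = letter_wt r i a + cartan j i"
      using letter_wt_inc ij D(1)[OF a] by (simp_all add: cartan_sym)
    show ?thesis
      using c w ij D(1)[OF a] D(2)[OF a ij(1)] D(2)[OF a ij(2)] inc_commute[OF ij, of 1 "-1" a]
      by (auto simp: letter_f_def letter_e_def)
  qed
  show "letter_depth j b = letter_depth j a + (if j = i then 1 else 0)"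
    if "i \<in> E6_index" "j \<in> E6_index" "letter_f r i a = Some b" for i j a b
    using that letter_depth_inc[of i j a 1] by (auto simp: letter_f_def split: if_splits)
  show "0 \<le> letter_depth j a" if "a \<in> set (letters r)" "j \<in> E6_index" for a j using D(3) that by blast
  show "letter_wt r i a = Lambda r i - (\<Sum>j\<in>E6_index. cartan i j * letter_depth j a)" for i a
    by (rule letter_wt_def)
  show "a = b" if "a \<in> set (letters r)" "b \<in> set (letters r)"
    and dp: "\<And>j. j \<in> E6_index \<Longrightarrow> letter_depth j a = letter_depth j b" for a b
  proof (rule nth_equalityI)
    show "length a = length b" using D(1) that by simp
    fix i assume "i < length a"
    then have "Suc i \<in> E6_index" using D(1) that by (simp add: E6_index_def)
    from dp[OF this] show "a ! i = b ! i" by (simp add: letter_depth_def)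
  qed
qed

lemma highest_letters_27:
  assumes r: "r \<in> {1, 6}" and J: "set Jl \<subseteq> E6_index"
  shows "graded_letters.highest_letters (set (letters r)) (letter_e r) (set Jl) = set (highest_list r Jl)"
proof -
  interpret graded_letters "set (letters r)" "letter_f r" "letter_e r" "letter_wt r" letter_depth "Lambda r"
    by (rule graded_letters_27[OF r])
  have "letter_e r j a = None \<longleftrightarrow> letter_wt_eval r j a \<noteq> -1" if "a \<in> set (letters r)" "j \<in> set Jl" for a j
    using el_wl[of j a] that J letter_wt_eval_eq[of j r a] by auto
  then show ?thesis unfolding highest_letters_def highest_list_def by (auto simp: list_all_iff)
qed

lemma highest_letters_J:
  assumes r: "r \<in> {1, 6}"
  shows "graded_letters.highest_letters (set (letters r)) (letter_e r) J_left = set (highest_list r [1,2,3,4,5])"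
    and "graded_letters.highest_letters (set (letters r)) (letter_e r) J_right = set (highest_list r [2,3,4,5,6])"
    and "graded_letters.highest_letters (set (letters r)) (letter_e r) E6_index = {[0,0,0,0,0,0]}"
proof -
  have J: "J_left = set [1,2,3,4,5]" "J_right = set [2,3,4,5,6]" "E6_index = set [1,2,3,4,5,6]"
    by (auto simp: J_left_cases J_right_cases E6_index_cases)
  have E: "set [1,2,3,4,5] \<subseteq> E6_index" "set [2,3,4,5,6] \<subseteq> E6_index" "set [1,2,3,4,5,6] \<subseteq> E6_index"
    by (simp_all add: E6_index_set)
  show "graded_letters.highest_letters (set (letters r)) (letter_e r) J_left = set (highest_list r [1,2,3,4,5])"
    unfolding J(1) by (rule highest_letters_27[OF r E(1)])
  show "graded_letters.highest_letters (set (letters r)) (letter_e r) J_right = set (highest_list r [2,3,4,5,6])"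
    unfolding J(2) by (rule highest_letters_27[OF r E(2)])
  have "set (highest_list r [1,2,3,4,5,6]) = {[0,0,0,0,0,0]}" using r highest_lists(5,6) by auto
  then show "graded_letters.highest_letters (set (letters r)) (letter_e r) E6_index = {[0,0,0,0,0,0]}"
    using highest_letters_27[OF r E(3)] unfolding J(3) by simp
qed

lemma twisted_letters_27:
  assumes r: "r \<in> {1, 6}"
  shows "twisted_letters (set (letters r)) (letter_f r) (letter_e r) (letter_wt r) letter_depth (Lambda r) (letter_twist r)"
proof (intro twisted_letters.intro twisted_letters_axioms.intro graded_letters_27[OF r])
  interpret graded_letters "set (letters r)" "letter_f r" "letter_e r" "letter_wt r" letter_depth "Lambda r"
    by (rule graded_letters_27[OF r])
  have "check_twist r" using r letters_twist by auto
  then have dist: "distinct (map (letter_twist r) (letters r))"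
    and *: "\<And>a. a \<in> set (letters r) \<Longrightarrow> letter_twist r a \<in> set (letters r)
     \<and> (\<forall>i\<in>set [0,1,2,3,4,5,6]. letter_awt_eval r (pdot i) (letter_twist r a) = letter_awt_eval r i a)
     \<and> (\<forall>i\<in>set [1,2,3,4,5]. letter_twist r (inc 1 i a) = inc 1 (pdot i) (letter_twist r a)
         \<and> letter_twist r (inc (-1) i a) = inc (-1) (pdot i) (letter_twist r a))"
    unfolding check_twist_def list_all_iff by blast+
  have inj: "inj_on (letter_twist r) (set (letters r))" using dist by (simp add: distinct_map)
  show "bij_betw (letter_twist r) (set (letters r)) (set (letters r))"
  proof -
    have "letter_twist r ` set (letters r) \<subseteq> set (letters r)" using * by blast
    from endo_inj_surj[OF _ this inj] show ?thesis unfolding bij_betw_def using inj by simp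
  qed
  have awl_eval: "awl i a = letter_awt_eval r i a" if "i \<in> aff_index" for i a
  proof -
    have w: "letter_wt r 1 a = letter_wt_eval r 1 a" "letter_wt r 2 a = letter_wt_eval r 2 a" "letter_wt r 3 a = letter_wt_eval r 3 a"
      "letter_wt r 4 a = letter_wt_eval r 4 a" "letter_wt r 5 a = letter_wt_eval r 5 a" "letter_wt r 6 a = letter_wt_eval r 6 a"
      by (rule letter_wt_eval_eq, simp add: E6_index_set)+
    show ?thesis
    proof (cases "i = 0")
      case True
      show ?thesis unfolding True awl_def letter_awt_eval_def w by simp
    next
      case False
      then have "i \<in> E6_index" using that by (auto simp: aff_index_def E6_index_def)
      then show ?thesis using False letter_wt_eval_eq by (simp add: awl_def letter_awt_eval_def)
    qed
  qed
  show awl: "awl (pdot i) (letter_twist r a) = awl i a" if i: "i \<in> aff_index" and a: "a \<in> set (letters r)" for i a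
  proof -
    have "i \<in> set [0,1,2,3,4,5,6]" using i by (auto simp: aff_index_def)
    then have "letter_awt_eval r (pdot i) (letter_twist r a) = letter_awt_eval r i a" using *[OF a] by blast
    moreover have "pdot i \<in> aff_index" using pdot_diagram_automorphism(1) i by (auto simp: bij_betw_def)
    ultimately show ?thesis using awl_eval i by simp
  qed
  have wt: "letter_wt r (pdot i) (letter_twist r a) = letter_wt r i a" if i: "i \<in> J_left" and a: "a \<in> set (letters r)" for i a
  proof -
    have E: "i \<in> E6_index" "pdot i \<in> E6_index" using i J_E6 pdot_J(3) by auto
    then have "i \<in> aff_index" "i \<noteq> 0" "pdot i \<noteq> 0" by (auto simp: E6_index_def aff_index_def)
    then show ?thesis using awl[OF \<open>i \<in> aff_index\<close> a] by (simp add: awl_def)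
  qed
  have incs: "letter_twist r (inc 1 i a) = inc 1 (pdot i) (letter_twist r a)"
    "letter_twist r (inc (-1) i a) = inc (-1) (pdot i) (letter_twist r a)"
    if i: "i \<in> J_left" and a: "a \<in> set (letters r)" for i a
  proof -
    have "i \<in> set [1,2,3,4,5]" using i by (auto simp: J_left_cases)
    then show "letter_twist r (inc 1 i a) = inc 1 (pdot i) (letter_twist r a)"
      "letter_twist r (inc (-1) i a) = inc (-1) (pdot i) (letter_twist r a)" using *[OF a] by blast+
  qed
  show "letter_f r (pdot i) (letter_twist r a) = map_option (letter_twist r) (letter_f r i a)"
    "letter_e r (pdot i) (letter_twist r a) = map_option (letter_twist r) (letter_e r i a)"
    if i: "i \<in> J_left" and a: "a \<in> set (letters r)" for i a
  proof -
    have E: "i \<in> E6_index" "pdot i \<in> E6_index" using i J_E6 pdot_J(3) by auto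
    have len: "length a = 6" "length (letter_twist r a) = 6" using letters_closedD(1)[OF r] a *[OF a] by auto
    show "letter_f r (pdot i) (letter_twist r a) = map_option (letter_twist r) (letter_f r i a)"
      "letter_e r (pdot i) (letter_twist r a) = map_option (letter_twist r) (letter_e r i a)"
      using E len wt[OF i a] incs[OF i a] by (simp_all add: letter_f_def letter_e_def)
  qed
  have H: "highest_letters J_left = set (highest_list r [1,2,3,4,5])" "highest_letters J_right = set (highest_list r [2,3,4,5,6])"
    using highest_letters_J[OF r] by auto
  have HL: "set (highest_list r [1,2,3,4,5]) =
      (if r = 1 then {[0,0,0,0,0,0], [1,0,1,1,1,1], [2,2,3,4,3,2]} else {[0,0,0,0,0,0], [0,0,0,0,0,1], [0,1,1,2,2,2]})"
    and HR: "set (highest_list r [2,3,4,5,6]) =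
      (if r = 1 then {[0,0,0,0,0,0], [1,0,0,0,0,0], [2,1,2,2,1,0]} else {[0,0,0,0,0,0], [1,0,1,1,1,1], [2,2,3,4,3,2]})"
  proof -
    have "r = 1 \<or> r = 6" using r by simp
    then show "set (highest_list r [1,2,3,4,5]) =
      (if r = 1 then {[0,0,0,0,0,0], [1,0,1,1,1,1], [2,2,3,4,3,2]} else {[0,0,0,0,0,0], [0,0,0,0,0,1], [0,1,1,2,2,2]})"
      "set (highest_list r [2,3,4,5,6]) =
      (if r = 1 then {[0,0,0,0,0,0], [1,0,0,0,0,0], [2,1,2,2,1,0]} else {[0,0,0,0,0,0], [1,0,1,1,1,1], [2,2,3,4,3,2]})"
      by (elim disjE; simp only: highest_lists; simp)+
  qed
  have wt_eval: "letter_wt r j a = letter_wt_eval r j a" if "j \<in> J_left \<union> J_right" for j a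
    using that J_E6 by (intro letter_wt_eval_eq) auto
  show "geq a b \<longleftrightarrow> geq (letter_twist r b) (letter_twist r a)" if "a \<in> highest_letters J_left" "b \<in> highest_letters J_left" for a b
    using that r unfolding H HL
    by (auto simp: geq_def E6_index_set letter_depth_def letter_twist_def split: if_splits)
  show "letter_depth j a = 0" if "a \<in> highest_letters J_left" "j \<in> J_left" "letter_wt r j a = 1" for a j
  proof -
    have "j \<in> {1,2,3,4,5}" using that(2) by (auto simp: J_left_cases)
    moreover have "letter_wt_eval r j a = 1" using that(2,3) wt_eval[of j a] by simp
    ultimately show ?thesis using that(1) r unfolding H HL HR
      by (auto simp: letter_depth_def letter_wt_eval_def split: if_splits)
  qed
  show "letter_depth j a = 0" if "a \<in> highest_letters J_right" "j \<in> J_right" "letter_wt r j a = 1" for a j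
  proof -
    have "j \<in> {2,3,4,5,6}" using that(2) by (auto simp: J_right_cases)
    moreover have "letter_wt_eval r j a = 1" using that(2,3) wt_eval[of j a] by simp
    ultimately show ?thesis using that(1) r unfolding H HL HR
      by (auto simp: letter_depth_def letter_wt_eval_def split: if_splits)
  qed
  show "\<exists>a b c i j. i \<in> E6_index \<and> j \<in> E6_index \<and> b \<noteq> c \<and> a \<noteq> b \<and> a \<noteq> c \<and> highest_letters J_right = {a, b, c} \<and>
      (\<forall>d\<in>{a, b, c}. letter_wt r i d = (if d = b then 1 else 0) \<and> letter_wt r j d = (if d = c then 1 else 0))"
  proof (cases "r = 1")
    case True
    have w: "letter_wt r 3 d = letter_wt_eval r 3 d" "letter_wt r 6 d = letter_wt_eval r 6 d" for d
      by (rule letter_wt_eval_eq; simp add: E6_index_set)+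
    have HR1: "highest_letters J_right = {[0,0,0,0,0,0], [1,0,0,0,0,0], [2,1,2,2,1,0]}"
      unfolding H HR using True by simp
    show ?thesis unfolding HR1
      by (rule exI[of _ "[0,0,0,0,0,0]"], rule exI[of _ "[1,0,0,0,0,0]"], rule exI[of _ "[2,1,2,2,1,0]"],
          rule exI[of _ 3], rule exI[of _ 6])
        (use w True in \<open>auto simp: E6_index_set letter_wt_eval_def\<close>)
  next
    case False
    then have True: "r = 6" using r by simp
    have w: "letter_wt r 6 d = letter_wt_eval r 6 d" "letter_wt r 2 d = letter_wt_eval r 2 d" for d
      by (rule letter_wt_eval_eq; simp add: E6_index_set)+
    have HR6: "highest_letters J_right = {[2,2,3,4,3,2], [0,0,0,0,0,0], [1,0,1,1,1,1]}"
      unfolding H HR using True by auto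
    show ?thesis unfolding HR6
      by (rule exI[of _ "[2,2,3,4,3,2]"], rule exI[of _ "[0,0,0,0,0,0]"], rule exI[of _ "[1,0,1,1,1,1]"],
          rule exI[of _ 6], rule exI[of _ 2])
        (use w True in \<open>auto simp: E6_index_set letter_wt_eval_def\<close>)
  qed
qed

theorem theorem3p13:
  fixes scale :: "Qq \<Rightarrow> 'v \<Rightarrow> 'v::ab_group_add"
    and E F K :: "nat \<Rightarrow> 'v \<Rightarrow> 'v"
    and r s :: nat and u :: 'v and L :: "'v set" and B :: "'v set set"
    and C :: "'v set crystal"
  assumes "r \<in> {1, 6}" and "s \<ge> 1"
    and "highest_weight_crystal_base scale E F K (\<lambda>i. int s * Lambda r i) u L B"
    and "C = Uq_E6_module.crystal_of scale E F K L B"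
  shows "\<exists>!p. p \<in> extensional (nodes0 C) \<and>
           twisted_isomorphism pdot C C p \<and>
           (\<forall>b\<in>nodes C. \<forall>i\<in>aff_index. aff_wt C (pdot i) (the (p (Some b))) = aff_wt C i b)"
proof -
  interpret T: twisted_letters "set (letters r)" "letter_f r" "letter_e r" "letter_wt r" letter_depth "Lambda r" "letter_twist r"
    by (rule twisted_letters_27[OF assms(1)])
  let ?t = "[0,0,0,0,0,0] :: int list"
  note top = highest_letters_J(3)[OF assms(1)]
  have depth_top: "letter_depth j ?t = 0" if "j \<in> E6_index" for j
    using that by (auto simp: letter_depth_def E6_index_set)
  note std = T.standard_component[OF top depth_top, of s]
  have "word_model scale E F K (\<lambda>i. int s * Lambda r i) u L B (set (letters r)) (letter_f r) (letter_e r) (letter_wt r) s (replicate s ?t)"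
  proof (intro word_model.intro assms(3) T.letter_crystal_axioms word_model_axioms.intro)
    show "replicate s ?t \<in> T.Words s" by (rule T.standard_Words[OF std(1)])
    show "letter_e r i a = None" if "a \<in> set (replicate s ?t)" "i \<in> E6_index" for a i
    proof -
      have "a \<in> T.highest_letters E6_index" using that(1) top by simp
      then show ?thesis using that(2) by (simp add: T.highest_letters_def)
    qed
    show "T.ww i (replicate s ?t) = int s * Lambda r i" if i: "i \<in> E6_index" for i
    proof -
      have "letter_wt r i ?t = Lambda r i" using depth_top by (simp add: letter_wt_def)
      then show ?thesis by (simp add: T.ww_def map_replicate sum_list_replicate)
    qed
  qed
  then interpret M: word_model scale E F K "\<lambda>i. int s * Lambda r i" u L B "set (letters r)" "letter_f r" "letter_e r" "letter_wt r" s "replicate s ?t" .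
  have comp: "M.component = T.standard s" using std(2) unfolding M.component_def by (rule sym)
  have nodes: "nodes C = B" "nodes0 C = insert None (Some ` B)"
    unfolding assms(4) nodes0_def by (simp_all add: M.crystal_of_def)
  show ?thesis
  proof (rule T.unique_twisted_isomorphism[of M.word_of C s])
    show "bij_betw M.word_of (nodes C) (T.standard s)"
      unfolding nodes comp[symmetric] by (rule M.word_of_bij)
    fix i b assume i: "i \<in> E6_index" and b: "b \<in> nodes C"
    have b: "b \<in> B" using b nodes by simp
    show "f_op C i b \<in> nodes0 C" "map_option M.word_of (f_op C i b) = T.word_f i (M.word_of b)"
      unfolding nodes(2) unfolding assms(4) by (rule M.word_of_f[OF i b])+
    show "e_op C i b \<in> nodes0 C" "map_option M.word_of (e_op C i b) = T.word_e i (M.word_of b)"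
      unfolding nodes(2) unfolding assms(4) by (rule M.word_of_e[OF i b])+
    show "wt C i b = T.ww i (M.word_of b)"
      unfolding assms(4) by (rule M.word_of_weight[OF i b])
  qed
qed

end
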